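(* Let $\overline{D}\subset\mathbb{C}$ be a closed disc with centre at $0$, let $0<\alpha<1$, and let $F:\overline{D}\to\mathbb{C}$ be a function of Hölder class $\mathcal{C}^\alpha(\overline{D})$. Assume that there exist a nowhere-dense subset $E\subset\overline{D}$, a nowhere-vanishing function $A\in\mathcal{O}(\overline{D})$, constants $M>0$, $K>0$, and a number $\nu\geq 1$ such that for each $\zeta\in\overline{D}\setminus E$ there exist - a function $G_\zeta\in\mathcal{O}_\zeta(\overline{D})$ satisfying $|z-\zeta|^{-1}|G_\zeta(z)|\leq M$ for all $z\in\overline{D}\setminus\{\zeta\}$, and - a constant $C_\zeta\in\mathbb{C}$ with $|C_\zeta|=1$, so that $$C_\zeta\,(z-\zeta)\bigl(A(z)F(z)-A(\zeta)F(\zeta)+G_\zeta(z)\bigr)\in\left\{u+iv\in\mathbb{C}: u\geq 0,\ |v|\leq K u^{1/\nu}\right\}\quad\text{for all } z\in\overline{D}.$$ Then the graph $\Gamma_{\overline{D}}(F)$ is polynomially convex. If, additionally, $F\in\mathcal{C}^1(\overline{D})$ and the set $\{z\in\overline{D}:\partial F/\partial\overline{z}\,(z)=0\}$ is nowhere dense and finitely connected, then $[z,F]_{\overline{D}}=\mathcal{C}(\overline{D})$.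
   Context: $\mathcal{O}(\overline{D})$ is the set of functions that are holomorphic on some (not necessarily fixed) open neighbourhood of $\overline{D}$; for $\zeta\in\overline{D}$, $\mathcal{O}_\zeta(\overline{D})$ is the set of functions in $\mathcal{O}(\overline{D})$ that vanish at $\zeta$. $\Gamma_{\overline{D}}(F):=\{(z,F(z)):z\in\overline{D}\}\subset\mathbb{C}^2$. A compact set $X\subset\mathbb{C}^n$ is polynomially convex if it equals its polynomially convex hull $\widehat{X}=\{x\in\mathbb{C}^n: |p(x)|\leq\sup_X|p| \text{ for every holomorphic polynomial } p\}$. $[z,F]_{\overline{D}}$ denotes the uniform algebra on $\overline{D}$ generated by $z$ and $F$, i.e. the closure in $\mathcal{C}(\overline{D})$ (complex-valued continuous functions, sup norm) of the polynomials in $z$ and $F$. $\mathcal{C}^1(\overline{D})$ denotes the complex-valued functions that are continuously differentiable (in the real sense) up to the boundary. A subset $S\subset\mathbb{C}$ is finitely connected if $\widehat{\mathbb{C}}\setminus S$ has finitely many connected components, where $\widehat{\mathbb{C}}$ is the one-point compactification of $\mathbb{C}$. *)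

theory Defs
  imports "HOL-Analysis.Analysis"
begin

definition hol_on_closed :: "complex set \<Rightarrow> (complex \<Rightarrow> complex) set" where
  "hol_on_closed S = {f. \<exists>U. open U \<and> S \<subseteq> U \<and> f holomorphic_on U}"

definition hol_on_closed_zero :: "complex set \<Rightarrow> complex \<Rightarrow> (complex \<Rightarrow> complex) set" where
  "hol_on_closed_zero S \<zeta> = {f \<in> hol_on_closed S. f \<zeta> = 0}"

definition holder_on :: "real \<Rightarrow> complex set \<Rightarrow> (complex \<Rightarrow> complex) \<Rightarrow> bool" where
  "holder_on \<alpha> S f \<longleftrightarrow>
     (\<exists>L. \<forall>z\<in>S. \<forall>w\<in>S. norm (f z - f w) \<le> L * norm (z - w) powr \<alpha>)"

(* For subsets of a closed disc of positive radius it makes no difference whether nowhere density is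
   understood in the disc or, as here, in the whole space. *)
definition nowhere_dense :: "'a::topological_space set \<Rightarrow> bool" where
  "nowhere_dense E \<longleftrightarrow> interior (closure E) = {}"

(* The monomials are indexed by their exponent vectors m. *)
definition hol_polynomial :: "(complex ^ 'n \<Rightarrow> complex) \<Rightarrow> bool" where
  "hol_polynomial p \<longleftrightarrow>
     (\<exists>(M :: ('n \<Rightarrow> nat) set) c. finite M \<and>
        p = (\<lambda>x. \<Sum>m\<in>M. c m * (\<Prod>i\<in>UNIV. (x $ i) ^ m i)))"

(* Only used for compact X, where the supremum is that of a bounded set. *)
definition poly_hull :: "(complex ^ 'n) set \<Rightarrow> (complex ^ 'n) set" where
  "poly_hull X = {x. \<forall>p. hol_polynomial p \<longrightarrow> norm (p x) \<le> (SUP y\<in>X. norm (p y))}"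

definition polynomially_convex :: "(complex ^ 'n) set \<Rightarrow> bool" where
  "polynomially_convex X \<longleftrightarrow> compact X \<and> poly_hull X = X"

definition graph_on :: "complex set \<Rightarrow> (complex \<Rightarrow> complex) \<Rightarrow> (complex ^ 2) set" where
  "graph_on S f = {vector [z, f z] | z. z \<in> S}"

(* C(S) is represented by total functions whose values off S are arbitrary; membership of a
   function in either of the next two sets depends only on its restriction to S, so equality of the
   sets is equality of the corresponding spaces of functions on S. *)
definition cont_funs :: "complex set \<Rightarrow> (complex \<Rightarrow> complex) set" where
  "cont_funs S = {h. continuous_on S h}"

definition uniform_algebra_gen ::
    "complex set \<Rightarrow> (complex \<Rightarrow> complex) \<Rightarrow> (complex \<Rightarrow> complex) \<Rightarrow> (complex \<Rightarrow> complex) set" where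
  "uniform_algebra_gen S f g =
     {h \<in> cont_funs S. \<forall>\<epsilon>>0. \<exists>p :: complex ^ 2 \<Rightarrow> complex. hol_polynomial p \<and>
        (\<forall>z\<in>S. norm (h z - p (vector [f z, g z])) < \<epsilon>)}"

(* Real differentiability relative to S, one-sided at boundary points.  The derivative within S is
   unique when S is a closed disc of positive radius. *)
definition C1_on :: "complex set \<Rightarrow> (complex \<Rightarrow> complex) \<Rightarrow> bool" where
  "C1_on S f \<longleftrightarrow> f differentiable_on S \<and>
     (\<forall>v. continuous_on S (\<lambda>z. frechet_derivative f (at z within S) v))"

definition dbar :: "complex set \<Rightarrow> (complex \<Rightarrow> complex) \<Rightarrow> complex \<Rightarrow> complex" where
  "dbar S f z = (frechet_derivative f (at z within S) 1
                 + \<i> * frechet_derivative f (at z within S) \<i>) / 2"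

(* The one-point compactification of the plane; None is the point at infinity. *)
definition riemann_sphere :: "complex option topology" where
  "riemann_sphere = topology (\<lambda>U. open (Some -` U) \<and> (None \<in> U \<longrightarrow> compact (- (Some -` U))))"

lemma openin_riemann_sphere:
  "openin riemann_sphere U \<longleftrightarrow> open (Some -` U) \<and> (None \<in> U \<longrightarrow> compact (- (Some -` U)))"
proof -
  have "istopology (\<lambda>U :: complex option set.
          open (Some -` U) \<and> (None \<in> U \<longrightarrow> compact (- (Some -` U))))"
    unfolding istopology_def
  proof (rule conjI; intro allI impI)
    fix U V :: "complex option set"
    assume "open (Some -` U) \<and> (None \<in> U \<longrightarrow> compact (- (Some -` U)))"
      and "open (Some -` V) \<and> (None \<in> V \<longrightarrow> compact (- (Some -` V)))"
    then show "open (Some -` (U \<inter> V)) \<and> (None \<in> U \<inter> V \<longrightarrow> compact (- (Some -` (U \<inter> V))))"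
      by (auto simp: vimage_Int Compl_Int)
  next
    fix \<U> :: "complex option set set"
    assume *: "\<forall>U\<in>\<U>. open (Some -` U) \<and> (None \<in> U \<longrightarrow> compact (- (Some -` U)))"
    have op: "open (Some -` \<Union>\<U>)"
      using * by (auto simp: vimage_Union)
    moreover have "compact (- (Some -` \<Union>\<U>))" if inf: "None \<in> \<Union>\<U>"
    proof -
      obtain U where U: "U \<in> \<U>" "None \<in> U" using inf by blast
      then have "compact (- (Some -` U))" using * by blast
      moreover have "- (Some -` \<Union>\<U>) = - (Some -` U) \<inter> - (Some -` \<Union>\<U>)"
        using U by auto
      moreover have "closed (- (Some -` \<Union>\<U>))" using op by (simp add: closed_Compl)
      ultimately show ?thesis by (metis compact_Int_closed)
    qed
    ultimately show "open (Some -` \<Union>\<U>) \<and> (None \<in> \<Union>\<U> \<longrightarrow> compact (- (Some -` \<Union>\<U>)))"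
      by blast
  qed
  then show ?thesis by (simp add: riemann_sphere_def)
qed

lemma topspace_riemann_sphere [simp]: "topspace riemann_sphere = UNIV"
proof -
  have "openin riemann_sphere UNIV" by (simp add: openin_riemann_sphere)
  then show ?thesis using openin_subset by blast
qed

definition finitely_connected :: "complex set \<Rightarrow> bool" where
  "finitely_connected S \<longleftrightarrow>
     finite (connected_components_of (subtopology riemann_sphere (- (Some ` S))))"

end

theory Submission
  imports Defs "HOL-Complex_Analysis.Complex_Analysis" "HOL-Real_Asymp.Real_Asymp"
begin

no_notation fps_nth (infixl "$" 75)

text \<open>Put f = A F - A(w) F(w) + G and H = C (z - w) f. The functions f exp (-t H) belong to the algebra
  of the graph, and the parabolic region containing the values of H makes them small on the graph when t is
  large, whereas at a point of the hull lying over w they keep the value of f up to a small error. So f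
  vanishes there, i.e. the point is on the graph; exceptional w are approached from outside E.

  Now let F be continuously differentiable, let D be the disc, let a complex measure mu annihilate the
  algebra and let C mu be its Cauchy transform. Dilating F and integrating by parts, the density
  h = (dF/d(cnj z)) (C mu) on D annihilates the algebra as well. For w in D the functions
  (1 - exp (-t H)) / (z - w) are in the algebra, bounded by a multiple of 1 / |z - w| and, as t grows,
  tend to 1 / (z - w) off the zeros of f, while at almost all of these zeros dF/d(cnj z) = 0 and hence
  h = 0. So the Cauchy transform of h vanishes and therefore h = 0 almost everywhere: C mu = 0 almost
  everywhere off the critical set Z. It follows that mu is carried by Z and annihilates the functions
  holomorphic near Z. Every w in Z is in the closure of one of the finitely many components of the
  complement of Z, so 1 / (z - w) is the limit of such functions, bounded by a multiple of 1 / |z - w|;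
  they are built from the square root of a Moebius transformation with both branch points in that component.
  Thus C mu = 0 almost everywhere, mu = 0, and the algebra is dense by Hahn--Banach and Riesz.\<close>

section \<open>Uniform limits of polynomials\<close>

text \<open>A nowhere dense set can have positive area, so neither \<open>E\<close> nor the critical
  set Z may be discarded as a null set. This shapes both halves of the density argument. The
  hypothesis speaks only of points off \<open>E\<close>, but the Cauchy transform of the density h
  has to vanish at almost every w in D. At w in \<open>E\<close> the data at nearby points off
  \<open>E\<close> are therefore passed to a limit: the uniform constant \<open>M\<close> makes the
  functions \<open>G\<close> a normal family, and the region is closed, so the limit still satisfies
  Re H > 0 unless H = 0. Such a limit is holomorphic in the open disc only, and its H may leave the
  algebra; hence t stays fixed while the points converge and tends to infinity afterwards.

  On Z, vanishing of C mu off Z gives no direct information. The measure carried by Z is unknown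
  apart from its annihilating property, so limits of kernels can be taken only by dominated
  convergence, and the multiple of 1 / |z - w| must not depend on the stage of the approximation. An
  absolute constant is available because both branch points lie at distances from w that shrink to 0
  inside one and the same component.\<close>

lemma hol_polynomial_monomial: "hol_polynomial (\<lambda>x. a * (\<Prod>i\<in>UNIV. (x $ i) ^ m i))"
  unfolding hol_polynomial_def by (rule exI[of _ "{m}"], rule exI[of _ "\<lambda>_. a"]) simp

lemma hol_polynomial_const: "hol_polynomial (\<lambda>x. a)"
  using hol_polynomial_monomial[of a "\<lambda>_. 0"] by simp

lemma hol_polynomial_proj: "hol_polynomial (\<lambda>x. x $ i)"
proof -
  have "(\<Prod>j\<in>UNIV. (x $ j) ^ (if j = i then 1 else 0)) = x $ i" for x :: "complex ^ 'a"
  proof -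
    have "(\<Prod>j\<in>UNIV. (x $ j) ^ (if j = i then 1 else 0)) = (\<Prod>j\<in>UNIV. if j = i then x $ j else 1)"
      by (rule prod.cong) auto
    then show ?thesis by simp
  qed
  then show ?thesis
    using hol_polynomial_monomial[of 1 "\<lambda>j. if j = i then 1 else 0"] by simp
qed

lemma hol_polynomial_add:
  assumes "hol_polynomial p" "hol_polynomial q"
  shows "hol_polynomial (\<lambda>x. p x + q x)"
proof -
  obtain M c where M: "finite M" and p: "p = (\<lambda>x. \<Sum>m\<in>M. c m * (\<Prod>i\<in>UNIV. (x $ i) ^ m i))"
    using assms(1) unfolding hol_polynomial_def by blast
  obtain N d where N: "finite N" and q: "q = (\<lambda>x. \<Sum>m\<in>N. d m * (\<Prod>i\<in>UNIV. (x $ i) ^ m i))"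
    using assms(2) unfolding hol_polynomial_def by blast
  have p': "p x = (\<Sum>m\<in>M\<union>N. (if m \<in> M then c m else 0) * (\<Prod>i\<in>UNIV. (x $ i) ^ m i))" for x
    unfolding p by (rule sum.mono_neutral_cong_left) (use M N in auto)
  have q': "q x = (\<Sum>m\<in>M\<union>N. (if m \<in> N then d m else 0) * (\<Prod>i\<in>UNIV. (x $ i) ^ m i))" for x
    unfolding q by (rule sum.mono_neutral_cong_left) (use M N in auto)
  show ?thesis
    unfolding hol_polynomial_def
    by (rule exI[of _ "M \<union> N"],
        rule exI[of _ "\<lambda>m. (if m \<in> M then c m else 0) + (if m \<in> N then d m else 0)"])
       (use M N in \<open>simp add: p' q' fun_eq_iff distrib_right sum.distrib\<close>)
qed

lemma hol_polynomial_sum: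
  "(\<And>i. i \<in> I \<Longrightarrow> hol_polynomial (p i)) \<Longrightarrow> hol_polynomial (\<lambda>x. \<Sum>i\<in>I. p i x)"
  by (induction I rule: infinite_finite_induct)
     (auto simp: hol_polynomial_const intro: hol_polynomial_add)

lemma hol_polynomial_mult:
  assumes "hol_polynomial p" "hol_polynomial q"
  shows "hol_polynomial (\<lambda>x. p x * q x)"
proof -
  obtain M c where p: "p = (\<lambda>x. \<Sum>m\<in>M. c m * (\<Prod>i\<in>UNIV. (x $ i) ^ m i))"
    using assms(1) unfolding hol_polynomial_def by blast
  obtain N d where q: "q = (\<lambda>x. \<Sum>m\<in>N. d m * (\<Prod>i\<in>UNIV. (x $ i) ^ m i))"
    using assms(2) unfolding hol_polynomial_def by blast
  have "hol_polynomial (\<lambda>x. (c m * (\<Prod>i\<in>UNIV. (x $ i) ^ m i)) * (d n * (\<Prod>i\<in>UNIV. (x $ i) ^ n i)))"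
    for m n
    using hol_polynomial_monomial[of "c m * d n" "\<lambda>i. m i + n i"]
    by (simp add: power_add prod.distrib mult_ac)
  then show ?thesis
    unfolding p q sum_product by (intro hol_polynomial_sum)
qed

lemma continuous_on_hol_polynomial: "hol_polynomial p \<Longrightarrow> continuous_on S p"
  unfolding hol_polynomial_def by (auto intro!: continuous_intros)

text \<open>The uniform algebra P(Y), its members kept as total functions whose values off
  \<open>Y\<close> are arbitrary. The set \<open>Y\<close> is a parameter because the hull argument
  adjoins a hull point to the graph.\<close>

definition poly_closure :: "(complex ^ 'n) set \<Rightarrow> (complex ^ 'n \<Rightarrow> complex) set" where
  "poly_closure Y = {h. \<forall>\<epsilon>>0. \<exists>p. hol_polynomial p \<and> (\<forall>y\<in>Y. norm (h y - p y) < \<epsilon>)}"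

lemma poly_closureD:
  assumes "h \<in> poly_closure Y" "\<epsilon> > 0"
  obtains p where "hol_polynomial p" "\<And>y. y \<in> Y \<Longrightarrow> norm (h y - p y) < \<epsilon>"
  using assms unfolding poly_closure_def by blast

lemma poly_closure_polynomial: "hol_polynomial p \<Longrightarrow> p \<in> poly_closure Y"
  unfolding poly_closure_def by auto

lemma poly_closure_uniform_limit:
  assumes "\<And>\<epsilon>. \<epsilon> > 0 \<Longrightarrow> \<exists>g\<in>poly_closure Y. \<forall>y\<in>Y. norm (h y - g y) < \<epsilon>"
  shows "h \<in> poly_closure Y"
  unfolding poly_closure_def
proof safe
  fix \<epsilon> :: real assume "\<epsilon> > 0"
  then obtain g where g: "g \<in> poly_closure Y" "\<forall>y\<in>Y. norm (h y - g y) < \<epsilon>/2"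
    using assms[of "\<epsilon>/2"] by auto
  obtain p where p: "hol_polynomial p" "\<And>y. y \<in> Y \<Longrightarrow> norm (g y - p y) < \<epsilon>/2"
    using poly_closureD[OF g(1), of "\<epsilon>/2"] \<open>\<epsilon> > 0\<close> by auto
  have "norm (h y - p y) < \<epsilon>" if "y \<in> Y" for y
    using norm_triangle_lt[of "h y - g y" "g y - p y" \<epsilon>] g(2) p(2)[OF that] that by force
  then show "\<exists>p. hol_polynomial p \<and> (\<forall>y\<in>Y. norm (h y - p y) < \<epsilon>)" using p(1) by blast
qed

lemma poly_closure_add:
  assumes "f \<in> poly_closure Y" "g \<in> poly_closure Y"
  shows "(\<lambda>y. f y + g y) \<in> poly_closure Y"
  unfolding poly_closure_def
proof safe
  fix \<epsilon> :: real assume "\<epsilon> > 0"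
  obtain p where p: "hol_polynomial p" "\<And>y. y \<in> Y \<Longrightarrow> norm (f y - p y) < \<epsilon>/2"
    using poly_closureD[OF assms(1), of "\<epsilon>/2"] \<open>\<epsilon> > 0\<close> by auto
  obtain q where q: "hol_polynomial q" "\<And>y. y \<in> Y \<Longrightarrow> norm (g y - q y) < \<epsilon>/2"
    using poly_closureD[OF assms(2), of "\<epsilon>/2"] \<open>\<epsilon> > 0\<close> by auto
  have "norm (f y + g y - (p y + q y)) < \<epsilon>" if "y \<in> Y" for y
    using norm_triangle_lt[of "f y - p y" "g y - q y" \<epsilon>] p(2)[OF that] q(2)[OF that]
    by (simp add: algebra_simps)
  then show "\<exists>p. hol_polynomial p \<and> (\<forall>y\<in>Y. norm (f y + g y - p y) < \<epsilon>)"
    using hol_polynomial_add[OF p(1) q(1)] by blast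
qed

lemma poly_closure_bounded:
  assumes "compact Y" "h \<in> poly_closure Y"
  shows "\<exists>B>0. \<forall>y\<in>Y. norm (h y) \<le> B"
proof -
  obtain p where p: "hol_polynomial p" "\<And>y. y \<in> Y \<Longrightarrow> norm (h y - p y) < 1"
    using poly_closureD[OF assms(2), of 1] by auto
  have "bounded (p ` Y)"
    using compact_continuous_image[OF continuous_on_hol_polynomial[OF p(1)] assms(1)]
    by (rule compact_imp_bounded)
  then obtain B where B: "B > 0" "\<And>y. y \<in> Y \<Longrightarrow> norm (p y) \<le> B"
    unfolding bounded_pos by auto
  have "norm (h y) \<le> B + 1" if "y \<in> Y" for y
    using norm_triangle_ineq[of "h y - p y" "p y"] p(2)[OF that] B(2)[OF that] by simp
  then show ?thesis using B(1) by (intro exI[of _ "B + 1"]) auto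
qed

lemma poly_closure_mult:
  assumes Y: "compact Y" and f: "f \<in> poly_closure Y" and g: "g \<in> poly_closure Y"
  shows "(\<lambda>y. f y * g y) \<in> poly_closure Y"
  unfolding poly_closure_def
proof safe
  fix \<epsilon> :: real assume e: "\<epsilon> > 0"
  obtain B where B: "B > 0" "\<And>y. y \<in> Y \<Longrightarrow> norm (g y) \<le> B"
    using poly_closure_bounded[OF Y g] by blast
  obtain p where p: "hol_polynomial p" "\<And>y. y \<in> Y \<Longrightarrow> norm (f y - p y) < \<epsilon>/(2*B)"
    using poly_closureD[OF f, of "\<epsilon>/(2*B)"] e B by auto
  \<comment> \<open>\<open>q\<close> is chosen after \<open>p\<close>: its accuracy is measured
    against the size of the approximant \<open>p\<close>.\<close>
  obtain B' where B': "B' > 0" "\<And>y. y \<in> Y \<Longrightarrow> norm (p y) \<le> B'"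
    using poly_closure_bounded[OF Y poly_closure_polynomial[OF p(1)]] by blast
  obtain q where q: "hol_polynomial q" "\<And>y. y \<in> Y \<Longrightarrow> norm (g y - q y) < \<epsilon>/(2*B')"
    using poly_closureD[OF g, of "\<epsilon>/(2*B')"] e B' by auto
  have "norm (f y * g y - p y * q y) < \<epsilon>" if y: "y \<in> Y" for y
  proof -
    have "norm ((f y - p y) * g y) \<le> norm (f y - p y) * B"
      using B(2)[OF y] by (simp add: norm_mult mult_left_mono)
    also have "\<dots> < \<epsilon>/2"
      using p(2)[OF y] B(1) by (simp add: field_simps)
    finally have 1: "norm ((f y - p y) * g y) < \<epsilon>/2" .
    have "norm (p y * (g y - q y)) \<le> B' * norm (g y - q y)"
      using B'(2)[OF y] by (simp add: norm_mult mult_right_mono)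
    also have "\<dots> < \<epsilon>/2"
      using q(2)[OF y] B'(1) by (simp add: field_simps)
    finally have 2: "norm (p y * (g y - q y)) < \<epsilon>/2" .
    have "f y * g y - p y * q y = (f y - p y) * g y + p y * (g y - q y)"
      by (simp add: algebra_simps)
    then show ?thesis
      using norm_triangle_lt[of "(f y - p y) * g y" "p y * (g y - q y)" \<epsilon>] 1 2 by simp
  qed
  then show "\<exists>p. hol_polynomial p \<and> (\<forall>y\<in>Y. norm (f y * g y - p y) < \<epsilon>)"
    using hol_polynomial_mult[OF p(1) q(1)] by blast
qed

lemma poly_closure_const: "(\<lambda>y. a) \<in> poly_closure Y"
  by (intro poly_closure_polynomial hol_polynomial_const)

lemma poly_closure_proj: "(\<lambda>y. y $ i) \<in> poly_closure Y"
  by (intro poly_closure_polynomial hol_polynomial_proj)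

lemma poly_closure_diff:
  assumes "compact Y" "f \<in> poly_closure Y" "g \<in> poly_closure Y"
  shows "(\<lambda>y. f y - g y) \<in> poly_closure Y"
  using poly_closure_add[OF assms(2) poly_closure_mult[OF assms(1) poly_closure_const[of "-1"] assms(3)]]
  by simp

lemma poly_closure_sum:
  "(\<And>i. i \<in> I \<Longrightarrow> f i \<in> poly_closure Y) \<Longrightarrow> (\<lambda>y. \<Sum>i\<in>I. f i y) \<in> poly_closure Y"
  by (induction I rule: infinite_finite_induct)
     (auto simp: poly_closure_const intro: poly_closure_add)

lemma poly_closure_power:
  assumes "compact Y" "f \<in> poly_closure Y"
  shows "(\<lambda>y. f y ^ n) \<in> poly_closure Y"
  by (induction n) (auto intro: poly_closure_const poly_closure_mult[OF assms(1)] assms(2))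

text \<open>The values of \<open>h\<close> lie in the closed disc of radius \<open>R'\<close>, where
  the Taylor polynomials of \<open>g\<close> at 0 converge uniformly. The gap between
  \<open>R'\<close> and \<open>R\<close> leaves room for a larger radius at which the series
  converges, and this forces absolute convergence at \<open>R'\<close>.\<close>

lemma poly_closure_holomorphic:
  assumes Y: "compact Y" and h: "h \<in> poly_closure Y"
    and g: "g holomorphic_on ball 0 R" and R': "R' < R" "\<And>y. y \<in> Y \<Longrightarrow> norm (h y) \<le> R'"
  shows "(\<lambda>y. g (h y)) \<in> poly_closure Y"
proof (cases "Y = {}")
  case True
  then show ?thesis using hol_polynomial_const by (auto simp: poly_closure_def)
next
  case False
  then have R'0: "0 \<le> R'" using R'(2) norm_ge_zero order_trans by blast
  define a where "a n = (deriv ^^ n) g 0 / fact n" for n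
  have sums: "(\<lambda>n. a n * w ^ n) sums g w" if "norm w < R" for w
    using holomorphic_power_series[OF g, of w] that by (simp add: a_def)
  define \<rho> where "\<rho> = (R' + R) / 2"
  have \<rho>: "0 \<le> \<rho>" "R' < \<rho>" "\<rho> < R" using R'0 R'(1) by (auto simp: \<rho>_def)
  have "summable (\<lambda>n. a n * of_real \<rho> ^ n)"
    using sums[of "of_real \<rho>"] \<rho> by (simp add: sums_iff)
  then have "summable (\<lambda>n. norm (a n * of_real R' ^ n))"
    by (rule powser_insidea) (use R'0 \<rho> in auto)
  then have summ: "summable (\<lambda>n. norm (a n) * R' ^ n)"
    using R'0 by (simp add: norm_mult norm_power)
  have "uniform_limit (cball 0 R') (\<lambda>n w. \<Sum>i<n. a i * w ^ i) (\<lambda>w. suminf (\<lambda>i. a i * w ^ i)) sequentially"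
    by (rule Weierstrass_m_test[OF _ summ])
       (auto simp: norm_mult norm_power intro!: mult_left_mono power_mono)
  then have ul: "uniform_limit (cball 0 R') (\<lambda>n w. \<Sum>i<n. a i * w ^ i) g sequentially"
    by (rule uniform_limit_cong'[THEN iffD1, rotated -1])
       (use sums R'(1) in \<open>auto simp: sums_iff\<close>)
  show ?thesis
  proof (rule poly_closure_uniform_limit)
    fix \<epsilon> :: real assume "\<epsilon> > 0"
    then have "\<forall>\<^sub>F n in sequentially. \<forall>w\<in>cball 0 R'. dist (\<Sum>i<n. a i * w ^ i) (g w) < \<epsilon>"
      using ul by (simp add: uniform_limit_iff)
    then obtain n where n: "\<forall>w\<in>cball 0 R'. dist (\<Sum>i<n. a i * w ^ i) (g w) < \<epsilon>"
      by (auto simp: eventually_sequentially)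
    have "(\<lambda>y. \<Sum>i<n. a i * h y ^ i) \<in> poly_closure Y"
      by (intro poly_closure_sum poly_closure_mult poly_closure_const poly_closure_power Y h)
    then show "\<exists>k\<in>poly_closure Y. \<forall>y\<in>Y. norm (g (h y) - k y) < \<epsilon>"
      using n R'(2) by (intro bexI[of _ "\<lambda>y. \<Sum>i<n. a i * h y ^ i"]) (auto simp: dist_norm norm_minus_commute)
  qed
qed

lemma poly_closure_entire:
  assumes "compact Y" "h \<in> poly_closure Y" "g holomorphic_on UNIV"
  shows "(\<lambda>y. g (h y)) \<in> poly_closure Y"
proof -
  obtain B where "\<And>y. y \<in> Y \<Longrightarrow> norm (h y) \<le> B"
    using poly_closure_bounded[OF assms(1,2)] by blast
  then show ?thesis
    using poly_closure_holomorphic[OF assms(1,2), of g "B + 1" B] assms(3)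
    by (meson holomorphic_on_subset less_add_one subset_UNIV)
qed

text \<open>By compactness a neighbourhood of a closed disc about 0 contains a larger concentric
  disc, so one power series about 0 represents the function past the disc.\<close>

lemma poly_closure_hol_on_closed:
  assumes "compact Y" "g \<in> hol_on_closed (cball 0 r)" "\<And>y. y \<in> Y \<Longrightarrow> norm (y $ i) \<le> r"
  shows "(\<lambda>y. g (y $ i)) \<in> poly_closure Y"
proof -
  obtain U where U: "open U" "cball 0 r \<subseteq> U" "g holomorphic_on U"
    using assms(2) unfolding hol_on_closed_def by blast
  obtain e where e: "e > 0" "(\<Union>x\<in>cball 0 r. cball x e) \<subseteq> U"
    using compact_subset_open_imp_cball_epsilon_subset[OF compact_cball U(1,2)] by blast
  have "ball (0::complex) (r + e) \<subseteq> (\<Union>x\<in>cball 0 r. cball x e)" if r: "r \<ge> 0"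
  proof
    fix z :: complex assume z: "z \<in> ball 0 (r + e)"
    \<comment> \<open>\<open>x\<close> is the radial projection of \<open>z\<close> to the closed
      disc.\<close>
    define x where "x = (if norm z \<le> r then z else of_real (r / norm z) * z)"
    have "norm x \<le> r" using r by (auto simp: x_def norm_mult norm_divide)
    moreover have "dist x z \<le> e"
    proof (cases "norm z \<le> r")
      case False
      then have "norm z > 0" using r by linarith
      have "x - z = of_real (r / norm z - 1) * z" using False by (simp add: x_def algebra_simps)
      then have "norm (x - z) = \<bar>r / norm z - 1\<bar> * norm z"
        by (metis norm_mult norm_of_real)
      also have "\<dots> = norm z - r"
        using False r \<open>norm z > 0\<close> by (simp add: abs_if divide_simps algebra_simps)
      finally show ?thesis using z by (simp add: dist_norm)
    qed (use e in \<open>simp add: x_def\<close>)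
    ultimately show "z \<in> (\<Union>x\<in>cball 0 r. cball x e)"
      by (intro UN_I[of x]) simp_all
  qed
  then have *: "g holomorphic_on ball 0 (r + e)" if "r \<ge> 0"
    using holomorphic_on_subset[OF U(3)] e(2) that by (meson order_trans)
  show ?thesis
  proof (cases "Y = {}")
    case True
    then show ?thesis using hol_polynomial_const by (auto simp: poly_closure_def)
  next
    case False
    then have "r \<ge> 0" using assms(3) norm_ge_zero order_trans by blast
    then show ?thesis
      using e(1) by (intro poly_closure_holomorphic[OF assms(1) poly_closure_proj *, of r i] assms(3)) auto
  qed
qed

text \<open>The hull inequality is about polynomials. It survives a uniform limit only if the
  approximation also holds at \<open>x\<close>, whence the closure over
  \<open>insert x X\<close>.\<close>

lemma poly_hull_bound:
  assumes X: "compact X" "X \<noteq> {}" and x: "x \<in> poly_hull X"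
    and h: "h \<in> poly_closure (insert x X)" and b: "\<And>y. y \<in> X \<Longrightarrow> norm (h y) \<le> b"
  shows "norm (h x) \<le> b"
proof (rule field_le_epsilon)
  fix e :: real assume "e > 0"
  then obtain p where p: "hol_polynomial p" "\<And>y. y \<in> insert x X \<Longrightarrow> norm (h y - p y) < e/2"
    using poly_closureD[OF h, of "e/2"] by auto
  have "norm (p x) \<le> (SUP y\<in>X. norm (p y))"
    using x p(1) unfolding poly_hull_def by blast
  also have "\<dots> \<le> b + e/2"
  proof (rule cSUP_least[OF X(2)])
    fix y assume y: "y \<in> X"
    then show "norm (p y) \<le> b + e/2"
      using norm_triangle_ineq2[of "p y" "h y"] p(2)[of y] b[OF y] by (simp add: norm_minus_commute)
  qed
  finally show "norm (h x) \<le> b + e"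
    using norm_triangle_ineq2[of "h x" "p x"] p(2)[of x] by simp
qed

lemma subset_poly_hull:
  assumes "compact X"
  shows "X \<subseteq> poly_hull X"
proof
  fix x assume x: "x \<in> X"
  have "norm (p x) \<le> (SUP y\<in>X. norm (p y))" if p: "hol_polynomial p" for p
  proof (rule cSUP_upper[OF x])
    have "compact ((\<lambda>y. norm (p y)) ` X)"
      by (intro compact_continuous_image continuous_on_norm continuous_on_hol_polynomial p assms)
    then show "bdd_above ((\<lambda>y. norm (p y)) ` X)"
      by (intro bounded_imp_bdd_above compact_imp_bounded)
  qed
  then show "x \<in> poly_hull X" by (simp add: poly_hull_def)
qed

lemma continuous_on_graph_map:
  assumes "continuous_on S F"
  shows "continuous_on S (\<lambda>z. vector [z, F z] :: complex ^ 2)"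
proof -
  have eq: "vector [z, F z] = (\<chi> (i :: 2). if i = 1 then z else F z)" for z
    by (simp add: vec_eq_iff forall_2 vector_def)
  show ?thesis
    unfolding eq
  proof (rule continuous_on_vec_lambda)
    show "continuous_on S (\<lambda>z. if i = 1 then z else F z)" for i :: 2
      using assms by (cases "i = 1") auto
  qed
qed

lemma compact_graph_on:
  assumes "compact S" "continuous_on S F"
  shows "compact (graph_on S F)"
proof -
  have "graph_on S F = (\<lambda>z. vector [z, F z]) ` S" by (auto simp: graph_on_def)
  then show ?thesis
    using compact_continuous_image[OF continuous_on_graph_map[OF assms(2)] assms(1)] by simp
qed

section \<open>Polynomial convexity of the graph\<close>

text \<open>With y = t u the claim is y^s \<le> exp y, which follows from y^s \<le> 1 for y \<le> 1
  and from y^s \<le> y otherwise. The exponents applied later are 1 and 1/\<nu>, for the real and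
  the imaginary part of H.\<close>

lemma powr_mult_exp_le:
  assumes "u \<ge> 0" "t > 0" "0 < s" "s \<le> (1::real)"
  shows "u powr s * exp (- (t * u)) \<le> t powr (- s)"
proof -
  have "(t * u) powr s \<le> exp (t * u)"
  proof (cases "t * u \<le> 1")
    case True
    then have "(t * u) powr s \<le> 1" using assms by (intro powr_le1) auto
    also have "1 \<le> exp (t * u)" using assms by simp
    finally show ?thesis .
  next
    case False
    then have "(t * u) powr s \<le> (t * u) powr 1" using assms by (intro powr_mono) auto
    also have "\<dots> \<le> exp (t * u)"
      using False exp_ge_add_one_self[of "t * u"] by (simp add: powr_one_gt_zero_iff del: exp_ge_add_one_self)
    finally show ?thesis .
  qed
  then show ?thesis
    using assms by (simp add: powr_mult powr_minus exp_minus field_simps)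
qed

text \<open>A boundary point is first moved into the open disc; near it there is then a nonempty
  open set, which the closure of \<open>E\<close> cannot cover.\<close>

lemma nowhere_dense_approx:
  fixes z :: complex
  assumes E: "nowhere_dense E" and r: "r > 0" and z: "z \<in> cball 0 r" and d: "d > 0"
  obtains w where "w \<in> ball 0 r - E" "dist z w < d"
proof -
  have "z \<in> closure (ball 0 r)" using z r by simp
  then obtain y where y: "y \<in> ball 0 r" "dist y z < d"
    using d closure_approachable by blast
  then have "ball 0 r \<inter> ball z d \<noteq> {}" by (auto simp: dist_commute)
  moreover have "open (ball 0 r \<inter> ball z d)" by (intro open_Int open_ball)
  ultimately have "\<not> ball 0 r \<inter> ball z d \<subseteq> closure E"
    using E unfolding nowhere_dense_def by (metis interior_maximal subset_empty)
  then obtain w where "w \<in> ball 0 r" "w \<in> ball z d" "w \<notin> closure E" by blast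
  then show thesis using that[of w] closure_subset[of E] by auto
qed

lemma vector_2_nth: "vector [a, b] $ (1::2) = a" "vector [a, b] $ (2::2) = b"
  by (simp_all add: vector_def)

lemma holomorphic_exp_mult: "(\<lambda>w. exp (a * w)) holomorphic_on S" for a :: complex
  by (intro holomorphic_intros)

text \<open>Multiplying f by exp (-t H), where H = C (z - w) f, makes it small on the graph, while a point
  of the hull over a point close to w hardly notices the factor.\<close>

lemma exp_damping_bound:
  fixes f H C z w :: complex
  assumes H: "H = C * (z - w) * f" and C: "norm C = 1"
    and Re: "Re H \<ge> 0" and Im: "\<bar>Im H\<bar> \<le> K * Re H powr (1 / \<nu>)" and "K > 0" "\<nu> \<ge> 1"
    and t: "t > 0" and \<rho>: "\<rho> > 0"
    and near: "norm (z - w) < \<rho> \<Longrightarrow> norm f \<le> b"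
    and far: "(1 / t + K * t powr (- (1 / \<nu>))) / \<rho> \<le> b"
  shows "norm (f * exp (- (of_real t * H))) \<le> b"
proof -
  show ?thesis
  proof (cases "norm (z - w) < \<rho>")
    case True
    have "norm f * exp (- (t * Re H)) \<le> norm f * 1"
      using t Re by (intro mult_left_mono) auto
    then show ?thesis using near[OF True] by (simp add: norm_mult)
  next
    case False
    have "norm H = norm (z - w) * norm f" using H C by (simp add: norm_mult)
    then have "\<rho> * norm f \<le> norm H" using False by (simp add: mult_right_mono)
    \<comment> \<open>At distance at least \<rho> from \<open>w\<close> the factor z - w can be
      divided out, so the region controls \<open>f\<close> itself.\<close>
    then have "norm f \<le> norm H / \<rho>" using \<rho> by (simp add: field_simps)
    also have "norm H \<le> Re H + K * Re H powr (1 / \<nu>)"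
      using cmod_le[of H] Re Im by simp
    finally have "norm f \<le> (Re H + K * Re H powr (1 / \<nu>)) / \<rho>"
      using \<rho> by (simp add: divide_right_mono)
    then have "norm f * exp (- (t * Re H)) \<le> (Re H + K * Re H powr (1 / \<nu>)) / \<rho> * exp (- (t * Re H))"
      by (intro mult_right_mono) auto
    also have "\<dots> = (Re H powr 1 * exp (- (t * Re H)) + K * (Re H powr (1 / \<nu>) * exp (- (t * Re H)))) / \<rho>"
      using Re by (simp add: field_simps)
    also have "\<dots> \<le> (t powr (- 1) + K * t powr (- (1 / \<nu>))) / \<rho>"
      using assms by (intro divide_right_mono add_mono mult_left_mono powr_mult_exp_le) auto
    also have "\<dots> \<le> b" using far t by (simp add: powr_minus field_simps)
    finally show ?thesis by (simp add: norm_mult)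
  qed
qed

text \<open>The order of choices carries the proof: \<delta>, then \<rho>, then t, and only then the
  point \<xi> off \<open>E\<close>. The functions f and H depend on \<xi>, but \<open>M\<close>,
  \<open>K\<close> and \<nu> do not, so \<rho> and t serve for every \<xi>.\<close>

lemma polynomially_convex_graph:
  fixes F A :: "complex \<Rightarrow> complex" and E :: "complex set"
  assumes r: "r > 0" and F: "continuous_on (cball 0 r) F" and E: "nowhere_dense E"
    and A: "A \<in> hol_on_closed (cball 0 r)" and A0: "\<forall>z\<in>cball 0 r. A z \<noteq> 0"
    and M: "M > 0" and K: "K > 0" and \<nu>: "\<nu> \<ge> 1"
    and main: "\<forall>\<zeta>\<in>cball 0 r - E.
           \<exists>G \<in> hol_on_closed_zero (cball 0 r) \<zeta>. \<exists>C :: complex.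
             (\<forall>z\<in>cball 0 r - {\<zeta>}. inverse (norm (z - \<zeta>)) * norm (G z) \<le> M) \<and>
             norm C = 1 \<and>
             (\<forall>z\<in>cball 0 r. C * (z - \<zeta>) * (A z * F z - A \<zeta> * F \<zeta> + G z)
                \<in> {w. Re w \<ge> 0 \<and> \<bar>Im w\<bar> \<le> K * Re w powr (1 / \<nu>)})"
  shows "polynomially_convex (graph_on (cball 0 r) F)"
proof -
  let ?D = "cball (0::complex) r"
  define X where "X = graph_on ?D F"
  have X: "compact X" unfolding X_def by (intro compact_graph_on compact_cball F)
  have Xne: "X \<noteq> {}" using r by (auto simp: X_def graph_on_def intro!: exI[of _ 0])
  have Xmem: "y $ 1 \<in> ?D" "y $ 2 = F (y $ 1)" if "y \<in> X" for y
    using that by (auto simp: X_def graph_on_def vector_2_nth)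
  obtain U where U: "?D \<subseteq> U" "A holomorphic_on U"
    using A unfolding hol_on_closed_def by blast
  have contA: "continuous_on ?D A"
    using U by (meson continuous_on_subset holomorphic_on_imp_continuous_on)
  have ucont: "uniformly_continuous_on ?D (\<lambda>z. A z * F z)"
    by (intro compact_uniformly_continuous continuous_on_mult contA F compact_cball)
  have "x \<in> X" if x: "x \<in> poly_hull X" for x
  proof -
    define \<zeta> where "\<zeta> = x $ 1"
    define w where "w = x $ 2"
    have \<zeta>: "\<zeta> \<in> ?D"
      using poly_hull_bound[OF X Xne x poly_closure_proj[of 1], of r] Xmem by (auto simp: \<zeta>_def)
    have Y: "compact (insert x X)" using X by simp
    \<comment> \<open>Undoing the exponential factor at \<open>x\<close> costs 2 \<delta>, and
      replacing \<open>f x\<close> by \<open>A \<zeta> * (w - F \<zeta>)\<close> costs another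
      \<delta>.\<close>
    have small: "norm (A \<zeta> * (w - F \<zeta>)) \<le> 3 * \<delta>" if \<delta>: "\<delta> > 0" for \<delta>
    proof -
      obtain \<rho>1 where \<rho>1: "\<rho>1 > 0"
        "\<And>z z'. z \<in> ?D \<Longrightarrow> z' \<in> ?D \<Longrightarrow> dist z' z < \<rho>1 \<Longrightarrow> dist (A z' * F z') (A z * F z) < \<delta> / 2"
        using ucont \<delta> unfolding uniformly_continuous_on_def by (metis half_gt_zero)
      \<comment> \<open>Within distance \<rho> the variation of A F and the size of G each take half
        of \<delta>.\<close>
      define \<rho> where "\<rho> = min \<rho>1 (\<delta> / (2 * M))"
      have \<rho>: "\<rho> > 0" "M * \<rho> \<le> \<delta> / 2"
        using \<rho>1(1) \<delta> M by (auto simp: \<rho>_def min_def field_simps)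
      have "((\<lambda>t. (1 / t + K * t powr (- (1 / \<nu>))) / \<rho>) \<longlongrightarrow> (0 + K * 0) / \<rho>) at_top"
        using \<rho> \<nu> by (intro tendsto_intros tendsto_neg_powr tendsto_divide_0[OF tendsto_const] filterlim_ident
            filterlim_at_top_imp_at_infinity) auto
      then have "\<forall>\<^sub>F t in at_top. (1 / t + K * t powr (- (1 / \<nu>))) / \<rho> < \<delta>"
        using \<delta> by (auto dest: order_tendstoD(2))
      then have "\<forall>\<^sub>F t in at_top. (1 / t + K * t powr (- (1 / \<nu>))) / \<rho> < \<delta> \<and> t > 0"
        using eventually_gt_at_top[of 0] by eventually_elim auto
      then obtain t where t: "(1 / t + K * t powr (- (1 / \<nu>))) / \<rho> < \<delta>" "t > 0"
        by (auto simp: eventually_at_top_linorder)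
      \<comment> \<open>\<open>B\<close> will bound \<open>f x\<close> for every admissible \<xi>;
        it is fixed in advance because \<eta>, and through it \<xi>, is chosen from it.\<close>
      define B where "B = norm (A \<zeta> * (w - F \<zeta>)) + \<delta>"
      have B: "B > 0" using \<delta> by (simp add: B_def add_nonneg_pos)
      \<comment> \<open>\<eta> keeps t |H x| at most ln 2, so the exponential at \<open>x\<close>
        has modulus at least 1/2.\<close>
      define \<eta> where "\<eta> = min \<rho> (ln 2 / (t * B))"
      have \<eta>: "\<eta> > 0" "t * B * \<eta> \<le> ln 2"
        using \<rho> t B by (auto simp: \<eta>_def min_def field_simps)
      obtain \<xi> where \<xi>: "\<xi> \<in> ball 0 r - E" "dist \<zeta> \<xi> < \<eta>"
        using nowhere_dense_approx[OF E r \<zeta> \<eta>(1)] by metis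
      then have \<xi>D: "\<xi> \<in> ?D - E" by auto
      obtain G C where G: "G \<in> hol_on_closed_zero ?D \<xi>"
        and GM: "\<And>z. z \<in> ?D - {\<xi>} \<Longrightarrow> inverse (norm (z - \<xi>)) * norm (G z) \<le> M"
        and C: "norm C = 1"
        and cone: "\<And>z. z \<in> ?D \<Longrightarrow> Re (C * (z - \<xi>) * (A z * F z - A \<xi> * F \<xi> + G z)) \<ge> 0 \<and>
            \<bar>Im (C * (z - \<xi>) * (A z * F z - A \<xi> * F \<xi> + G z))\<bar>
              \<le> K * Re (C * (z - \<xi>) * (A z * F z - A \<xi> * F \<xi> + G z)) powr (1 / \<nu>)"
        using main \<xi>D by blast
      have G': "G \<in> hol_on_closed ?D" "G \<xi> = 0" using G by (auto simp: hol_on_closed_zero_def)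
      have Gb: "norm (G z) \<le> M * norm (z - \<xi>)" if "z \<in> ?D" for z
      proof (cases "z = \<xi>")
        case False
        then have "inverse (norm (z - \<xi>)) * norm (G z) \<le> M" using GM that by blast
        with False show ?thesis by (simp add: field_simps)
      qed (simp add: G')
      define f where "f = (\<lambda>y :: complex ^ 2. A (y $ 1) * y $ 2 - A \<xi> * F \<xi> + G (y $ 1))"
      define H where "H = (\<lambda>y :: complex ^ 2. C * (y $ 1 - \<xi>) * f y)"
      have n1: "norm (y $ 1) \<le> r" if "y \<in> insert x X" for y
        using that Xmem(1) \<zeta> by (auto simp: \<zeta>_def)
      have fP: "f \<in> poly_closure (insert x X)"
        unfolding f_def
        by (intro poly_closure_add poly_closure_diff poly_closure_mult poly_closure_const
            poly_closure_proj poly_closure_hol_on_closed[OF Y A] poly_closure_hol_on_closed[OF Y G'(1)] Y n1)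
      have HP: "H \<in> poly_closure (insert x X)"
        unfolding H_def
        by (intro poly_closure_diff poly_closure_mult poly_closure_const poly_closure_proj Y fP)
      have kP: "(\<lambda>y. f y * exp (- of_real t * H y)) \<in> poly_closure (insert x X)"
        by (intro poly_closure_mult Y fP poly_closure_entire[OF Y HP holomorphic_exp_mult])
      have "norm (f y * exp (- of_real t * H y)) \<le> \<delta>" if y: "y \<in> X" for y
      proof -
        have fy: "f y = A (y $ 1) * F (y $ 1) - A \<xi> * F \<xi> + G (y $ 1)"
          using Xmem(2)[OF y] by (simp add: f_def)
        have "norm (f y * exp (- (of_real t * H y))) \<le> \<delta>"
        proof (rule exp_damping_bound[OF _ C _ _ K \<nu> t(2) \<rho>(1)])
          show "H y = C * (y $ 1 - \<xi>) * f y" by (simp add: H_def)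
          show "Re (H y) \<ge> 0" "\<bar>Im (H y)\<bar> \<le> K * Re (H y) powr (1 / \<nu>)"
            using cone[OF Xmem(1)[OF y]] by (auto simp: H_def fy)
          show "(1 / t + K * t powr - (1 / \<nu>)) / \<rho> \<le> \<delta>" using t(1) by simp
          assume near: "norm (y $ 1 - \<xi>) < \<rho>"
          have "norm (A (y $ 1) * F (y $ 1) - A \<xi> * F \<xi>) \<le> \<delta> / 2"
            using \<rho>1(2)[of \<xi> "y $ 1"] Xmem(1)[OF y] \<xi>D near by (auto simp: \<rho>_def dist_norm)
          moreover have "norm (G (y $ 1)) \<le> M * \<rho>"
            using Gb[OF Xmem(1)[OF y]] near M by (meson less_imp_le mult_left_mono order_trans)
          ultimately show "norm (f y) \<le> \<delta>"
            using \<rho>(2) norm_triangle_ineq[of "A (y $ 1) * F (y $ 1) - A \<xi> * F \<xi>" "G (y $ 1)"]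
            unfolding fy by linarith
        qed
        then show ?thesis by simp
      qed
      then have kx: "norm (f x * exp (- of_real t * H x)) \<le> \<delta>"
        using poly_hull_bound[OF X Xne x kP] by blast
      have fx: "norm (f x - A \<zeta> * (w - F \<zeta>)) \<le> \<delta>"
      proof -
        have d: "norm (\<zeta> - \<xi>) < \<rho>" using \<xi>(2) by (simp add: \<eta>_def dist_norm)
        have "norm (A \<zeta> * F \<zeta> - A \<xi> * F \<xi>) \<le> \<delta> / 2"
          using \<rho>1(2)[of \<xi> \<zeta>] \<zeta> \<xi>D d by (auto simp: \<rho>_def dist_norm)
        moreover have "norm (G \<zeta>) \<le> M * \<rho>"
          using Gb[OF \<zeta>] d M by (meson less_imp_le mult_left_mono order_trans)
        moreover have "f x - A \<zeta> * (w - F \<zeta>) = (A \<zeta> * F \<zeta> - A \<xi> * F \<xi>) + G \<zeta>"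
          by (simp add: f_def \<zeta>_def w_def algebra_simps)
        ultimately show ?thesis
          using \<rho>(2) norm_triangle_ineq[of "A \<zeta> * F \<zeta> - A \<xi> * F \<xi>" "G \<zeta>"] by simp
      qed
      then have fxB: "norm (f x) \<le> B"
        using norm_triangle_ineq2[of "f x" "A \<zeta> * (w - F \<zeta>)"] unfolding B_def by linarith
      have "norm (H x) \<le> \<eta> * B"
        using \<xi>(2) C fxB \<eta>(1)
        by (auto simp: H_def \<zeta>_def[symmetric] norm_mult dist_norm intro!: mult_mono)
      then have "t * norm (H x) \<le> t * (\<eta> * B)" using t(2) by (intro mult_left_mono) auto
      then have "t * norm (H x) \<le> ln 2" using \<eta>(2) by (simp add: mult_ac)
      moreover have "t * Re (H x) \<le> t * norm (H x)"
        using t(2) complex_Re_le_cmod by (intro mult_left_mono) auto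
      ultimately have "- ln 2 \<le> Re (- of_real t * H x)" by simp
      then have "exp (- ln 2) \<le> norm (exp (- of_real t * H x))" by (simp del: minus_mult_left)
      then have "norm (f x) * (1 / 2) \<le> norm (f x) * norm (exp (- of_real t * H x))"
        by (intro mult_left_mono) (auto simp: exp_minus)
      then have "norm (f x) \<le> 2 * \<delta>" using kx by (simp add: norm_mult)
      then show ?thesis
        using fx norm_triangle_ineq3[of "f x" "A \<zeta> * (w - F \<zeta>)"] by linarith
    qed
    have "norm (A \<zeta> * (w - F \<zeta>)) \<le> 0"
    proof (rule field_le_epsilon)
      fix e :: real assume "e > 0"
      then show "norm (A \<zeta> * (w - F \<zeta>)) \<le> 0 + e" using small[of "e / 3"] by simp
    qed
    then have "w = F \<zeta>" using A0 \<zeta> by auto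
    then have "x = vector [\<zeta>, F \<zeta>]"
      by (simp add: vec_eq_iff forall_2 vector_2_nth \<zeta>_def w_def)
    then show ?thesis using \<zeta> by (auto simp: X_def graph_on_def)
  qed
  then show ?thesis
    using X subset_poly_hull[OF X] unfolding polynomially_convex_def X_def by blast
qed

section \<open>The Hahn--Banach theorem\<close>

text \<open>Homogeneity as an inequality for c > 0 is the form easily checked for infima; applied
  with c and 1/c it yields equality.\<close>

definition sublinear :: "('v::real_vector \<Rightarrow> real) \<Rightarrow> bool" where
  "sublinear p \<longleftrightarrow> (\<forall>x y. p (x + y) \<le> p x + p y) \<and> (\<forall>c>0. \<forall>x. p (c *\<^sub>R x) \<le> c * p x)"

lemma sublinearD:
  assumes "sublinear p"
  shows "p (x + y) \<le> p x + p y" "c > 0 \<Longrightarrow> p (c *\<^sub>R x) \<le> c * p x" "p 0 = 0" "- p (- x) \<le> p x"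
proof -
  show add: "p (x + y) \<le> p x + p y" for x y using assms by (auto simp: sublinear_def)
  show hom: "c > 0 \<Longrightarrow> p (c *\<^sub>R x) \<le> c * p x" for c x using assms by (auto simp: sublinear_def)
  show 0: "p 0 = 0" using add[of 0 0] hom[of "1/2" 0] by simp
  show "- p (- x) \<le> p x" using add[of x "- x"] 0 by simp
qed

text \<open>Lowering \<open>m\<close> along a vector v, to the infimum over t \<ge> 0 of m (x + t v)
  - t m v, gives another sublinear function below \<open>m\<close>. Minimality makes it equal to
  \<open>m\<close>, and t = 1 at -v gives m (-v) \<le> - m v. An odd sublinear function is
  linear.\<close>

lemma minimal_sublinear_linear:
  assumes m: "sublinear m" and min: "\<And>q. sublinear q \<Longrightarrow> q \<le> m \<Longrightarrow> q = m"
  shows "linear m"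
proof -
  note sD = sublinearD[OF m]
  have neg: "m (- v) = - m v" for v
  proof -
    define n where "n x = (INF t\<in>{0..}. m (x + t *\<^sub>R v) - t * m v)" for x
    have lb: "- m (- x) \<le> m (x + t *\<^sub>R v) - t * m v" if "t \<ge> 0" for x t
    proof (cases "t = 0")
      case False
      then have t: "t > 0" using that by simp
      have "t * m v \<le> m (t *\<^sub>R v)"
        using sD(2)[of "inverse t" "t *\<^sub>R v"] t by (simp add: field_simps)
      moreover have "m (t *\<^sub>R v) \<le> m (x + t *\<^sub>R v) + m (- x)"
        using sD(1)[of "x + t *\<^sub>R v" "- x"] by simp
      ultimately show ?thesis by linarith
    qed (use sD(4) in simp)
    have bdd: "bdd_below ((\<lambda>t. m (x + t *\<^sub>R v) - t * m v) ` {0..})" for x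
      using lb by (intro bdd_belowI2[of _ "- m (- x)"]) auto
    have n_le: "n x \<le> m (x + t *\<^sub>R v) - t * m v" if "t \<ge> 0" for x t
      unfolding n_def using that by (intro cINF_lower bdd) auto
    have n_ge: "b \<le> n x" if "\<And>t. t \<ge> 0 \<Longrightarrow> b \<le> m (x + t *\<^sub>R v) - t * m v" for b x
      unfolding n_def using that by (intro cINF_greatest) auto
    have "sublinear n"
      unfolding sublinear_def
    proof (intro conjI allI impI)
      fix x y
      have "n (x + y) - (m (y + t *\<^sub>R v) - t * m v) \<le> n x" if t: "t \<ge> 0" for t
      proof (rule n_ge)
        fix s :: real assume s: "s \<ge> 0"
        have "n (x + y) \<le> m ((x + y) + (s + t) *\<^sub>R v) - (s + t) * m v"
          using s t by (intro n_le) auto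
        moreover have "m ((x + y) + (s + t) *\<^sub>R v) \<le> m (x + s *\<^sub>R v) + m (y + t *\<^sub>R v)"
          using sD(1)[of "x + s *\<^sub>R v" "y + t *\<^sub>R v"] by (simp add: algebra_simps)
        ultimately show "n (x + y) - (m (y + t *\<^sub>R v) - t * m v) \<le> m (x + s *\<^sub>R v) - s * m v"
          by (simp add: algebra_simps)
      qed
      then have "n (x + y) - n x \<le> n y" by (intro n_ge) (auto simp: algebra_simps)
      then show "n (x + y) \<le> n x + n y" by simp
    next
      fix c :: real and x assume c: "c > 0"
      have "n (c *\<^sub>R x) / c \<le> n x"
      proof (rule n_ge)
        fix s :: real assume s: "s \<ge> 0"
        have "n (c *\<^sub>R x) \<le> m (c *\<^sub>R x + (c * s) *\<^sub>R v) - c * s * m v"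
          using s c by (intro n_le) auto
        also have "m (c *\<^sub>R x + (c * s) *\<^sub>R v) \<le> c * m (x + s *\<^sub>R v)"
          using sD(2)[OF c, of "x + s *\<^sub>R v"] by (simp add: algebra_simps)
        finally show "n (c *\<^sub>R x) / c \<le> m (x + s *\<^sub>R v) - s * m v"
          using c by (simp add: field_simps)
      qed
      then show "n (c *\<^sub>R x) \<le> c * n x" using c by (simp add: field_simps)
    qed
    moreover have "n \<le> m" using n_le[of 0] by (auto simp: le_fun_def)
    ultimately have "n = m" by (rule min)
    then have "m (- v) \<le> - m v" using n_le[of 1 "- v"] sD(3) by simp
    then show ?thesis using sD(4)[of v] by simp
  qed
  show ?thesis
  proof (rule linearI)
    fix x y
    show "m (x + y) = m x + m y"
      using sD(1)[of x y] sD(1)[of "- x" "- y"] neg[of "x + y"] neg[of x] neg[of y] by simp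
  next
    fix c :: real and x
    have pos: "m (c *\<^sub>R x) = c * m x" if "c > 0" for c x
      using sD(2)[OF that, of x] sD(2)[of "inverse c" "c *\<^sub>R x"] that by (simp add: field_simps)
    show "m (c *\<^sub>R x) = c *\<^sub>R m x"
      using pos[of c x] pos[of "- c" x] sD(3) neg[of "c *\<^sub>R x"] by (cases c "0 :: real" rule: linorder_cases) auto
  qed
qed

text \<open>No subspace and no extension step appear: whatever is wanted of \<open>L\<close> is
  encoded in \<open>p\<close>. Zorn's lemma runs over the sublinear functions below
  \<open>p\<close>; a chain is bounded by its pointwise infimum, finite because every member is at
  least - p (-x).\<close>

theorem hahn_banach_sublinear:
  assumes p: "sublinear p"
  obtains L where "linear L" "\<And>x. L x \<le> p x"
proof -
  define A where "A = {q. sublinear q \<and> q \<le> p}"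
  \<comment> \<open>Zorn's lemma yields maximal elements, so the order is reversed to obtain a
    minimal sublinear function.\<close>
  define P where "P = (\<lambda>a b :: 'a \<Rightarrow> real. b \<le> a)"
  have po: "partial_order_on A (relation_of P A)"
    by (auto simp: partial_order_on_def preorder_on_def refl_on_def trans_def antisym_def relation_of_def P_def
        intro: order_trans)
  have "\<exists>m\<in>A. \<forall>a\<in>A. P m a \<longrightarrow> a = m"
  proof (rule predicate_Zorn[OF po])
    fix C assume "C \<in> Chains (relation_of P A)"
    then have CA: "C \<subseteq> A" and Ctot: "\<And>a b. a \<in> C \<Longrightarrow> b \<in> C \<Longrightarrow> a \<le> b \<or> b \<le> a"
      by (auto simp: Chains_def relation_of_def P_def)
    show "\<exists>u\<in>A. \<forall>a\<in>C. P a u"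
    proof (cases "C = {}")
      case True
      then show ?thesis using p by (auto simp: A_def)
    next
      case False
      define u where "u x = (INF q\<in>C. q x)" for x
      have lb: "- p (- x) \<le> q x" if "q \<in> C" for q x
      proof -
        have q: "sublinear q" "q (- x) \<le> p (- x)" using that CA by (auto simp: A_def le_fun_def)
        show ?thesis using sublinearD(4)[OF q(1), of x] q(2) by linarith
      qed
      have bdd: "bdd_below ((\<lambda>q. q x) ` C)" for x
        using lb by (intro bdd_belowI2[of _ "- p (- x)"]) auto
      have u_le: "u x \<le> q x" if "q \<in> C" for q x
        unfolding u_def by (rule cINF_lower[OF bdd that])
      have u_ge: "b \<le> u x" if "\<And>q. q \<in> C \<Longrightarrow> b \<le> q x" for b x
        unfolding u_def by (rule cINF_greatest[OF False]) (use that in auto)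
      have "sublinear u"
        unfolding sublinear_def
      proof (intro conjI allI impI)
        fix x y
        have "u (x + y) - q' y \<le> u x" if q': "q' \<in> C" for q'
        proof (rule u_ge)
          fix q assume q: "q \<in> C"
          \<comment> \<open>Subadditivity of the infimum needs one member below both
            \<open>q\<close> and \<open>q'\<close>, which the chain provides.\<close>
          obtain s where s: "s \<in> C" "s \<le> q" "s \<le> q'" using Ctot[OF q q'] q q' by auto
          have "sublinear s" using s CA by (auto simp: A_def)
          then have "s (x + y) \<le> s x + s y" by (rule sublinearD)
          moreover have "s x \<le> q x" "s y \<le> q' y" using s by (auto simp: le_fun_def)
          ultimately show "u (x + y) - q' y \<le> q x" using u_le[OF s(1), of "x + y"] by linarith
        qed
        then have "u (x + y) - u x \<le> u y" by (intro u_ge) (auto simp: algebra_simps)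
        then show "u (x + y) \<le> u x + u y" by simp
      next
        fix c :: real and x assume c: "c > 0"
        have "u (c *\<^sub>R x) / c \<le> u x"
        proof (rule u_ge)
          fix q assume q: "q \<in> C"
          then have "q (c *\<^sub>R x) \<le> c * q x" using CA c by (auto simp: A_def intro: sublinearD)
          then show "u (c *\<^sub>R x) / c \<le> q x" using u_le[OF q, of "c *\<^sub>R x"] c by (simp add: field_simps)
        qed
        then show "u (c *\<^sub>R x) \<le> c * u x" using c by (simp add: field_simps)
      qed
      moreover have "u \<le> p"
      proof -
        obtain q where q: "q \<in> C" using False by blast
        then have "q \<le> p" using CA by (auto simp: A_def)
        moreover have "u \<le> q" using u_le[OF q] by (simp add: le_fun_def)
        ultimately show ?thesis by (rule order_trans[rotated])
      qed
      ultimately show ?thesis using u_le by (auto simp: A_def P_def le_fun_def)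
    qed
  qed
  then obtain m where m: "m \<in> A" "\<And>a. a \<in> A \<Longrightarrow> a \<le> m \<Longrightarrow> a = m" by (auto simp: P_def)
  have "linear m"
    by (rule minimal_sublinear_linear) (use m in \<open>auto simp: A_def intro: order_trans\<close>)
  then show thesis using that m(1) by (auto simp: A_def le_fun_def)
qed

section \<open>The Riesz representation theorem\<close>

locale positive_functional =
  fixes Y :: "'a::metric_space set" and \<Lambda> :: "('a \<Rightarrow> real) \<Rightarrow> real"
  assumes compact: "compact Y"
    and add: "\<And>f g. continuous_on Y f \<Longrightarrow> continuous_on Y g \<Longrightarrow> \<Lambda> (\<lambda>x. f x + g x) = \<Lambda> f + \<Lambda> g"
    and scale: "\<And>c f. continuous_on Y f \<Longrightarrow> \<Lambda> (\<lambda>x. c * f x) = c * \<Lambda> f"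
    and pos: "\<And>f. continuous_on Y f \<Longrightarrow> (\<And>x. x \<in> Y \<Longrightarrow> 0 \<le> f x) \<Longrightarrow> 0 \<le> \<Lambda> f"
begin

lemma mono:
  assumes "continuous_on Y f" "continuous_on Y g" "\<And>x. x \<in> Y \<Longrightarrow> f x \<le> g x"
  shows "\<Lambda> f \<le> \<Lambda> g"
proof -
  have "0 \<le> \<Lambda> (\<lambda>x. g x + (-1) * f x)"
    using assms by (intro pos continuous_intros) auto
  also have "\<dots> = \<Lambda> g + (-1) * \<Lambda> f"
    using assms by (subst add, simp, intro continuous_intros, simp, subst scale) auto
  finally show ?thesis by simp
qed

text \<open>By monotonicity in both directions, \<Lambda> sees only the values on \<open>Y\<close>
  although it is applied to total functions.\<close>

lemma cong:
  assumes "continuous_on Y f" "\<And>x. x \<in> Y \<Longrightarrow> f x = g x"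
  shows "\<Lambda> f = \<Lambda> g"
proof -
  have "continuous_on Y g" using assms continuous_on_cong by metis
  then show ?thesis using assms by (intro antisym mono) auto
qed

lemma zero: "\<Lambda> (\<lambda>x. 0) = 0"
  using scale[of "\<lambda>x. 0" 0] by simp

lemma sum:
  assumes "\<And>i. i \<in> I \<Longrightarrow> continuous_on Y (f i)"
  shows "\<Lambda> (\<lambda>x. \<Sum>i\<in>I. f i x) = (\<Sum>i\<in>I. \<Lambda> (f i))"
  using assms
proof (induction I rule: infinite_finite_induct)
  case (insert i I)
  then show ?case by (simp add: add continuous_on_sum)
qed (auto simp: zero)

text \<open>These replace the functions with compact support inside \<open>V\<close> of the usual
  construction: only vanishing off \<open>V\<close> is asked, and \<open>truncation\<close> supplies
  a compact carrier.\<close>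

definition tests :: "'a set \<Rightarrow> ('a \<Rightarrow> real) set" where
  "tests V = {f. continuous_on Y f \<and> (\<forall>y\<in>Y. 0 \<le> f y \<and> f y \<le> 1 \<and> (y \<notin> V \<longrightarrow> f y = 0))}"

definition content0 :: "'a set \<Rightarrow> ennreal" where
  "content0 V = (SUP f\<in>tests V. ennreal (\<Lambda> f))"

definition outer :: "'a set \<Rightarrow> ennreal" where
  "outer S = (INF V\<in>{V. open V \<and> S \<subseteq> V}. content0 V)"

lemma one_nonneg: "0 \<le> \<Lambda> (\<lambda>x. 1)" by (rule pos) auto

lemma tests_mono: "V \<subseteq> W \<Longrightarrow> tests V \<subseteq> tests W"
  by (auto simp: tests_def)

lemma content0_mono: "V \<subseteq> W \<Longrightarrow> content0 V \<le> content0 W"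
  unfolding content0_def by (rule SUP_subset_mono) (use tests_mono in auto)

lemma content0_upper: "f \<in> tests V \<Longrightarrow> ennreal (\<Lambda> f) \<le> content0 V"
  unfolding content0_def by (rule SUP_upper)

lemma content0_le: "content0 V \<le> ennreal (\<Lambda> (\<lambda>x. 1))"
  unfolding content0_def by (rule SUP_least) (auto simp: tests_def intro!: ennreal_leI mono)

lemma outer_open: "open V \<Longrightarrow> outer V = content0 V"
  unfolding outer_def
  by (rule antisym) (auto intro: INF_lower INF_greatest content0_mono)

lemma outer_mono: "S \<subseteq> T \<Longrightarrow> outer S \<le> outer T"
  unfolding outer_def by (rule INF_superset_mono) auto

lemma outer_finite: "outer S < top"
proof -
  have "outer S \<le> content0 UNIV" unfolding outer_def by (rule INF_lower) auto
  also have "\<dots> \<le> ennreal (\<Lambda> (\<lambda>x. 1))" by (rule content0_le)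
  finally show ?thesis by (simp add: ennreal_less_top order_le_less_trans)
qed

text \<open>The truncated function vanishes off the compact part of \<open>V\<close> where f \<ge>
  \<epsilon>, so covering arguments apply to it, at the price of \<epsilon> times the value of
  \<Lambda> at the constant 1.\<close>

lemma truncation:
  assumes f: "f \<in> tests V" and \<epsilon>: "0 < \<epsilon>"
  shows "(\<lambda>x. max 0 (f x - \<epsilon>)) \<in> tests V" "\<Lambda> f \<le> \<Lambda> (\<lambda>x. max 0 (f x - \<epsilon>)) + \<epsilon> * \<Lambda> (\<lambda>x. 1)"
proof -
  have cont: "continuous_on Y f" using f by (simp add: tests_def)
  have c1: "continuous_on Y (\<lambda>x. max 0 (f x - \<epsilon>))"
    by (intro continuous_on_max continuous_intros cont)
  show "(\<lambda>x. max 0 (f x - \<epsilon>)) \<in> tests V" using f \<epsilon> c1 by (auto simp: tests_def max_def)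
  have "\<Lambda> f \<le> \<Lambda> (\<lambda>x. max 0 (f x - \<epsilon>) + \<epsilon> * 1)"
    by (rule mono) (auto intro!: continuous_intros cont c1)
  also have "\<dots> = \<Lambda> (\<lambda>x. max 0 (f x - \<epsilon>)) + \<epsilon> * \<Lambda> (\<lambda>x. 1)"
    by (subst add, rule c1, intro continuous_intros, subst scale) auto
  finally show "\<Lambda> f \<le> \<Lambda> (\<lambda>x. max 0 (f x - \<epsilon>)) + \<epsilon> * \<Lambda> (\<lambda>x. 1)" .
qed

lemma open_positive_function:
  assumes "open (V :: 'a set)"
  obtains d :: "'a \<Rightarrow> real" where "continuous_on UNIV d" "\<And>x. 0 \<le> d x" "\<And>x. d x > 0 \<longleftrightarrow> x \<in> V"
\<comment> \<open>\<open>infdist\<close> to the empty set is 0, so the distance to the complement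
  fails as a witness when \<open>V\<close> is the whole space.\<close>
proof (cases "V = UNIV")
  case True
  show thesis by (rule that[of "\<lambda>_. 1"]) (auto simp: True)
next
  case False
  have cl: "closed (- V)" using assms by auto
  show thesis
  proof (rule that[of "\<lambda>x. infdist x (- V)"])
    show "infdist x (- V) > 0 \<longleftrightarrow> x \<in> V" for x
    proof -
      have ne: "- V \<noteq> {}" using False by auto
      have "infdist x (- V) = 0 \<longleftrightarrow> x \<in> - V" using in_closed_iff_infdist_zero[OF cl ne] by blast
      then show ?thesis using infdist_nonneg[of x "- V"] by auto
    qed
  qed (auto intro: continuous_intros infdist_nonneg)
qed

text \<open>The carrier of a truncated test is covered by finitely many \<open>V i\<close>, and a
  partition of unity subordinate to them splits it into tests for the single
  \<open>V i\<close>.\<close>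

lemma content0_UN:
  assumes op: "\<And>i::nat. open (V i)"
  shows "content0 (\<Union>i. V i) \<le> (\<Sum>i. content0 (V i))"
  unfolding content0_def[of "\<Union>i. V i"]
proof (rule SUP_least)
  fix f assume f: "f \<in> tests (\<Union>i. V i)"
  have cont: "continuous_on Y f" using f by (simp add: tests_def)
  have bound: "ennreal (\<Lambda> f) \<le> (\<Sum>i. content0 (V i)) + ennreal (\<epsilon> * \<Lambda> (\<lambda>x. 1))" if \<epsilon>: "\<epsilon> > 0" for \<epsilon>
  proof -
    define h where "h = (\<lambda>x. max 0 (f x - \<epsilon>))"
    have h: "h \<in> tests (\<Union>i. V i)" "\<Lambda> f \<le> \<Lambda> h + \<epsilon> * \<Lambda> (\<lambda>x. 1)"
      unfolding h_def using truncation[OF f \<epsilon>] by auto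
    have hc: "continuous_on Y h" using h by (simp add: tests_def)
    define Kc where "Kc = {y\<in>Y. \<epsilon> \<le> f y}"
    have Kc: "compact Kc"
    proof -
      have "closed Kc"
        unfolding Kc_def
        using continuous_closed_preimage[OF cont compact_imp_closed[OF compact] closed_atLeast[of \<epsilon>]]
        by (simp add: vimage_def Int_def)
      then show ?thesis using compact compact_Int_closed[of Y Kc] by (simp add: Kc_def Int_absorb1 inf_commute Collect_conj_eq)
    qed
    have "Kc \<subseteq> (\<Union>i. V i)" using f \<epsilon> by (fastforce simp: Kc_def tests_def)
    then obtain I where I: "finite I" "Kc \<subseteq> (\<Union>i\<in>I. V i)"
      by (rule compactE_image[OF Kc op])
    have "\<exists>d. \<forall>i. continuous_on UNIV (d i) \<and> (\<forall>x. 0 \<le> d i x) \<and> (\<forall>x. (d i x :: real) > 0 \<longleftrightarrow> x \<in> V i)"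
      by (rule choice) (meson open_positive_function op)
    then obtain d where d: "\<And>i. continuous_on UNIV (d i)" "\<And>i x. 0 \<le> d i x"
      "\<And>i x. (d i x :: real) > 0 \<longleftrightarrow> x \<in> V i" by blast
    define s where "s x = (\<Sum>i\<in>I. d i x)" for x
    have sc: "continuous_on UNIV s" unfolding s_def by (intro continuous_intros d)
    have spos: "s x > 0" if xK: "x \<in> Kc" for x
    proof -
      obtain i where "i \<in> I" "x \<in> V i" using I(2) xK by blast
      then show ?thesis unfolding s_def using d I(1) by (intro sum_pos2[of I i]) auto
    qed
    obtain c where c: "c > 0" "\<And>x. x \<in> Kc \<Longrightarrow> c \<le> s x"
    proof (cases "Kc = {}")
      case True
      then show ?thesis using that[of 1] by auto
    next
      case False
      obtain x where "x \<in> Kc" "\<And>y. y \<in> Kc \<Longrightarrow> s x \<le> s y"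
        using continuous_attains_inf[OF Kc False, of s] continuous_on_subset[OF sc] by blast
      then show ?thesis using that[of "s x"] spos by auto
    qed
    \<comment> \<open>The denominator equals \<open>s x\<close> on \<open>Kc\<close>, where
      \<open>s\<close> is at least \<open>c\<close>; elsewhere \<open>h\<close> vanishes and the
      maximum merely keeps the quotient continuous.\<close>
    define g where "g i x = h x * (d i x / max (s x) c)" for i x
    have gc: "continuous_on Y (g i)" for i
      unfolding g_def using c(1)
      by (intro continuous_intros continuous_on_max hc continuous_on_subset[OF d(1)] continuous_on_subset[OF sc]) auto
    have gt: "g i \<in> tests (V i)" if i: "i \<in> I" for i
    proof -
      have "0 \<le> g i y \<and> g i y \<le> 1 \<and> (y \<notin> V i \<longrightarrow> g i y = 0)" if y: "y \<in> Y" for y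
      proof -
        have h01: "0 \<le> h y" "h y \<le> 1" using h(1) y by (auto simp: tests_def)
        have "d i y \<le> s y" unfolding s_def using I(1) i d(2) by (intro member_le_sum) auto
        then have "d i y / max (s y) c \<le> 1" using c(1) by (simp add: divide_le_eq_1 max_def)
        moreover have "0 \<le> d i y / max (s y) c" using c(1) d(2)[of i y] by (simp add: max_def)
        moreover have "y \<notin> V i \<Longrightarrow> d i y = 0" using d(2,3)[of i y] by (simp add: order_less_le)
        ultimately show ?thesis
          using h01 unfolding g_def by (intro conjI impI mult_nonneg_nonneg mult_le_one) simp_all
      qed
      then show ?thesis using gc by (auto simp: tests_def)
    qed
    have "\<Lambda> h = \<Lambda> (\<lambda>x. \<Sum>i\<in>I. g i x)"
    proof (rule cong[OF hc])
      fix x assume x: "x \<in> Y"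
      show "h x = (\<Sum>i\<in>I. g i x)"
      proof (cases "x \<in> Kc")
        case True
        then have "max (s x) c = s x" "s x > 0" using c(2)[of x] spos by auto
        then show ?thesis
          by (simp add: g_def sum_distrib_left[symmetric] sum_divide_distrib[symmetric] s_def[symmetric])
      next
        case False
        then have "h x = 0" using x by (auto simp: Kc_def h_def max_def)
        then show ?thesis by (simp add: g_def)
      qed
    qed
    also have "\<dots> = (\<Sum>i\<in>I. \<Lambda> (g i))" by (rule sum) (rule gc)
    finally have "ennreal (\<Lambda> h) = (\<Sum>i\<in>I. ennreal (\<Lambda> (g i)))"
      using gt by (subst sum_ennreal) (auto intro!: pos simp: tests_def)
    also have "\<dots> \<le> (\<Sum>i\<in>I. content0 (V i))"
      by (intro sum_mono content0_upper gt)
    also have "\<dots> \<le> (\<Sum>i. content0 (V i))"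
      by (intro sum_le_suminf) (auto simp: I)
    finally have "ennreal (\<Lambda> h) \<le> (\<Sum>i. content0 (V i))" .
    moreover have "ennreal (\<Lambda> f) \<le> ennreal (\<Lambda> h) + ennreal (\<epsilon> * \<Lambda> (\<lambda>x. 1))"
      using h(2) hc h(1) \<epsilon> one_nonneg
      by (subst ennreal_plus[symmetric]) (auto intro!: pos ennreal_leI simp: tests_def)
    ultimately show ?thesis using add_right_mono order_trans by blast
  qed
  show "ennreal (\<Lambda> f) \<le> (\<Sum>i. content0 (V i))"
  proof (rule ennreal_le_epsilon)
    fix e :: real assume e: "0 < e"
    \<comment> \<open>Adding 1 keeps \<open>c\<close> positive when \<Lambda> is zero.\<close>
    define c where "c = \<Lambda> (\<lambda>x. 1) + 1"
    have c: "c > 0" using one_nonneg by (simp add: c_def)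
    have "e / c * \<Lambda> (\<lambda>x. 1) \<le> e / c * c" using e c by (intro mult_left_mono) (auto simp: c_def)
    then have "ennreal (e / c * \<Lambda> (\<lambda>x. 1)) \<le> ennreal e" using c by (intro ennreal_leI) auto
    then show "ennreal (\<Lambda> f) \<le> (\<Sum>i. content0 (V i)) + ennreal e"
      using bound[of "e / c"] e c add_left_mono order_trans by (metis divide_pos_pos)
  qed
qed

lemma outer_measure_space_outer: "outer_measure_space (Pow UNIV) outer"
  unfolding outer_measure_space_def
proof (intro conjI)
  have "content0 {} \<le> 0"
    unfolding content0_def
  proof (rule SUP_least)
    fix f assume f: "f \<in> tests {}"
    then have "\<Lambda> f = \<Lambda> (\<lambda>x. 0)" by (intro cong) (auto simp: tests_def)
    then show "ennreal (\<Lambda> f) \<le> 0" by (simp add: zero)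
  qed
  then show "positive (Pow UNIV) outer" by (simp add: positive_def outer_open)
  show "increasing (Pow UNIV) outer" by (simp add: increasing_def outer_mono)
  show "countably_subadditive (Pow UNIV) outer"
    unfolding countably_subadditive_def
  proof (intro allI impI)
    fix S :: "nat \<Rightarrow> 'a set"
    show "outer (\<Union>i. S i) \<le> (\<Sum>i. outer (S i))"
    proof (rule ennreal_le_epsilon)
      fix e :: real assume e: "0 < e"
      have "\<exists>V. open V \<and> S i \<subseteq> V \<and> content0 V \<le> outer (S i) + ennreal (e * (1/2) ^ Suc i)" for i
      proof -
        have pos: "0 < ennreal (e * (1/2) ^ Suc i)" using e by simp
        have "outer (S i) < outer (S i) + ennreal (e * (1/2) ^ Suc i)"
          using outer_finite[of "S i"] pos by (simp add: ennreal_add_left_cancel_less)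
        then have "\<exists>V\<in>{V. open V \<and> S i \<subseteq> V}. content0 V < outer (S i) + ennreal (e * (1/2) ^ Suc i)"
          unfolding outer_def INF_less_iff by blast
        then show ?thesis using less_imp_le by blast
      qed
      then obtain V where V: "\<And>i. open (V i)" "\<And>i. S i \<subseteq> V i"
        "\<And>i. content0 (V i) \<le> outer (S i) + ennreal (e * (1/2) ^ Suc i)" by metis
      have "outer (\<Union>i. S i) \<le> outer (\<Union>i. V i)" by (rule outer_mono) (use V(2) in blast)
      also have "\<dots> = content0 (\<Union>i. V i)" using V(1) by (intro outer_open) auto
      also have "\<dots> \<le> (\<Sum>i. content0 (V i))" by (rule content0_UN[OF V(1)])
      also have "\<dots> \<le> (\<Sum>i. outer (S i) + ennreal (e * (1/2) ^ Suc i))"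
        by (intro suminf_le V(3)) auto
      also have "\<dots> = (\<Sum>i. outer (S i)) + (\<Sum>i. ennreal (e * (1/2) ^ Suc i))"
        by (rule suminf_add[symmetric]) auto
      also have "(\<Sum>i. ennreal (e * (1/2) ^ Suc i)) = ennreal e"
        using e sums_mult[OF power_half_series, of e] by (intro suminf_ennreal_eq) auto
      finally show "outer (\<Union>i. S i) \<le> (\<Sum>i. outer (S i)) + ennreal e" .
    qed
  qed
qed


lemma outer_approx:
  assumes "\<epsilon> > 0"
  obtains W where "open W" "S \<subseteq> W" "content0 W \<le> outer S + ennreal \<epsilon>"
proof -
  have "outer S < outer S + ennreal \<epsilon>"
    using outer_finite[of S] assms by (simp add: ennreal_add_left_cancel_less)
  then have "\<exists>V\<in>{V. open V \<and> S \<subseteq> V}. content0 V < outer S + ennreal \<epsilon>"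
    unfolding outer_def INF_less_iff by blast
  then show thesis using that less_imp_le by blast
qed

text \<open>A truncated test for W \<inter> V and a test for \<open>W\<close> minus its carrier are
  never nonzero at the same point, so their sum is a test for \<open>W\<close>. This is the
  nontrivial half of Caratheodory's criterion for \<open>V\<close>, checked on open sets.\<close>

lemma content0_split:
  assumes V: "open V" and W: "open W"
  shows "content0 (W \<inter> V) + outer (W - V) \<le> content0 W"
proof -
  have "content0 (W \<inter> V) \<le> content0 W - outer (W - V)"
    unfolding content0_def[of "W \<inter> V"]
  proof (rule SUP_least)
    fix f assume f: "f \<in> tests (W \<inter> V)"
    have cont: "continuous_on Y f" using f by (simp add: tests_def)
    have "ennreal (\<Lambda> f) + outer (W - V) \<le> content0 W"
    proof (rule ennreal_le_epsilon)
      fix e :: real assume e: "0 < e"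
      define c where "c = \<Lambda> (\<lambda>x. 1) + 1"
      have c: "c > 0" using one_nonneg by (simp add: c_def)
      define \<epsilon> where "\<epsilon> = e / c"
      have \<epsilon>: "\<epsilon> > 0" using e c by (simp add: \<epsilon>_def)
      have "\<epsilon> * \<Lambda> (\<lambda>x. 1) \<le> \<epsilon> * c" using \<epsilon> by (intro mult_left_mono) (auto simp: c_def)
      then have \<epsilon>e: "\<epsilon> * \<Lambda> (\<lambda>x. 1) \<le> e" using c by (simp add: \<epsilon>_def)
      define h where "h = (\<lambda>x. max 0 (f x - \<epsilon>))"
      have h: "h \<in> tests (W \<inter> V)" "\<Lambda> f \<le> \<Lambda> h + \<epsilon> * \<Lambda> (\<lambda>x. 1)"
        unfolding h_def using truncation[OF f \<epsilon>] by auto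
      have hc: "continuous_on Y h" using h by (simp add: tests_def)
      have h0: "0 \<le> \<Lambda> h" using h(1) hc by (intro pos) (auto simp: tests_def)
      define Kc where "Kc = {y\<in>Y. \<epsilon> \<le> f y}"
      have "closed Kc"
        unfolding Kc_def
        using continuous_closed_preimage[OF cont compact_imp_closed[OF compact] closed_atLeast[of \<epsilon>]]
        by (simp add: vimage_def Int_def)
      then have opK: "open (W - Kc)" using W by auto
      \<comment> \<open>The carrier lies inside \<open>V\<close>, so removing it from
        \<open>W\<close> leaves an open set that still contains W - V.\<close>
      have "Kc \<subseteq> V" using f \<epsilon> by (force simp: Kc_def tests_def)
      then have "outer (W - V) \<le> content0 (W - Kc)"
        using outer_open[OF opK] outer_mono[of "W - V" "W - Kc"] by auto
      also have "content0 (W - Kc) \<le> content0 W - ennreal (\<Lambda> h)"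
        unfolding content0_def[of "W - Kc"]
      proof (rule SUP_least)
        fix g assume g: "g \<in> tests (W - Kc)"
        have gc: "continuous_on Y g" using g by (simp add: tests_def)
        have g0: "0 \<le> \<Lambda> g" using g gc by (intro pos) (auto simp: tests_def)
        have "(\<lambda>x. h x + g x) \<in> tests W"
        proof -
          have "0 \<le> h y + g y \<and> h y + g y \<le> 1 \<and> (y \<notin> W \<longrightarrow> h y + g y = 0)" if y: "y \<in> Y" for y
          proof (cases "y \<in> Kc")
            case True
            then have "g y = 0" using g y by (auto simp: tests_def)
            then show ?thesis using h(1) y by (auto simp: tests_def)
          next
            case False
            then have "h y = 0" using y by (auto simp: Kc_def h_def max_def)
            then show ?thesis using g y by (auto simp: tests_def)
          qed
          then show ?thesis by (auto simp: tests_def intro: continuous_on_add hc gc)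
        qed
        then have "ennreal (\<Lambda> h + \<Lambda> g) \<le> content0 W" using content0_upper add[OF hc gc] by metis
        then show "ennreal (\<Lambda> g) \<le> content0 W - ennreal (\<Lambda> h)"
          using h0 g0 by (simp add: ennreal_plus add.commute ennreal_le_minus_iff)
      qed
      finally have "outer (W - V) \<le> content0 W - ennreal (\<Lambda> h)" .
      moreover have "ennreal (\<Lambda> h) \<le> content0 W"
        using h(1) tests_mono[of "W \<inter> V" W] by (intro content0_upper) auto
      ultimately have "ennreal (\<Lambda> h) + outer (W - V) \<le> content0 W"
        by (metis add.commute ennreal_le_minus_iff ennreal_diff_le_mono_left add_right_mono diff_add_cancel_ennreal)
      moreover have "ennreal (\<Lambda> f) \<le> ennreal (\<Lambda> h) + ennreal e"
        using ennreal_leI[of "\<Lambda> f" "\<Lambda> h + e"] h(2) \<epsilon>e h0 e by simp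
      ultimately have le: "ennreal (\<Lambda> f) \<le> ennreal (\<Lambda> h) + ennreal e"
        "ennreal (\<Lambda> h) + outer (W - V) \<le> content0 W" by blast+
      have "ennreal (\<Lambda> f) + outer (W - V) \<le> (ennreal (\<Lambda> h) + ennreal e) + outer (W - V)"
        by (intro add_right_mono le)
      also have "\<dots> = (ennreal (\<Lambda> h) + outer (W - V)) + ennreal e" by (simp only: add_ac)
      also have "\<dots> \<le> content0 W + ennreal e" by (intro add_right_mono le)
      finally show "ennreal (\<Lambda> f) + outer (W - V) \<le> content0 W + ennreal e" .
    qed
    then show "ennreal (\<Lambda> f) \<le> content0 W - outer (W - V)"
      using outer_finite[of "W - V"] by (simp add: ennreal_le_minus_iff)
  qed
  moreover have "outer (W - V) \<le> content0 W"
    using outer_mono[of "W - V" W] outer_open[OF W] by auto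
  ultimately show ?thesis
    using add_right_mono[of "content0 (W \<inter> V)" "content0 W - outer (W - V)" "outer (W - V)"]
    by (simp add: diff_add_cancel_ennreal)
qed

lemma open_in_lambda_system:
  assumes V: "open V"
  shows "V \<in> lambda_system UNIV (Pow UNIV) outer"
  unfolding lambda_system_def
proof (intro CollectI conjI ballI)
  fix S :: "'a set"
  show "outer (V \<inter> S) + outer ((UNIV - V) \<inter> S) = outer S"
  proof (rule antisym)
    show "outer (V \<inter> S) + outer ((UNIV - V) \<inter> S) \<le> outer S"
    proof (rule ennreal_le_epsilon)
      fix e :: real assume e: "0 < e"
      obtain W where W: "open W" "S \<subseteq> W" "content0 W \<le> outer S + ennreal e"
        using outer_approx[OF e] by blast
      have "outer (V \<inter> S) \<le> content0 (W \<inter> V)"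
        using outer_mono[of "V \<inter> S" "W \<inter> V"] outer_open[OF open_Int[OF W(1) V]] W(2) by force
      moreover have "outer ((UNIV - V) \<inter> S) \<le> outer (W - V)"
        using W by (intro outer_mono) auto
      ultimately have "outer (V \<inter> S) + outer ((UNIV - V) \<inter> S) \<le> content0 (W \<inter> V) + outer (W - V)"
        by (rule add_mono)
      also have "\<dots> \<le> content0 W" by (rule content0_split[OF V W(1)])
      also note W(3)
      finally show "outer (V \<inter> S) + outer ((UNIV - V) \<inter> S) \<le> outer S + ennreal e" .
    qed
    have "subadditive (Pow UNIV) outer"
      using outer_measure_space_outer unfolding outer_measure_space_def
      by (intro ring_of_sets.countably_subadditive_subadditive[OF ring_of_sets_Pow]) auto
    then have "outer ((V \<inter> S) \<union> ((UNIV - V) \<inter> S)) \<le> outer (V \<inter> S) + outer ((UNIV - V) \<inter> S)"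
      by (rule subadditiveD) auto
    moreover have "(V \<inter> S) \<union> ((UNIV - V) \<inter> S) = S" by blast
    ultimately show "outer S \<le> outer (V \<inter> S) + outer ((UNIV - V) \<inter> S)" by simp
  qed
qed auto

section \<open>The Borel measure of the functional and its integral formula\<close>

definition riesz_measure :: "'a measure" where
  "riesz_measure = measure_of UNIV (sets borel) outer"

lemma sets_riesz_measure [simp, measurable_cong]: "sets riesz_measure = sets borel"
  using sets.sigma_sets_eq[of "borel :: 'a measure"]
  by (simp add: riesz_measure_def)

lemma space_riesz_measure [simp]: "space riesz_measure = UNIV"
  by (simp add: riesz_measure_def)

lemma emeasure_riesz_measure:
  assumes "S \<in> sets borel"
  shows "emeasure riesz_measure S = outer S"
proof -
  define L where "L = lambda_system UNIV (Pow UNIV) outer"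
  have ms: "measure_space UNIV L outer"
    unfolding L_def
    using sigma_algebra.caratheodory_lemma[OF sigma_algebra_Pow outer_measure_space_outer] .
  then have sa: "sigma_algebra UNIV L" and ca: "countably_additive L outer" and po: "positive L outer"
    by (auto simp: measure_space_def)
  have "sets (borel :: 'a measure) = sigma_sets UNIV {S. open S}"
    by (simp add: borel_def)
  also have "\<dots> \<subseteq> L"
    using open_in_lambda_system by (intro sigma_algebra.sigma_sets_subset[OF sa]) (auto simp: L_def)
  finally have sub: "sets (borel :: 'a measure) \<subseteq> L" .
  show ?thesis
    unfolding riesz_measure_def
  proof (rule emeasure_measure_of)
    show "sets borel \<subseteq> Pow (UNIV :: 'a set)" by simp
    show "positive (sets (measure_of UNIV (sets borel) outer)) outer"
      using po by (auto simp: positive_def)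
    have "sets (measure_of UNIV (sets borel) outer) = sets borel"
      using sets_riesz_measure unfolding riesz_measure_def .
    then show "countably_additive (sets (measure_of UNIV (sets borel) outer)) outer"
      using sub ca unfolding countably_additive_def by (auto simp: subset_iff)
    show "S \<in> sets (measure_of UNIV (sets borel) outer)"
      using assms sets_riesz_measure unfolding riesz_measure_def by blast
  qed simp
qed

lemma finite_riesz_measure: "finite_measure riesz_measure"
  by (rule finite_measureI) (use outer_finite[of UNIV] in \<open>simp add: emeasure_riesz_measure less_top\<close>)

lemma borel_Y: "Y \<in> sets borel"
  using compact compact_imp_closed by (auto intro: borel_closed)

lemma riesz_measure_null: "emeasure riesz_measure (- Y) = 0"
proof -
  have op: "open (- Y)" using compact compact_imp_closed by auto
  have "content0 (- Y) \<le> 0"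
    unfolding content0_def
  proof (rule SUP_least)
    fix f assume f: "f \<in> tests (- Y)"
    then have "\<Lambda> f = \<Lambda> (\<lambda>x. 0)" by (intro cong) (auto simp: tests_def)
    then show "ennreal (\<Lambda> f) \<le> 0" by (simp add: zero)
  qed
  then show ?thesis using op by (simp add: emeasure_riesz_measure outer_open)
qed

lemma borel_measurable_cont:
  assumes "continuous_on Y f"
  shows "(\<lambda>x. indicator Y x * f x :: real) \<in> borel_measurable borel"
  using borel_measurable_continuous_on_indicator[OF borel_Y assms] by simp

lemma integrable_riesz:
  assumes "continuous_on Y f"
  shows "integrable riesz_measure (\<lambda>x. indicator Y x * f x :: real)"
proof -
  interpret finite_measure riesz_measure by (rule finite_riesz_measure)
  have "compact (f ` Y)" by (intro compact_continuous_image assms compact)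
  then obtain B where B: "\<And>y. y \<in> Y \<Longrightarrow> norm (f y) \<le> B"
    using compact_imp_bounded[of "f ` Y"] unfolding bounded_iff by blast
  have "(\<lambda>x. indicator Y x * f x :: real) \<in> borel_measurable riesz_measure"
    using borel_measurable_cont[OF assms] by simp
  then show ?thesis
    using B by (intro integrable_const_bound[of _ "\<bar>B\<bar>"]) (force simp: indicator_def)+
qed

text \<open>The function n f is cut horizontally into n slices with values between 0 and 1. Both the
  integral of the k-th slice and its image under \<Lambda> lie between the measures of the sets
  where n f exceeds k + 1 and k. The differences telescope, so the two functionals differ at f by at
  most the total mass over n.\<close>

lemma riesz_unit:
  assumes f: "continuous_on Y f" and f01: "\<And>y. y \<in> Y \<Longrightarrow> 0 \<le> f y \<and> f y \<le> 1"
  shows "(LINT x|riesz_measure. indicator Y x * f x) = \<Lambda> f"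
proof -
  interpret finite_measure riesz_measure by (rule finite_riesz_measure)
  define I where "I f = (LINT x|riesz_measure. indicator Y x * f x)" for f :: "'a \<Rightarrow> real"
  have bound: "\<bar>I f - \<Lambda> f\<bar> \<le> measure riesz_measure UNIV / real n" if n: "n > 0" for n
  proof -
    \<comment> \<open>The complement of \<open>Y\<close> is included to make \<open>U k\<close> open
      in the whole space; it has measure zero.\<close>
    define U where "U k = - {y\<in>Y. f y \<le> real k / real n}" for k
    define m where "m k = measure riesz_measure (U k)" for k
    \<comment> \<open>The part of n f between the heights k and k + 1: on \<open>Y\<close> it is 0
      off \<open>U k\<close> and 1 on \<open>U (Suc k)\<close>.\<close>
    define F where "F k x = min (max (real n * f x - real k) 0) 1" for k x
    have opU: "open (U k)" for k
    proof -
      have "closed {y\<in>Y. f y \<le> real k / real n}"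
        using continuous_closed_preimage[OF f compact_imp_closed[OF compact] closed_atMost[of "real k / real n"]]
        by (simp add: vimage_def Int_def)
      then show ?thesis by (auto simp: U_def)
    qed
    have cF: "continuous_on Y (F k)" for k
      unfolding F_def by (intro continuous_on_min continuous_on_max continuous_intros f)
    have U_iff: "y \<in> U k \<longleftrightarrow> real k < real n * f y" if "y \<in> Y" for y k
      using that n by (auto simp: U_def field_simps)
    have F01: "0 \<le> F k y" "F k y \<le> 1" for k y by (auto simp: F_def)
    have F_zero: "F k y = 0" if "y \<in> Y" "y \<notin> U k" for y k
      using that U_iff[OF that(1)] by (auto simp: F_def)
    have F_one: "F k y = 1" if "y \<in> Y" "y \<in> U (Suc k)" for y k
      using that U_iff[OF that(1)] by (auto simp: F_def)
    have emU: "emeasure riesz_measure (U k) = content0 (U k)" for k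
      using opU by (simp add: emeasure_riesz_measure outer_open)
    have \<Lambda>0: "0 \<le> \<Lambda> (F k)" for k by (intro pos cF F01)
    have up: "\<Lambda> (F k) \<le> m k" for k
    proof -
      have "F k \<in> tests (U k)" using cF F01 F_zero by (auto simp: tests_def)
      then have "ennreal (\<Lambda> (F k)) \<le> emeasure riesz_measure (U k)" by (simp add: emU content0_upper)
      then show ?thesis unfolding m_def emeasure_eq_measure by (simp add: ennreal_le_iff)
    qed
    have low: "m (Suc k) \<le> \<Lambda> (F k)" for k
    proof -
      have "content0 (U (Suc k)) \<le> ennreal (\<Lambda> (F k))"
        unfolding content0_def
      proof (rule SUP_least, rule ennreal_leI, rule mono)
        fix g x assume g: "g \<in> tests (U (Suc k))"
        show "continuous_on Y g" using g by (simp add: tests_def)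
        show "g x \<le> F k x" if "x \<in> Y"
          using g that F_one[OF that] F01[of k x] by (cases "x \<in> U (Suc k)") (auto simp: tests_def)
      qed (rule cF)
      then show ?thesis
        unfolding m_def emU[symmetric] emeasure_eq_measure by (simp add: ennreal_le_iff \<Lambda>0)
    qed
    have meU: "U k \<in> sets borel" for k using opU by auto
    have mY: "(LINT x|riesz_measure. indicator Y x * indicator (U k) x) = m k" for k
    proof -
      have "(LINT x|riesz_measure. indicator Y x * indicator (U k) x :: real) = (LINT x|riesz_measure. indicator (U k) x)"
      proof (rule integral_cong_AE)
        have "AE x in riesz_measure. x \<in> Y"
          using riesz_measure_null borel_Y
          by (intro AE_I'[of "- Y"]) (auto simp: null_sets_def)
        then show "AE x in riesz_measure. indicator Y x * indicator (U k) x = (indicator (U k) x :: real)"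
          by eventually_elim simp
        show "(\<lambda>x. indicator Y x * indicator (U k) x :: real) \<in> borel_measurable riesz_measure"
          using borel_Y meU by (intro borel_measurable_times borel_measurable_indicator) auto
        show "(indicator (U k) :: 'a \<Rightarrow> real) \<in> borel_measurable riesz_measure"
          using meU by (intro borel_measurable_indicator) auto
      qed
      then show ?thesis using meU by (simp add: m_def)
    qed
    have intU: "integrable riesz_measure (\<lambda>x. indicator Y x * indicator (U k) x :: real)" for k
    proof (rule integrable_const_bound[of _ 1])
      show "(\<lambda>x. indicator Y x * indicator (U k) x :: real) \<in> borel_measurable riesz_measure"
        using borel_Y meU by (intro borel_measurable_times borel_measurable_indicator) auto
    qed (auto simp: indicator_def)
    have upI: "I (F k) \<le> m k" for k
      unfolding I_def mY[symmetric]
      by (intro integral_mono integrable_riesz cF intU) (use F01 F_zero in \<open>auto simp: indicator_def\<close>)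
    have lowI: "m (Suc k) \<le> I (F k)" for k
      unfolding I_def mY[symmetric]
      by (intro integral_mono integrable_riesz cF intU) (use F01 F_one in \<open>auto simp: indicator_def\<close>)
    have sumF: "(\<Sum>k<N. F k x) = min (real n * f x) (real N)" if "x \<in> Y" for x N
    proof (induction N)
      case 0
      then show ?case using f01[OF that] by simp
    next
      case (Suc N)
      then show ?case by (auto simp: F_def min_def max_def)
    qed
    have sumF': "real n * f x = (\<Sum>k<n. F k x)" if "x \<in> Y" for x
      using sumF[OF that, of n] f01[OF that] mult_left_mono[of "f x" 1 "real n"] by auto
    have "real n * \<Lambda> f = \<Lambda> (\<lambda>x. real n * f x)" using scale[OF f] by simp
    also have "\<dots> = \<Lambda> (\<lambda>x. \<Sum>k<n. F k x)"
      by (rule cong) (auto intro!: continuous_intros f sumF')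
    also have "\<dots> = (\<Sum>k<n. \<Lambda> (F k))" by (rule sum) (rule cF)
    finally have \<Lambda>s: "real n * \<Lambda> f = (\<Sum>k<n. \<Lambda> (F k))" .
    have "real n * I f = I (\<lambda>x. real n * f x)"
      unfolding I_def by (simp add: mult.left_commute)
    also have "\<dots> = (LINT x|riesz_measure. (\<Sum>k<n. indicator Y x * F k x))"
      unfolding I_def by (intro Bochner_Integration.integral_cong) (auto simp: indicator_def sumF')
    also have "\<dots> = (\<Sum>k<n. I (F k))"
      unfolding I_def by (rule Bochner_Integration.integral_sum) (intro integrable_riesz cF)
    finally have Is: "real n * I f = (\<Sum>k<n. I (F k))" .
    have tele: "(\<Sum>k<n. m k - m (Suc k)) = m 0 - m n" by (rule sum_lessThan_telescope')
    have "\<bar>\<Sum>k<n. I (F k) - \<Lambda> (F k)\<bar> \<le> (\<Sum>k<n. m k - m (Suc k))"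
    proof (rule order_trans[OF sum_abs sum_mono])
      show "\<bar>I (F k) - \<Lambda> (F k)\<bar> \<le> m k - m (Suc k)" for k
        using upI[of k] lowI[of k] up[of k] low[of k] by linarith
    qed
    also have "\<dots> \<le> m 0" using tele by (simp add: m_def)
    also have "\<dots> \<le> measure riesz_measure UNIV"
      unfolding m_def by (rule bounded_measure[of "U 0", simplified])
    finally have "\<bar>real n * (I f - \<Lambda> f)\<bar> \<le> measure riesz_measure UNIV"
      by (simp add: right_diff_distrib \<Lambda>s Is sum_subtractf)
    then have "\<bar>I f - \<Lambda> f\<bar> * real n \<le> measure riesz_measure UNIV"
      using n by (simp only: abs_mult abs_of_nat mult.commute)
    then show ?thesis using n by (simp only: pos_le_divide_eq of_nat_0_less_iff)
  qed
  have "\<bar>I f - \<Lambda> f\<bar> \<le> 0"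
  proof (rule tendsto_lowerbound)
    show "(\<lambda>n. measure riesz_measure UNIV / real n) \<longlonglongrightarrow> 0"
      by (rule lim_const_over_n)
    show "\<forall>\<^sub>F n in sequentially. \<bar>I f - \<Lambda> f\<bar> \<le> measure riesz_measure UNIV / real n"
      using eventually_gt_at_top[of 0] by eventually_elim (rule bound)
  qed simp
  then show ?thesis by (simp add: I_def)
qed

theorem riesz:
  assumes f: "continuous_on Y f"
  shows "(LINT x|riesz_measure. indicator Y x * f x) = \<Lambda> f"
proof -
  have "compact (f ` Y)" by (intro compact_continuous_image f compact)
  then obtain B where B: "\<And>y. y \<in> Y \<Longrightarrow> norm (f y) \<le> B"
    using compact_imp_bounded[of "f ` Y"] unfolding bounded_iff by blast
  define b where "b = \<bar>B\<bar> + 1"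
  have b: "b > 0" "\<And>y. y \<in> Y \<Longrightarrow> \<bar>f y\<bar> \<le> b" using B by (force simp: b_def)+
  define g where "g = (\<lambda>y. (f y + b) / (2 * b))"
  have gc: "continuous_on Y g" unfolding g_def using b(1) by (intro continuous_intros f) auto
  have g01: "0 \<le> g y \<and> g y \<le> 1" if "y \<in> Y" for y
    using b(2)[OF that] b(1) by (auto simp: g_def divide_simps)
  have feq: "f y = 2 * b * g y + (- b) * 1" for y using b(1) by (simp add: g_def)
  have "\<Lambda> f = \<Lambda> (\<lambda>y. 2 * b * g y + (- b) * 1)" using feq by (intro arg_cong[of _ _ \<Lambda>]) auto
  also have "\<dots> = 2 * b * \<Lambda> g + (- b) * \<Lambda> (\<lambda>_. 1)"
    by (subst add, intro continuous_intros gc, intro continuous_intros, subst scale[OF gc], subst scale, auto)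
  also have "\<dots> = 2 * b * (LINT x|riesz_measure. indicator Y x * g x) + (- b) * (LINT x|riesz_measure. indicator Y x * 1)"
    using riesz_unit[OF gc g01] riesz_unit[of "\<lambda>_. 1"] by simp
  also have "\<dots> = (LINT x|riesz_measure. 2 * b * (indicator Y x * g x) + (- b) * (indicator Y x * 1))"
    using integrable_riesz[OF gc] integrable_riesz[of "\<lambda>_. 1"]
    by (subst Bochner_Integration.integral_add) auto
  also have "\<dots> = (LINT x|riesz_measure. indicator Y x * f x)"
    by (intro Bochner_Integration.integral_cong) (auto simp: feq algebra_simps)
  finally show ?thesis by simp
qed

end

section \<open>Annihilating measures\<close>

text \<open>The sublinear functional below is the gauge that forces its linear minorants to be
  positive, normalised and at least d on T.\<close>

lemma separating_functional:
  fixes Y :: "'a::metric_space set" and T :: "('a \<Rightarrow>\<^sub>C real) set"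
  assumes Y: "Y \<noteq> {}" and T: "convex T" "T \<noteq> {}" and d: "\<And>s. s \<in> T \<Longrightarrow> \<exists>y\<in>Y. d \<le> apply_bcontfun s y"
  obtains L where "linear L" "\<And>u b. (\<And>y. y \<in> Y \<Longrightarrow> apply_bcontfun u y \<le> b) \<Longrightarrow> L u \<le> b"
    "\<And>s. s \<in> T \<Longrightarrow> d \<le> L s"
proof -
  \<comment> \<open>With t = 0 every upper bound of u on \<open>Y\<close> lies in
    \<open>V u\<close>; with u = -s and t = 1 the number -d does. These two facts become the two
    properties of \<open>L\<close>.\<close>
  define V where "V u = {b. \<exists>t\<ge>0. \<exists>s\<in>T. \<forall>y\<in>Y. apply_bcontfun u y + t * (apply_bcontfun s y - d) \<le> b}" for u
  define p where "p u = Inf (V u)" for u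
  have lb: "- norm u \<le> b" if b: "b \<in> V u" for u b
  proof -
    obtain t s where ts: "t \<ge> 0" "s \<in> T" "\<And>y. y \<in> Y \<Longrightarrow> apply_bcontfun u y + t * (apply_bcontfun s y - d) \<le> b"
      using b unfolding V_def by blast
    \<comment> \<open>At such a \<open>y\<close> the added term is nonnegative, so no
      \<open>t\<close> and \<open>s\<close> can push \<open>b\<close> below - norm u. This makes the
      infimum finite.\<close>
    obtain y where y: "y \<in> Y" "d \<le> apply_bcontfun s y" using d ts(2) by blast
    have "0 \<le> t * (apply_bcontfun s y - d)" using ts(1) y(2) by simp
    moreover have "- norm u \<le> apply_bcontfun u y" using norm_bounded[of u y] by (simp add: abs_le_iff)
    ultimately show ?thesis using ts(3)[OF y(1)] by linarith
  qed
  obtain s0 where s0: "s0 \<in> T" using T by blast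
  have V_I: "b \<in> V u" if "\<And>y. y \<in> Y \<Longrightarrow> apply_bcontfun u y \<le> b" for u b
    unfolding V_def using that s0 by (intro CollectI exI[of _ 0]) auto
  have ne: "V u \<noteq> {}" for u
    using V_I[of u "norm u"] norm_bounded[of u] by (force simp: abs_le_iff)
  have bdd: "bdd_below (V u)" for u using lb by (intro bdd_belowI) blast
  have p_le: "p u \<le> b" if "b \<in> V u" for u b
    unfolding p_def by (rule cInf_lower[OF that bdd])
  have p_ge: "b \<le> p u" if "\<And>x. x \<in> V u \<Longrightarrow> b \<le> x" for u b
    unfolding p_def by (rule cInf_greatest[OF ne that])
  have V_add: "a + b \<in> V (u + v)" if a: "a \<in> V u" and b: "b \<in> V v" for a b u v
  proof -
    obtain t s where ts: "t \<ge> 0" "s \<in> T" "\<And>y. y \<in> Y \<Longrightarrow> apply_bcontfun u y + t * (apply_bcontfun s y - d) \<le> a"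
      using a unfolding V_def by blast
    obtain t' s' where ts': "t' \<ge> 0" "s' \<in> T" "\<And>y. y \<in> Y \<Longrightarrow> apply_bcontfun v y + t' * (apply_bcontfun s' y - d) \<le> b"
      using b unfolding V_def by blast
    show ?thesis
    proof (cases "t + t' = 0")
      case True
      then have "t = 0" "t' = 0" using ts(1) ts'(1) by auto
      then show ?thesis using ts(3) ts'(3) by (intro V_I) (auto simp: plus_bcontfun.rep_eq intro: add_mono)
    next
      case False
      then have tt: "t + t' > 0" using ts(1) ts'(1) by simp
      \<comment> \<open>Convexity of \<open>T\<close> merges the two weighted constraints into one
        of weight t + t'.\<close>
      define s'' where "s'' = (t / (t + t')) *\<^sub>R s + (t' / (t + t')) *\<^sub>R s'"
      have "s'' \<in> T"
        unfolding s''_def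
        by (rule convexD[OF T(1) ts(2) ts'(2)]) (use ts(1) ts'(1) tt in \<open>auto simp: add_divide_distrib[symmetric]\<close>)
      moreover have "(t + t') * (apply_bcontfun s'' y - d) = t * (apply_bcontfun s y - d) + t' * (apply_bcontfun s' y - d)" for y
        using tt by (simp add: s''_def plus_bcontfun.rep_eq scaleR_bcontfun.rep_eq divide_simps) (simp add: algebra_simps)
      ultimately show ?thesis
        unfolding V_def using ts(3) ts'(3) tt
        by (intro CollectI exI[of _ "t + t'"] conjI bexI[of _ s'']) (fastforce simp: plus_bcontfun.rep_eq)+
    qed
  qed
  have "sublinear p"
    unfolding sublinear_def
  proof (intro conjI allI impI)
    fix u v
    have "p (u + v) - b \<le> p u" if b: "b \<in> V v" for b
    proof (rule p_ge)
      fix a assume "a \<in> V u"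
      then show "p (u + v) - b \<le> a" using p_le[OF V_add[OF _ b]] by (simp add: algebra_simps)
    qed
    then have "p (u + v) - p u \<le> p v" by (intro p_ge) (simp add: algebra_simps)
    then show "p (u + v) \<le> p u + p v" by simp
  next
    fix c :: real and u assume c: "c > 0"
    have "p (c *\<^sub>R u) / c \<le> p u"
    proof (rule p_ge)
      fix b assume "b \<in> V u"
      then obtain t s where ts: "t \<ge> 0" "s \<in> T" "\<And>y. y \<in> Y \<Longrightarrow> apply_bcontfun u y + t * (apply_bcontfun s y - d) \<le> b"
        unfolding V_def by blast
      have "c * b \<in> V (c *\<^sub>R u)"
        unfolding V_def
      proof (intro CollectI exI[of _ "c * t"] conjI bexI[OF _ ts(2)] ballI)
        fix y assume "y \<in> Y"
        then have "c * (apply_bcontfun u y + t * (apply_bcontfun s y - d)) \<le> c * b"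
          using ts(3) c by (intro mult_left_mono) auto
        then show "apply_bcontfun (c *\<^sub>R u) y + c * t * (apply_bcontfun s y - d) \<le> c * b"
          by (simp add: scaleR_bcontfun.rep_eq algebra_simps)
      qed (use c ts(1) in simp)
      then show "p (c *\<^sub>R u) / c \<le> b" using p_le c by (simp add: divide_le_eq mult.commute)
    qed
    then show "p (c *\<^sub>R u) \<le> c * p u" using c by (simp add: divide_le_eq mult.commute)
  qed
  then obtain L where L: "linear L" "\<And>u. L u \<le> p u" using hahn_banach_sublinear by blast
  show thesis
  proof (rule that[OF L(1)])
    show "L u \<le> b" if "\<And>y. y \<in> Y \<Longrightarrow> apply_bcontfun u y \<le> b" for u b
      using L(2)[of u] p_le[OF V_I[of u b]] that by force
    fix s assume s: "s \<in> T"
    have "- d \<in> V (- s)"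
      unfolding V_def using s by (intro CollectI exI[of _ 1]) (auto simp: uminus_bcontfun.rep_eq intro!: bexI[of _ s])
    then have "L (- s) \<le> - d" using L(2)[of "- s"] p_le order_trans by blast
    then show "d \<le> L s" using linear_neg[OF L(1), of s] by simp
  qed
qed

text \<open>A complex measure on X is represented by a finite positive measure N on pairs (x, u) with u in the
  closed unit disc and the weight c (x, u) = u, so that neither polar decompositions nor total
  variations of complex measures are needed.\<close>

theorem annihilating_measure:
  fixes X :: "complex set" and B :: "(complex \<Rightarrow> complex) set"
  assumes X: "compact X" "convex X" "X \<noteq> {}"
    and B0: "(\<lambda>_. 0) \<in> B"
    and Badd: "\<And>f g. f \<in> B \<Longrightarrow> g \<in> B \<Longrightarrow> (\<lambda>z. f z + g z) \<in> B"
    and Bscale: "\<And>a f. f \<in> B \<Longrightarrow> (\<lambda>z. a * f z) \<in> B"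
    and Bcont: "\<And>f. f \<in> B \<Longrightarrow> continuous_on X f"
    and g: "continuous_on X g" and \<epsilon>: "\<epsilon> > 0" and far: "\<And>f. f \<in> B \<Longrightarrow> \<exists>z\<in>X. \<epsilon> \<le> norm (g z - f z)"
  obtains N :: "(complex \<times> complex) measure" and c :: "complex \<times> complex \<Rightarrow> complex" where
    "finite_measure N" "sets N = sets borel" "c \<in> borel_measurable borel" "\<And>y. norm (c y) \<le> 1"
    "\<And>y. fst y \<notin> X \<Longrightarrow> c y = 0"
    "\<And>f. f \<in> B \<Longrightarrow> (LINT y|N. c y * f (fst y)) = 0"
    "(LINT y|N. c y * g (fst y)) \<noteq> 0"
proof -
  define Y where "Y = X \<times> cball (0::complex) 1"
  have Y: "compact Y" "convex Y" "Y \<noteq> {}"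
    using X by (auto simp: Y_def intro: compact_Times convex_Times)
  \<comment> \<open>The nearest-point retraction onto the convex set \<open>Y\<close> extends
    functions from \<open>Y\<close> to bounded continuous functions on the whole space, the vector
    space on which \<open>separating_functional\<close> acts.\<close>
  define \<pi> where "\<pi> = closest_point Y"
  have \<pi>cont: "continuous_on UNIV \<pi>"
    unfolding \<pi>_def using Y by (intro continuous_on_closest_point compact_imp_closed)
  have \<pi>Y: "\<pi> y \<in> Y" for y
    unfolding \<pi>_def using Y by (intro closest_point_in_set compact_imp_closed)
  have \<pi>id: "\<pi> y = y" if "y \<in> Y" for y
    unfolding \<pi>_def using that by (rule closest_point_self)
  define \<beta> where "\<beta> u = Bcontfun (\<lambda>y. u (\<pi> y))" for u :: "complex \<times> complex \<Rightarrow> real"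
  have \<beta>: "apply_bcontfun (\<beta> u) = (\<lambda>y. u (\<pi> y))" if u: "continuous_on Y u" for u
  proof -
    have "continuous_on UNIV (\<lambda>y. u (\<pi> y))"
      by (rule continuous_on_compose2[OF u \<pi>cont]) (use \<pi>Y in auto)
    moreover have "bounded (u ` Y)" by (intro compact_imp_bounded compact_continuous_image u Y)
    then have "bounded (range (\<lambda>y. u (\<pi> y)))" by (rule bounded_subset) (use \<pi>Y in auto)
    ultimately have "(\<lambda>y. u (\<pi> y)) \<in> bcontfun" by (simp add: bcontfun_def)
    then show ?thesis unfolding \<beta>_def by (rule Bcontfun_inverse)
  qed
  have c2: "continuous_on Y (\<lambda>y. Re (snd y * f (fst y)))" if "continuous_on X f" for f
    by (intro continuous_intros continuous_on_compose2[OF that continuous_on_fst[OF continuous_on_id]])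
       (auto simp: Y_def)
  \<comment> \<open>For fixed z the supremum over the second coordinate in the unit disc is |g z - f
    z|, so uniform distance turns into the one-sided bound that \<open>separating_functional\<close>
    asks for.\<close>
  define s where "s f = \<beta> (\<lambda>y. Re (snd y * (g (fst y) - f (fst y))))" for f
  have s_app: "apply_bcontfun (s f) = (\<lambda>y. Re (snd (\<pi> y) * (g (fst (\<pi> y)) - f (fst (\<pi> y)))))" if "f \<in> B" for f
    unfolding s_def by (rule \<beta>) (intro c2[of "\<lambda>z. g z - f z"] continuous_intros g Bcont that)
  have conv: "convex (s ` B)"
  proof (rule convexI)
    fix x y and u v :: real assume "x \<in> s ` B" "y \<in> s ` B" and uv: "u \<ge> 0" "v \<ge> 0" "u + v = 1"
    then obtain f h where f: "f \<in> B" "x = s f" and h: "h \<in> B" "y = s h" by blast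
    define k where "k = (\<lambda>z. of_real u * f z + of_real v * h z)"
    have k: "k \<in> B" unfolding k_def by (intro Badd Bscale f h)
    have "u *\<^sub>R x + v *\<^sub>R y = s k"
    proof (rule bcontfun_eqI)
      fix q
      have v: "v = 1 - u" using uv(3) by simp
      show "apply_bcontfun (u *\<^sub>R x + v *\<^sub>R y) q = apply_bcontfun (s k) q"
        by (simp add: plus_bcontfun.rep_eq scaleR_bcontfun.rep_eq f h s_app k) (simp add: k_def v algebra_simps)
    qed
    then show "u *\<^sub>R x + v *\<^sub>R y \<in> s ` B" using k by blast
  qed
  have dist: "\<exists>y\<in>Y. \<epsilon> \<le> apply_bcontfun t y" if "t \<in> s ` B" for t
  proof -
    obtain f where f: "f \<in> B" "t = s f" using \<open>t \<in> s ` B\<close> by blast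
    obtain z where z: "z \<in> X" "\<epsilon> \<le> norm (g z - f z)" using far f by blast
    define w where "w = g z - f z"
    have w: "norm w > 0" using z(2) \<epsilon> unfolding w_def by linarith
    define c where "c = cnj w / of_real (norm w)"
    have "norm c = 1" using w by (simp add: c_def norm_divide)
    then have y: "(z, c) \<in> Y" using z by (simp add: Y_def)
    have "c * w = of_real (norm w ^ 2) / of_real (norm w)"
      using complex_norm_square[of w] by (simp add: c_def mult.commute)
    also have "\<dots> = of_real (norm w)" using w by (simp add: power2_eq_square)
    finally have "Re (c * w) = norm w" by simp
    then have "\<epsilon> \<le> apply_bcontfun t (z, c)"
      using z f by (simp add: s_app \<pi>id[OF y] w_def)
    then show ?thesis using y by blast
  qed
  obtain L where L: "linear L" "\<And>u b. (\<And>y. y \<in> Y \<Longrightarrow> apply_bcontfun u y \<le> b) \<Longrightarrow> L u \<le> b"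
    "\<And>t. t \<in> s ` B \<Longrightarrow> \<epsilon> \<le> L t"
    using separating_functional[OF Y(3) conv _ dist] B0 by blast
  define \<Lambda> where "\<Lambda> u = L (\<beta> u)" for u
  interpret positive_functional Y \<Lambda>
  proof
    show "compact Y" by (rule Y)
  next
    fix u v :: "complex \<times> complex \<Rightarrow> real" assume "continuous_on Y u" "continuous_on Y v"
    then have "\<beta> (\<lambda>x. u x + v x) = \<beta> u + \<beta> v"
      by (intro bcontfun_eqI) (simp add: \<beta> continuous_on_add plus_bcontfun.rep_eq)
    then show "\<Lambda> (\<lambda>x. u x + v x) = \<Lambda> u + \<Lambda> v" by (simp add: \<Lambda>_def linear_add[OF L(1)])
  next
    fix c and u :: "complex \<times> complex \<Rightarrow> real" assume "continuous_on Y u"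
    then have "\<beta> (\<lambda>x. c * u x) = c *\<^sub>R \<beta> u"
      by (intro bcontfun_eqI) (simp add: \<beta> continuous_on_mult_left scaleR_bcontfun.rep_eq)
    then show "\<Lambda> (\<lambda>x. c * u x) = c * \<Lambda> u" by (simp add: \<Lambda>_def linear_scale[OF L(1)])
  next
    fix u :: "complex \<times> complex \<Rightarrow> real" assume u: "continuous_on Y u" "\<And>x. x \<in> Y \<Longrightarrow> 0 \<le> u x"
    have "L (- \<beta> u) \<le> 0"
      by (rule L(2)) (use u \<pi>Y in \<open>simp add: \<beta> uminus_bcontfun.rep_eq\<close>)
    then show "0 \<le> \<Lambda> u" by (simp add: \<Lambda>_def linear_neg[OF L(1)])
  qed
  interpret N: finite_measure riesz_measure by (rule finite_riesz_measure)
  define c where "c y = indicator Y y *\<^sub>R snd y" for y :: "complex \<times> complex"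
  have cm: "c \<in> borel_measurable borel"
    unfolding c_def using borel_Y by (intro borel_measurable_continuous_on_indicator continuous_intros)
  define J where "J f = (LINT y|riesz_measure. c y * f (fst y))" for f
  have J_int: "integrable riesz_measure (\<lambda>y. c y * f (fst y))"
    and ReJ: "Re (J f) = \<Lambda> (\<lambda>y. Re (snd y * f (fst y)))"
    if f: "continuous_on X f" for f
  proof -
    have h_eq: "(\<lambda>y. c y * f (fst y)) = (\<lambda>y. indicator Y y *\<^sub>R (snd y * f (fst y)))"
      by (simp add: c_def)
    have hc: "continuous_on Y (\<lambda>y. snd y * f (fst y))"
      by (intro continuous_intros continuous_on_compose2[OF f continuous_on_fst[OF continuous_on_id]])
         (auto simp: Y_def)
    then have hm: "(\<lambda>y. c y * f (fst y)) \<in> borel_measurable borel"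
      unfolding h_eq using borel_Y by (intro borel_measurable_continuous_on_indicator)
    have "bounded ((\<lambda>y. snd y * f (fst y)) ` Y)"
      by (intro compact_imp_bounded compact_continuous_image hc Y)
    then obtain b where b: "\<And>y. y \<in> Y \<Longrightarrow> norm (snd y * f (fst y)) \<le> b" unfolding bounded_iff by blast
    have "norm (c y * f (fst y)) \<le> \<bar>b\<bar>" for y
      using b[of y] by (cases "y \<in> Y") (auto simp: c_def)
    then show hi: "integrable riesz_measure (\<lambda>y. c y * f (fst y))"
      using hm by (intro N.integrable_const_bound[of _ "\<bar>b\<bar>"]) auto
    have "Re (J f) = (LINT y|riesz_measure. Re (c y * f (fst y)))" 
      unfolding J_def using hi by (rule integral_Re[symmetric])
    also have "\<dots> = (LINT y|riesz_measure. indicator Y y * Re (snd y * f (fst y)))"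
      by (intro Bochner_Integration.integral_cong) (auto simp: c_def indicator_def)
    also have "\<dots> = \<Lambda> (\<lambda>y. Re (snd y * f (fst y)))" by (rule riesz) (rule c2[OF f])
    finally show "Re (J f) = \<Lambda> (\<lambda>y. Re (snd y * f (fst y)))" .
  qed
  have sep: "\<epsilon> \<le> Re (J g) - Re (J f)" if f: "f \<in> B" for f
  proof -
    have "\<epsilon> \<le> \<Lambda> (\<lambda>y. Re (snd y * (g (fst y) - f (fst y))))"
      using L(3) f by (simp add: \<Lambda>_def s_def)
    also have "\<dots> = Re (J (\<lambda>z. g z - f z))"
      by (rule ReJ[symmetric]) (intro continuous_intros g Bcont f)
    also have "J (\<lambda>z. g z - f z) = J g - J f"
      unfolding J_def right_diff_distrib
      by (intro Bochner_Integration.integral_diff J_int g Bcont f)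
    finally show ?thesis by simp
  qed
  show thesis
  proof (rule that[OF finite_riesz_measure sets_riesz_measure cm])
    show "norm (c y) \<le> 1" for y by (auto simp: c_def indicator_def Y_def)
    show "c y = 0" if "fst y \<notin> X" for y using that by (auto simp: c_def indicator_def Y_def)
    show "(LINT y|riesz_measure. c y * g (fst y)) \<noteq> 0"
      using sep[OF B0] \<epsilon> by (auto simp: J_def)
    fix f assume f: "f \<in> B"
    have "J f = 0"
    proof (rule ccontr)
      assume nz: "J f \<noteq> 0"
      \<comment> \<open>If \<open>J f\<close> were nonzero, a multiple of \<open>f\<close> would
        give \<open>J\<close> the real part of \<open>J g\<close>, contradicting
        \<open>sep\<close>.\<close>
      define a where "a = of_real (Re (J g)) / J f"
      have "J (\<lambda>z. a * f z) = a * J f" by (simp add: J_def mult.left_commute)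
      also have "\<dots> = of_real (Re (J g))" using nz by (simp add: a_def)
      finally show False using sep[OF Bscale[OF f, of a]] \<epsilon> by simp
    qed
    then show "(LINT y|riesz_measure. c y * f (fst y)) = 0" by (simp add: J_def)
  qed
qed

section \<open>Wirtinger derivatives\<close>

text \<open>p and q are the Wirtinger derivatives du/dz and du/d(cnj z).\<close>

definition wirtinger ::
    "complex set \<Rightarrow> (complex \<Rightarrow> complex) \<Rightarrow> (complex \<Rightarrow> complex) \<Rightarrow> (complex \<Rightarrow> complex) \<Rightarrow> bool" where
  "wirtinger U u p q \<longleftrightarrow> open U \<and> continuous_on U p \<and> continuous_on U q \<and>
     (\<forall>z\<in>U. (u has_derivative (\<lambda>h. p z * h + q z * cnj h)) (at z))"

lemma wirtinger_open: "wirtinger U u p q \<Longrightarrow> open U"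
  by (simp add: wirtinger_def)

lemma wirtinger_continuous: "wirtinger U u p q \<Longrightarrow> continuous_on U u"
  unfolding wirtinger_def
  by (meson continuous_at_imp_continuous_on has_derivative_continuous)

lemma wirtinger_subset: "wirtinger U u p q \<Longrightarrow> V \<subseteq> U \<Longrightarrow> open V \<Longrightarrow> wirtinger V u p q"
  unfolding wirtinger_def by (meson continuous_on_subset subset_iff)

lemma wirtinger_cong:
  assumes "wirtinger U u p q" "\<And>z. z \<in> U \<Longrightarrow> u' z = u z" "\<And>z. z \<in> U \<Longrightarrow> p' z = p z" "\<And>z. z \<in> U \<Longrightarrow> q' z = q z"
  shows "wirtinger U u' p' q'"
proof -
  have "(u' has_derivative (\<lambda>h. p' z * h + q' z * cnj h)) (at z)" if "z \<in> U" for z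
  proof -
    have "(u' has_derivative (\<lambda>h. p z * h + q z * cnj h)) (at z)"
      using assms(1,2) that unfolding wirtinger_def
      by (intro has_derivative_transform_within_open[of u _ z UNIV U u']) auto
    then show ?thesis using assms that by simp
  qed
  moreover have "continuous_on U p'" "continuous_on U q'"
    using assms unfolding wirtinger_def by (auto cong: continuous_on_cong)
  ultimately show ?thesis using assms(1) by (simp add: wirtinger_def)
qed

lemma wirtinger_Un: "wirtinger U u p q \<Longrightarrow> wirtinger V u p q \<Longrightarrow> wirtinger (U \<union> V) u p q"
  unfolding wirtinger_def by (auto intro: continuous_on_open_Un)

lemma wirtinger_unique:
  assumes "wirtinger U u p q" "wirtinger V u' p' q'" "open W" "W \<subseteq> U" "W \<subseteq> V"
    "\<And>z. z \<in> W \<Longrightarrow> u z = u' z" "z \<in> W"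
  shows "p z = p' z" "q z = q' z"
proof -
  have 1: "(u has_derivative (\<lambda>h. p z * h + q z * cnj h)) (at z)"
    and 2: "(u' has_derivative (\<lambda>h. p' z * h + q' z * cnj h)) (at z)"
    using assms unfolding wirtinger_def by auto
  have "(u has_derivative (\<lambda>h. p' z * h + q' z * cnj h)) (at z)"
    using has_derivative_transform_within_open[OF 2 assms(3,7)] assms(6) by auto
  then have eq: "(\<lambda>h. p z * h + q z * cnj h) = (\<lambda>h. p' z * h + q' z * cnj h)"
    using 1 has_derivative_unique by blast
  have "p z + q z = p' z + q' z" using fun_cong[OF eq, of 1] by simp
  moreover have "\<i> * (p z - q z) = \<i> * (p' z - q' z)" using fun_cong[OF eq, of \<i>] by (simp add: algebra_simps)
  then have "p z - q z = p' z - q' z" by simp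
  ultimately show "p z = p' z" "q z = q' z" by algebra+
qed

lemma wirtinger_const: "open U \<Longrightarrow> wirtinger U (\<lambda>_. a) (\<lambda>_. 0) (\<lambda>_. 0)"
  by (auto simp: wirtinger_def)

lemma wirtinger_cnj: "open U \<Longrightarrow> wirtinger U cnj (\<lambda>_. 0) (\<lambda>_. 1)"
  by (auto simp: wirtinger_def intro!: derivative_eq_intros bounded_linear_imp_has_derivative bounded_linear_cnj)

lemma wirtinger_holomorphic:
  assumes "open U" "f holomorphic_on U"
  shows "wirtinger U f (deriv f) (\<lambda>_. 0)"
proof -
  have "continuous_on U (deriv f)"
    using assms holomorphic_deriv holomorphic_on_imp_continuous_on by blast
  moreover have "(f has_derivative (\<lambda>h. deriv f z * h)) (at z)" if "z \<in> U" for z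
    using holomorphic_derivI[OF assms(2,1) that] unfolding has_field_derivative_def by (simp add: mult_commute_abs)
  ultimately show ?thesis using assms(1) by (simp add: wirtinger_def)
qed

lemma wirtinger_ident: "open U \<Longrightarrow> wirtinger U (\<lambda>z. z) (\<lambda>_. 1) (\<lambda>_. 0)"
  using wirtinger_holomorphic[of U "\<lambda>z. z"] by simp

lemma wirtinger_add:
  assumes "wirtinger U u p q" "wirtinger U u' p' q'"
  shows "wirtinger U (\<lambda>z. u z + u' z) (\<lambda>z. p z + p' z) (\<lambda>z. q z + q' z)"
proof -
  have "((\<lambda>z. u z + u' z) has_derivative (\<lambda>h. (p z + p' z) * h + (q z + q' z) * cnj h)) (at z)" if "z \<in> U" for z
  proof (rule has_derivative_eq_rhs)
    show "((\<lambda>z. u z + u' z) has_derivative (\<lambda>h. (p z * h + q z * cnj h) + (p' z * h + q' z * cnj h))) (at z)"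
      using assms that unfolding wirtinger_def by (intro has_derivative_add) auto
  qed (simp add: algebra_simps fun_eq_iff)
  then show ?thesis using assms by (auto simp: wirtinger_def intro!: continuous_intros)
qed

lemma wirtinger_mult:
  assumes "wirtinger U u p q" "wirtinger U u' p' q'"
  shows "wirtinger U (\<lambda>z. u z * u' z) (\<lambda>z. p z * u' z + u z * p' z) (\<lambda>z. q z * u' z + u z * q' z)"
proof -
  have "((\<lambda>z. u z * u' z) has_derivative
      (\<lambda>h. (p z * u' z + u z * p' z) * h + (q z * u' z + u z * q' z) * cnj h)) (at z)" if "z \<in> U" for z
  proof (rule has_derivative_eq_rhs)
    show "((\<lambda>z. u z * u' z) has_derivative
        (\<lambda>h. u z * (p' z * h + q' z * cnj h) + (p z * h + q z * cnj h) * u' z)) (at z)"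
      using assms that unfolding wirtinger_def by (intro has_derivative_mult) auto
  qed (simp add: algebra_simps fun_eq_iff)
  then show ?thesis
    using assms wirtinger_continuous[OF assms(1)] wirtinger_continuous[OF assms(2)]
    by (auto simp: wirtinger_def intro!: continuous_intros)
qed

lemma wirtinger_cmult:
  assumes "wirtinger U u p q"
  shows "wirtinger U (\<lambda>z. a * u z) (\<lambda>z. a * p z) (\<lambda>z. a * q z)"
  using wirtinger_mult[OF wirtinger_const[OF wirtinger_open[OF assms]] assms] by simp

text \<open>Since Re u = (u + cnj u) / 2, its two coefficients are (p + cnj q) / 2 and the conjugate
  of this; the chain rule multiplies both by T'.\<close>

lemma wirtinger_real_comp:
  assumes u: "wirtinger U u p q"
    and T: "\<And>x. (T has_real_derivative T' x) (at x)" and T': "continuous_on UNIV T'"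
  shows "wirtinger U (\<lambda>z. of_real (T (Re (u z))))
     (\<lambda>z. of_real (T' (Re (u z))) * (p z + cnj (q z)) / 2)
     (\<lambda>z. of_real (T' (Re (u z))) * (q z + cnj (p z)) / 2)"
proof -
  have "((\<lambda>z. of_real (T (Re (u z))) :: complex) has_derivative
      (\<lambda>h. of_real (T' (Re (u z))) * (p z + cnj (q z)) / 2 * h
         + of_real (T' (Re (u z))) * (q z + cnj (p z)) / 2 * cnj h)) (at z)" if z: "z \<in> U" for z
  proof (rule has_derivative_eq_rhs)
    have 1: "((\<lambda>z. Re (u z)) has_derivative (\<lambda>h. Re (p z * h + q z * cnj h))) (at z)"
      using u z unfolding wirtinger_def
      by (intro has_derivative_compose[OF _ bounded_linear_imp_has_derivative[OF bounded_linear_Re]]) auto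
    have "((\<lambda>z. T (Re (u z))) has_derivative (\<lambda>h. T' (Re (u z)) * Re (p z * h + q z * cnj h))) (at z)"
      using has_derivative_compose[OF 1 T[unfolded has_field_derivative_def]] by simp
    then show "((\<lambda>z. of_real (T (Re (u z))) :: complex) has_derivative
        (\<lambda>h. of_real (T' (Re (u z)) * Re (p z * h + q z * cnj h)))) (at z)"
      by (rule has_derivative_of_real)
    show "(\<lambda>h. complex_of_real (T' (Re (u z)) * Re (p z * h + q z * cnj h))) =
      (\<lambda>h. of_real (T' (Re (u z))) * (p z + cnj (q z)) / 2 * h
         + of_real (T' (Re (u z))) * (q z + cnj (p z)) / 2 * cnj h)"
      by (auto simp: fun_eq_iff complex_eq_iff field_simps)
  qed
  moreover have "continuous_on U (\<lambda>z. T' (Re (u z)))"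
    by (rule continuous_on_compose2[OF T']) (auto intro!: continuous_intros wirtinger_continuous[OF u])
  ultimately show ?thesis using u by (auto simp: wirtinger_def intro!: continuous_intros)
qed

text \<open>\<open>U\<close> and the complement of \<open>S\<close> cover the plane. On their
  overlap, which is open, u is zero, hence so are its derivatives, and the two pieces agree.\<close>

lemma wirtinger_extend_zero:
  assumes u: "wirtinger U u p q" and S: "closed S" "S \<subseteq> U" and 0: "\<And>z. z \<in> U - S \<Longrightarrow> u z = 0"
  shows "wirtinger UNIV (\<lambda>z. if z \<in> U then u z else 0) (\<lambda>z. if z \<in> U then p z else 0) (\<lambda>z. if z \<in> U then q z else 0)"
proof -
  have op: "open (U - S)" using wirtinger_open[OF u] S(1) by blast
  have pq: "p z = 0" "q z = 0" if "z \<in> U - S" for z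
    using wirtinger_unique[OF u wirtinger_const[OF op, of 0] op _ _ 0 that] by auto
  let ?u = "\<lambda>z. if z \<in> U then u z else 0" and ?p = "\<lambda>z. if z \<in> U then p z else 0" and ?q = "\<lambda>z. if z \<in> U then q z else 0"
  have "wirtinger U ?u ?p ?q" by (rule wirtinger_cong[OF u]) auto
  moreover have "wirtinger (- S) ?u ?p ?q"
    by (rule wirtinger_cong[OF wirtinger_const[of "- S" 0]]) (use S 0 pq in auto)
  ultimately have "wirtinger (U \<union> - S) ?u ?p ?q" by (rule wirtinger_Un)
  moreover have "U \<union> - S = UNIV" using S by auto
  ultimately show ?thesis by simp
qed

lemma wirtinger_zero_off:
  assumes u: "wirtinger UNIV u p q" and S: "closed S" and 0: "\<And>z. z \<notin> S \<Longrightarrow> u z = 0" and z: "z \<notin> S"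
  shows "p z = 0" "q z = 0"
proof -
  have op: "open (- S)" using S by auto
  show "p z = 0" "q z = 0"
    using wirtinger_unique[OF u wirtinger_const[OF op, of 0] op _ _ 0, of z] z by auto
qed

lemma integrable_continuous_compact_support:
  fixes f :: "'a::euclidean_space \<Rightarrow> 'b::{banach, second_countable_topology}"
  assumes "continuous_on UNIV f" "compact S" "\<And>z. z \<notin> S \<Longrightarrow> f z = 0"
  shows "integrable lborel f"
proof -
  have "integrable lborel (\<lambda>z. indicator S z *\<^sub>R f z)"
    using assms by (intro borel_integrable_compact continuous_on_subset[OF assms(1)]) auto
  moreover have "(\<lambda>z. indicator S z *\<^sub>R f z) = f" using assms(3) by (auto simp: indicator_def)
  ultimately show ?thesis by simp
qed

lemma bounded_continuous_compact_support:
  fixes f :: "'a::euclidean_space \<Rightarrow> 'b::real_normed_vector"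
  assumes "continuous_on UNIV f" "compact S" "\<And>z. z \<notin> S \<Longrightarrow> f z = 0"
  obtains B where "B \<ge> 0" "\<And>z. norm (f z) \<le> B"
proof -
  have "bounded (f ` S)"
    by (intro compact_imp_bounded compact_continuous_image continuous_on_subset[OF assms(1)] assms(2)) auto
  then obtain B where "\<And>z. z \<in> S \<Longrightarrow> norm (f z) \<le> B" unfolding bounded_iff by blast
  then have "norm (f z) \<le> max B 0" for z
    using assms(3)[of z] by (cases "z \<in> S") (auto simp: le_max_iff_disj)
  then show thesis by (rule that[rotated]) simp
qed

lemma lborel_integral_translate:
  fixes f :: "'a::euclidean_space \<Rightarrow> 'b::{banach, second_countable_topology}"
  assumes "f \<in> borel_measurable borel"
  shows "(LINT z|lborel. f (c + z)) = (LINT z|lborel. f z)"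
    and "integrable lborel (\<lambda>z. f (c + z)) \<longleftrightarrow> integrable lborel f"
proof -
  have "(LINT z|lborel. f z) = (LINT z|distr lborel borel ((+) c). f z)" by (simp add: lborel_distr_plus)
  also have "\<dots> = (LINT z|lborel. f (c + z))" using assms by (intro integral_distr) auto
  finally show "(LINT z|lborel. f (c + z)) = (LINT z|lborel. f z)" by simp
  have "integrable lborel f \<longleftrightarrow> integrable (distr lborel borel ((+) c)) f" by (simp add: lborel_distr_plus)
  also have "\<dots> \<longleftrightarrow> integrable lborel (\<lambda>z. f (c + z))" using assms by (intro integrable_distr_eq) auto
  finally show "integrable lborel (\<lambda>z. f (c + z)) \<longleftrightarrow> integrable lborel f" by simp
qed

text \<open>Translation invariance of Lebesgue measure makes the integral of every difference quotient vanish.\<close>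

lemma integral_directional_derivative_zero:
  assumes u: "wirtinger UNIV u p q" and 0: "\<And>z. z \<notin> cball 0 R \<Longrightarrow> u z = 0" and v: "norm v = 1"
  shows "(LINT z|lborel. p z * v + q z * cnj v) = 0"
proof -
  have pq0: "p z = 0" "q z = 0" if "z \<notin> cball 0 R" for z
    using wirtinger_zero_off[OF u closed_cball 0 that] by auto
  have cont: "continuous_on UNIV u" "continuous_on UNIV p" "continuous_on UNIV q"
    using u wirtinger_continuous[OF u] by (auto simp: wirtinger_def)
  obtain Bp where Bp: "Bp \<ge> 0" "\<And>z. norm (p z) \<le> Bp"
    using bounded_continuous_compact_support[OF cont(2) compact_cball pq0(1)] by metis
  obtain Bq where Bq: "Bq \<ge> 0" "\<And>z. norm (q z) \<le> Bq"
    using bounded_continuous_compact_support[OF cont(3) compact_cball pq0(2)] by metis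
  \<comment> \<open>The Lipschitz bound dominates the difference quotients uniformly in the step
    size.\<close>
  have lip: "norm (u x - u y) \<le> (Bp + Bq) * norm (x - y)" for x y
  proof (rule differentiable_bound[of UNIV u "\<lambda>z h. p z * h + q z * cnj h"])
    show "(u has_derivative (\<lambda>h. p z * h + q z * cnj h)) (at z within UNIV)" for z
      using u by (simp add: wirtinger_def)
    show "onorm (\<lambda>h. p z * h + q z * cnj h) \<le> Bp + Bq" for z
    proof (rule onorm_le)
      fix h
      have "norm (p z * h + q z * cnj h) \<le> norm (p z) * norm h + norm (q z) * norm h"
        using norm_triangle_ineq[of "p z * h" "q z * cnj h"] by (simp add: norm_mult)
      also have "\<dots> \<le> Bp * norm h + Bq * norm h" using Bp Bq by (intro add_mono mult_right_mono) auto
      finally show "norm (p z * h + q z * cnj h) \<le> (Bp + Bq) * norm h" by (simp add: distrib_right)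
    qed
  qed auto
  define t where "t n = 1 / real (Suc n)" for n
  have t: "t n > 0" "t n \<le> 1" for n by (auto simp: t_def)
  define f where "f n z = (u (of_real (t n) * v + z) - u z) / of_real (t n)" for n z
  have um: "u \<in> borel_measurable borel" using cont(1) by (rule borel_measurable_continuous_onI)
  have ui: "integrable lborel u" by (rule integrable_continuous_compact_support[OF cont(1) compact_cball 0])
  have "(LINT z|lborel. f n z) = 0" for n
    unfolding f_def using ui lborel_integral_translate[OF um]
    by (simp add: Bochner_Integration.integral_diff)
  moreover have "(\<lambda>n. LINT z|lborel. f n z) \<longlonglongrightarrow> (LINT z|lborel. p z * v + q z * cnj v)"
  proof (rule integral_dominated_convergence)
    show "(\<lambda>z. p z * v + q z * cnj v) \<in> borel_measurable lborel"
      using cont by (auto intro!: borel_measurable_continuous_onI continuous_intros)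
    show "f n \<in> borel_measurable lborel" for n
      unfolding f_def
      by (auto intro!: borel_measurable_continuous_onI continuous_intros continuous_on_compose2[OF cont(1)])
         (use t(1)[of n] in simp)
    \<comment> \<open>Steps have length at most 1, so u and its translate both vanish outside the
      disc of radius |R| + 1.\<close>
    show "integrable lborel (\<lambda>z. (Bp + Bq) * indicator (cball (0::complex) (\<bar>R\<bar> + 1)) z)"
      by (intro integrable_mult_right integrable_real_indicator) (auto intro: emeasure_bounded_finite[unfolded infinity_ennreal_def])
    show "AE z in lborel. norm (f n z) \<le> (Bp + Bq) * indicator (cball (0::complex) (\<bar>R\<bar> + 1)) z" for n
    proof (rule AE_I2)
      fix z
      have nt: "norm (of_real (t n) * v) = t n" using v t(1)[of n] by (simp add: norm_mult)
      show "norm (f n z) \<le> (Bp + Bq) * indicator (cball (0::complex) (\<bar>R\<bar> + 1)) z"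
      proof (cases "z \<in> cball 0 (\<bar>R\<bar> + 1)")
        case True
        have "norm (u (of_real (t n) * v + z) - u z) \<le> (Bp + Bq) * t n"
          using lip[of "of_real (t n) * v + z" z] nt by simp
        then show ?thesis using True t(1)[of n] by (simp add: f_def norm_divide divide_le_eq)
      next
        case False
        have "norm z \<le> norm (of_real (t n) * v + z) + t n"
          using norm_triangle_ineq4[of "of_real (t n) * v + z" "of_real (t n) * v"] nt by simp
        then have "z \<notin> cball 0 R" "of_real (t n) * v + z \<notin> cball 0 R"
          using False t(2)[of n] by auto
        then show ?thesis using 0 False by (simp add: f_def)
      qed
    qed
    show "AE z in lborel. (\<lambda>n. f n z) \<longlonglongrightarrow> p z * v + q z * cnj v"
    proof (rule AE_I2)
      fix z
      have "(u has_derivative (\<lambda>h. p z * h + q z * cnj h)) (at z)" using u by (simp add: wirtinger_def)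
      then have lim: "((\<lambda>y. (1 / norm (y - z)) *\<^sub>R (u y - (u z + (p z * (y - z) + q z * cnj (y - z))))) \<longlongrightarrow> 0) (at z)"
        unfolding has_derivative_within by simp
      have t0: "(\<lambda>n. of_real (t n) * v + z) \<longlonglongrightarrow> of_real 0 * v + z"
        unfolding t_def by (intro tendsto_intros LIMSEQ_Suc lim_1_over_n)
      have "filterlim (\<lambda>n. of_real (t n) * v + z) (at z) sequentially"
        using t0 t(1) v by (auto simp: filterlim_at intro!: always_eventually) (metis less_irrefl norm_zero zero_neq_one)+
      from filterlim_compose[OF lim this]
      have "(\<lambda>n. (1 / t n) *\<^sub>R (u (of_real (t n) * v + z) - (u z + (p z * (of_real (t n) * v) + q z * cnj (of_real (t n) * v))))) \<longlonglongrightarrow> 0"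
        using v by (simp add: norm_mult abs_of_pos[OF t(1)])
      moreover have "(1 / t n) *\<^sub>R (u (of_real (t n) * v + z) - (u z + (p z * (of_real (t n) * v) + q z * cnj (of_real (t n) * v))))
          = f n z - (p z * v + q z * cnj v)" for n
        using t(1)[of n] by (simp add: f_def scaleR_conv_of_real field_simps)
      ultimately show "(\<lambda>n. f n z) \<longlonglongrightarrow> p z * v + q z * cnj v"
        by (simp add: LIM_zero_iff)
    qed
  qed
  ultimately show ?thesis by (simp add: LIMSEQ_const_iff)
qed

text \<open>The directions 1 and \<i> give the sum and the difference of the integrals of p and q.
  This is Stokes' theorem for compactly supported functions.\<close>

lemma integral_dbar_zero:
  assumes u: "wirtinger UNIV u p q" and 0: "\<And>z. z \<notin> cball 0 R \<Longrightarrow> u z = 0"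
  shows "(LINT z|lborel. q z) = 0"
proof -
  have pq0: "p z = 0" "q z = 0" if "z \<notin> cball 0 R" for z
    using wirtinger_zero_off[OF u closed_cball 0 that] by auto
  have cont: "continuous_on UNIV p" "continuous_on UNIV q" using u by (auto simp: wirtinger_def)
  have int: "integrable lborel p" "integrable lborel q"
    using integrable_continuous_compact_support[OF cont(1) compact_cball[of 0 R] pq0(1)]
      integrable_continuous_compact_support[OF cont(2) compact_cball[of 0 R] pq0(2)] by blast+
  have "(LINT z|lborel. p z) + (LINT z|lborel. q z) = 0"
    using integral_directional_derivative_zero[OF u 0, where v = 1] int by simp
  moreover have "(LINT z|lborel. p z) * \<i> - (LINT z|lborel. q z) * \<i> = 0"
    using integral_directional_derivative_zero[OF u 0, where v = \<i>] int by simp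
  then have "(LINT z|lborel. p z) = (LINT z|lborel. q z)" by simp
  ultimately show ?thesis by simp
qed

lemma wirtinger_inverse:
  assumes u: "wirtinger U u p q" and 0: "\<And>z. z \<in> U \<Longrightarrow> u z \<noteq> 0"
  shows "wirtinger U (\<lambda>z. inverse (u z)) (\<lambda>z. - (inverse (u z) * p z * inverse (u z)))
     (\<lambda>z. - (inverse (u z) * q z * inverse (u z)))"
proof -
  have "((\<lambda>z. inverse (u z)) has_derivative (\<lambda>h. - (inverse (u z) * p z * inverse (u z)) * h
      + - (inverse (u z) * q z * inverse (u z)) * cnj h)) (at z)" if "z \<in> U" for z
  proof (rule has_derivative_eq_rhs)
    show "((\<lambda>z. inverse (u z)) has_derivative (\<lambda>h. - (inverse (u z) * (p z * h + q z * cnj h) * inverse (u z)))) (at z)"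
      by (rule Deriv.has_derivative_inverse[where x = z and f = u, OF 0[OF that]]) (use u that in \<open>simp add: wirtinger_def\<close>)
  qed (simp add: algebra_simps fun_eq_iff)
  then show ?thesis
    using u 0 wirtinger_continuous[OF u] unfolding wirtinger_def
    by (intro conjI ballI continuous_intros) auto
qed

section \<open>Continuously differentiable bump functions\<close>

lemma wirtinger_sum_ex:
  assumes "finite I" "open U" "\<And>i. i \<in> I \<Longrightarrow> \<exists>p q. wirtinger U (u i) p q"
  shows "\<exists>p q. wirtinger U (\<lambda>z. \<Sum>i\<in>I. u i z) p q"
  using assms
proof (induction I)
  case empty
  then show ?case using wirtinger_const[of U 0] by auto
next
  case (insert i I)
  then obtain p q p' q' where "wirtinger U (u i) p q" "wirtinger U (\<lambda>z. \<Sum>i\<in>I. u i z) p' q'" by blast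
  from wirtinger_add[OF this] insert.hyps show ?case by auto
qed

text \<open>The square of the positive part is continuously differentiable, which is all the
  smoothness that \<open>wirtinger\<close> asks of a bump function.\<close>

lemma DERIV_max_zero_square: "((\<lambda>x. (max 0 x)\<^sup>2) has_real_derivative 2 * max 0 x) (at x)"
proof -
  consider "x > 0" | "x < 0" | "x = 0" by linarith
  then show ?thesis
  proof cases
    case 1
    have "((\<lambda>x. x\<^sup>2) has_real_derivative 2 * max 0 x) (at x)"
      using 1 by (auto intro!: derivative_eq_intros)
    then show ?thesis by (rule has_field_derivative_transform_within_open[where S = "{0<..}"]) (use 1 in auto)
  next
    case 2
    have "((\<lambda>x. 0) has_real_derivative 2 * max 0 x) (at x)"
      using 2 by (auto intro!: derivative_eq_intros)
    then show ?thesis by (rule has_field_derivative_transform_within_open[where S = "{..<0}"]) (use 2 in auto)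
  next
    case 3
    have "(\<lambda>h::real. (max 0 h)\<^sup>2 / h) = (\<lambda>h. max 0 h)"
      by (auto simp: fun_eq_iff power2_eq_square max_def)
    moreover have "((\<lambda>h::real. max 0 h) \<longlongrightarrow> max 0 0) (at 0)" by (intro tendsto_intros)
    ultimately show ?thesis using 3 by (simp add: DERIV_def)
  qed
qed

text \<open>Cover K by finitely many discs and let \<psi> be the sum over the centres c of the
  squared positive parts of \<rho>^2 - |z - c|^2. With m the minimum of \<psi> on K, the function 1
  minus the squared positive part of 1 - 2 \<psi> / m is 1 where \<psi> > m / 2 and 0 where \<psi> =
  0.\<close>

lemma wirtinger_bump:
  assumes K: "compact K" and U: "open U" "K \<subseteq> U"
  obtains \<phi> :: "complex \<Rightarrow> real" and p q S V where
    "wirtinger UNIV (\<lambda>z. of_real (\<phi> z)) p q" "compact S" "S \<subseteq> U" "\<And>z. z \<notin> S \<Longrightarrow> \<phi> z = 0"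
    "open V" "K \<subseteq> V" "\<And>z. z \<in> V \<Longrightarrow> \<phi> z = 1" "\<And>z. 0 \<le> \<phi> z" "\<And>z. \<phi> z \<le> 1"
proof (cases "K = {}")
  case True
  show thesis
    by (rule that[of "\<lambda>_. 0" "\<lambda>_. 0" "\<lambda>_. 0" "{}" "{}"]) (auto simp: True wirtinger_const)
next
  case False
  obtain \<rho> where \<rho>: "\<rho> > 0" "(\<Union>x\<in>K. cball x \<rho>) \<subseteq> U"
    using compact_subset_open_imp_cball_epsilon_subset[OF K U] by blast
  have "K \<subseteq> (\<Union>c\<in>K. ball c \<rho>)" using \<rho>(1) by auto
  then obtain C where C: "C \<subseteq> K" "finite C" "K \<subseteq> (\<Union>c\<in>C. ball c \<rho>)"
    by (rule compactE_image[OF K open_ball])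
  define T where "T = (\<lambda>x::real. (max 0 x)\<^sup>2)"
  have DT: "(T has_real_derivative 2 * max 0 x) (at x)" for x
    unfolding T_def by (rule DERIV_max_zero_square)
  have cT: "continuous_on UNIV (\<lambda>x::real. 2 * max 0 x)" by (intro continuous_intros)
  have T0: "T x \<ge> 0" "T x > 0 \<longleftrightarrow> x > 0" "x \<le> 0 \<Longrightarrow> T x = 0" "x \<le> 1 \<Longrightarrow> T x \<le> 1" for x
    by (auto simp: T_def max_def power_le_one zero_less_power2)
  define \<beta> where "\<beta> c z = T (\<rho>\<^sup>2 - (norm (z - c))\<^sup>2)" for c z :: complex
  have \<beta>w: "\<exists>p q. wirtinger UNIV (\<lambda>z. of_real (\<beta> c z)) p q" for c
  proof -
    obtain p q where w: "wirtinger UNIV (\<lambda>z. of_real (\<rho>\<^sup>2) + - 1 * ((z + - c) * (cnj z + - cnj c))) p q"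
      using wirtinger_add[OF wirtinger_const[OF open_UNIV] wirtinger_cmult[OF wirtinger_mult[OF
            wirtinger_add[OF wirtinger_ident[OF open_UNIV] wirtinger_const[OF open_UNIV]]
            wirtinger_add[OF wirtinger_cnj[OF open_UNIV] wirtinger_const[OF open_UNIV]]]]] by blast
    have "Re (of_real (\<rho>\<^sup>2) + - 1 * ((z + - c) * (cnj z + - cnj c))) = \<rho>\<^sup>2 - (norm (z - c))\<^sup>2" for z
      by (simp add: cmod_power2) (simp add: power2_eq_square algebra_simps)
    with wirtinger_real_comp[OF w DT cT] show ?thesis unfolding \<beta>_def by (simp only:) blast
  qed
  define \<psi> where "\<psi> z = (\<Sum>c\<in>C. \<beta> c z)" for z
  obtain p1 q1 where \<psi>w: "wirtinger UNIV (\<lambda>z. of_real (\<psi> z)) p1 q1"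
    using wirtinger_sum_ex[OF C(2) open_UNIV, of "\<lambda>c z. of_real (\<beta> c z)"] \<beta>w by (auto simp: \<psi>_def)
  have "continuous_on UNIV (\<lambda>z. Re (of_real (\<psi> z)))"
    by (intro continuous_intros wirtinger_continuous[OF \<psi>w])
  then have \<psi>c: "continuous_on UNIV \<psi>" by simp
  have \<psi>0: "\<psi> z \<ge> 0" for z unfolding \<psi>_def \<beta>_def by (intro sum_nonneg T0)
  have \<psi>pos: "\<psi> z > 0" if zK: "z \<in> K" for z
  proof -
    obtain c where c: "c \<in> C" "z \<in> ball c \<rho>" using C(3) zK by blast
    then have "norm (z - c) < \<rho>" by (simp add: dist_norm norm_minus_commute)
    then have "\<beta> c z > 0" using \<rho>(1) by (simp add: \<beta>_def T0 power_strict_mono)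
    then show ?thesis unfolding \<psi>_def \<beta>_def using c(1) C(2) T0(1) by (intro sum_pos2[of C c]) auto
  qed
  obtain z0 where z0: "z0 \<in> K" "\<And>z. z \<in> K \<Longrightarrow> \<psi> z0 \<le> \<psi> z"
    using continuous_attains_inf[OF K False continuous_on_subset[OF \<psi>c]] by auto
  define m where "m = \<psi> z0"
  have m: "m > 0" "\<And>z. z \<in> K \<Longrightarrow> m \<le> \<psi> z" using z0 \<psi>pos by (auto simp: m_def)
  define \<phi> where "\<phi> z = 1 - T (1 - 2 / m * \<psi> z)" for z
  have "wirtinger UNIV (\<lambda>z. 1 + (- of_real (2 / m)) * of_real (\<psi> z))
      (\<lambda>z. 0 + (- of_real (2 / m)) * p1 z) (\<lambda>z. 0 + (- of_real (2 / m)) * q1 z)"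
    by (rule wirtinger_add[OF wirtinger_const[OF open_UNIV] wirtinger_cmult[OF \<psi>w]])
  from wirtinger_real_comp[OF this DT cT]
  obtain p2 q2 where "wirtinger UNIV (\<lambda>z. of_real (T (Re (1 + (- of_real (2 / m)) * of_real (\<psi> z))))) p2 q2"
    by blast
  from wirtinger_add[OF wirtinger_const[OF open_UNIV, of 1] wirtinger_cmult[OF this, of "-1"]]
  have \<phi>w: "wirtinger UNIV (\<lambda>z. of_real (\<phi> z)) (\<lambda>z. 0 + - 1 * p2 z) (\<lambda>z. 0 + - 1 * q2 z)"
    by (rule wirtinger_cong) (auto simp: \<phi>_def)
  show thesis
  proof (rule that[OF \<phi>w])
    show "compact (\<Union>c\<in>C. cball c \<rho>)" using C(2) by auto
    show "(\<Union>c\<in>C. cball c \<rho>) \<subseteq> U" using \<rho>(2) C(1) by blast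
    show "\<phi> z = 0" if z: "z \<notin> (\<Union>c\<in>C. cball c \<rho>)" for z
    proof -
      have "\<beta> c z = 0" if "c \<in> C" for c
      proof -
        have "\<rho> \<le> norm (z - c)" using z that by (auto simp: dist_norm norm_minus_commute not_le)
        then have "\<rho>\<^sup>2 \<le> (norm (z - c))\<^sup>2" using \<rho>(1) by (intro power_mono) auto
        then show ?thesis by (simp add: \<beta>_def T0)
      qed
      then have "\<psi> z = 0" by (simp add: \<psi>_def)
      then show ?thesis by (simp add: \<phi>_def T_def)
    qed
    show "open {z. \<psi> z > m / 2}"
      using \<psi>c by (intro open_Collect_less continuous_intros)
    show "K \<subseteq> {z. \<psi> z > m / 2}" using m by fastforce
    show "\<phi> z = 1" if "z \<in> {z. \<psi> z > m / 2}" for z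
      using that m(1) by (simp add: \<phi>_def T0 field_simps)
    show "0 \<le> \<phi> z" for z using T0(4)[of "1 - 2 / m * \<psi> z"] m(1) \<psi>0[of z] by (simp add: \<phi>_def)
    show "\<phi> z \<le> 1" for z using T0(1) by (simp add: \<phi>_def)
  qed
qed

section \<open>The Cauchy--Pompeiu formula\<close>

text \<open>A substitute for polar coordinates: f is compared with a countable sum of constants on
  discs, each of which contributes its height times a multiple of its squared radius.\<close>

lemma nn_integral_shells_finite:
  fixes f :: "complex \<Rightarrow> real" and a s :: "nat \<Rightarrow> real"
  assumes f: "f \<in> borel_measurable borel" "\<And>w. 0 \<le> f w"
    and a: "\<And>k. 0 \<le> a k" "\<And>k. 0 \<le> s k"
    and dom: "\<And>w. f w \<noteq> 0 \<Longrightarrow> \<exists>k. w \<in> ball 0 (s k) \<and> f w \<le> a k"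
    and summ: "summable (\<lambda>k. a k * (s k)\<^sup>2)"
  shows "integrable lborel f"
proof (rule integrableI_nonneg)
  have "(\<integral>\<^sup>+w. ennreal (f w) \<partial>lborel) \<le> (\<integral>\<^sup>+w. (\<Sum>k. ennreal (a k) * indicator (ball (0::complex) (s k)) w) \<partial>lborel)"
  proof (rule nn_integral_mono)
    fix w :: complex
    show "ennreal (f w) \<le> (\<Sum>k. ennreal (a k) * indicator (ball 0 (s k)) w)"
    proof (cases "f w = 0")
      case False
      then obtain k where k: "w \<in> ball 0 (s k)" "f w \<le> a k" using dom by blast
      then have "ennreal (f w) \<le> ennreal (a k) * indicator (ball 0 (s k)) w" by (simp add: ennreal_leI)
      also have "\<dots> \<le> (\<Sum>j. ennreal (a j) * indicator (ball 0 (s j)) w)"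
        using sum_le_suminf[of "\<lambda>j. ennreal (a j) * indicator (ball 0 (s j)) w" "{k}"]
        by (simp only: sum.insert sum.empty finite.intros empty_iff not_False_eq_True add_0_right) simp
      finally show ?thesis .
    qed simp
  qed
  also have "\<dots> = (\<Sum>k. \<integral>\<^sup>+w. ennreal (a k) * indicator (ball (0::complex) (s k)) w \<partial>lborel)"
    by (rule nn_integral_suminf) (intro borel_measurable_times_ennreal borel_measurable_indicator, auto)
  also have "\<dots> = (\<Sum>k. ennreal (unit_ball_vol 2 * (a k * (s k)\<^sup>2)))"
    using a by (intro suminf_cong) (simp add: nn_integral_cmult_indicator emeasure_ball ennreal_mult[symmetric] mult_ac)
  also have "\<dots> < \<infinity>"
  proof -
    have "summable (\<lambda>k. unit_ball_vol 2 * (a k * (s k)\<^sup>2))" by (rule summable_mult[OF summ])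
    then have "(\<Sum>k. ennreal (unit_ball_vol 2 * (a k * (s k)\<^sup>2)))
        = ennreal (\<Sum>k. unit_ball_vol 2 * (a k * (s k)\<^sup>2))"
      using a by (intro suminf_ennreal2) auto
    then show ?thesis by simp
  qed
  finally show "(\<integral>\<^sup>+w. ennreal (f w) \<partial>lborel) < \<infinity>" .
qed (use f in auto)

lemma integrable_inverse_norm:
  assumes R: "R > 0"
  shows "integrable lborel (\<lambda>w::complex. indicator (ball 0 R) w / norm w)"
proof (rule nn_integral_shells_finite[where a = "\<lambda>k. 2 ^ Suc k / R" and s = "\<lambda>k. R / 2 ^ k"])
  show "\<exists>k. w \<in> ball 0 (R / 2 ^ k) \<and> indicator (ball 0 R) w / norm w \<le> 2 ^ Suc k / R"
    if "indicator (ball 0 R) w / norm w \<noteq> (0::real)" for w :: complex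
  proof -
    have w: "0 < norm w" "norm w < R" using that by (auto simp: indicator_def split: if_splits)
    \<comment> \<open>\<open>k\<close> is the index of the dyadic annulus R / 2^(k+1) \<le> |w| < R
      / 2^k that contains w; the origin is excluded because the quotient is 0 there by the
      convention on division.\<close>
    define k where "k = (LEAST n. R / 2 ^ Suc n \<le> norm w)"
    have "\<exists>n. R / 2 ^ Suc n \<le> norm w"
    proof -
      obtain n where "R / norm w < 2 ^ n" using real_arch_pow[of 2 "R / norm w"] by auto
      then have "R / 2 ^ Suc n \<le> norm w" using w R by (simp add: field_simps)
      then show ?thesis by blast
    qed
    then have k1: "R / 2 ^ Suc k \<le> norm w" unfolding k_def by (rule LeastI_ex)
    have k2: "norm w < R / 2 ^ k"
    proof (cases k)
      case (Suc j)
      then have "\<not> R / 2 ^ Suc j \<le> norm w" unfolding k_def by (intro not_less_Least) auto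
      then show ?thesis using Suc by simp
    qed (use w in simp)
    show ?thesis
      using k1 k2 w R by (intro exI[of _ k]) (simp add: field_simps)
  qed
  have "(\<lambda>k. 2 ^ Suc k / R * (R / 2 ^ k)\<^sup>2) = (\<lambda>k. 2 * R * (1 / 2) ^ k)"
    using R by (simp add: fun_eq_iff power2_eq_square power_divide field_simps)
  then show "summable (\<lambda>k. 2 ^ Suc k / R * (R / 2 ^ k)\<^sup>2)" by (simp add: summable_geometric summable_mult)
  show "(\<lambda>w::complex. indicator (ball 0 R) w / norm w) \<in> borel_measurable borel"
    by (intro borel_measurable_divide borel_measurable_indicator borel_measurable_norm) auto
qed (use R in auto)

lemma integrable_inverse_square_quartic:
  "integrable lborel (\<lambda>w::complex. 1 / (1 + (norm w)\<^sup>2)\<^sup>2)"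
proof (rule nn_integral_shells_finite[where a = "\<lambda>k. 16 / 16 ^ k" and s = "\<lambda>k. 2 ^ k"])
  show "(\<lambda>w::complex. 1 / (1 + (norm w)\<^sup>2)\<^sup>2) \<in> borel_measurable borel" by measurable
  show "\<exists>k. w \<in> ball 0 (2 ^ k) \<and> 1 / (1 + (norm w)\<^sup>2)\<^sup>2 \<le> 16 / 16 ^ k" for w :: complex
  proof -
    \<comment> \<open>As \<open>k\<close> is least, |w| \<ge> 2^(k-1) for k > 0, and the function is
      at most 16^(1-k), while the areas of the discs grow only like 4^k.\<close>
    define k where "k = (LEAST n. norm w < 2 ^ n)"
    have "\<exists>n. norm w < 2 ^ n" using real_arch_pow[of 2 "norm w"] by auto
    then have k1: "norm w < 2 ^ k" unfolding k_def by (rule LeastI_ex)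
    have "1 / (1 + (norm w)\<^sup>2)\<^sup>2 \<le> 16 / 16 ^ k"
    proof (cases k)
      case 0
      have "1 / (1 + (norm w)\<^sup>2)\<^sup>2 \<le> 1" by (simp add: divide_le_eq_1 one_le_power)
      then show ?thesis using 0 by simp
    next
      case (Suc j)
      then have "\<not> norm w < 2 ^ j" unfolding k_def by (intro not_less_Least) auto
      then have "(2 ^ j)\<^sup>2 \<le> (norm w)\<^sup>2" by (intro power_mono) auto
      then have "(2 ^ j)\<^sup>2 \<le> 1 + (norm w)\<^sup>2" by linarith
      then have "((2 ^ j)\<^sup>2)\<^sup>2 \<le> (1 + (norm w)\<^sup>2)\<^sup>2" by (intro power_mono) auto
      moreover have "((2 ^ j)\<^sup>2)\<^sup>2 = (16::real) ^ j"
      proof -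
        have "((2 ^ j)\<^sup>2)\<^sup>2 = ((2::real) ^ 4) ^ j" by (simp only: power_mult[symmetric] mult.commute) simp
        then show ?thesis by simp
      qed
      ultimately have "1 / (1 + (norm w)\<^sup>2)\<^sup>2 \<le> 1 / 16 ^ j" by (intro frac_le) simp_all
      then show ?thesis using Suc by simp
    qed
    then show ?thesis using k1 by auto
  qed
  have "(\<lambda>k. 16 / 16 ^ k * (2 ^ k)\<^sup>2) = (\<lambda>k. 16 * (1 / 4) ^ k :: real)"
    by (auto simp: fun_eq_iff power_divide power2_eq_square power_mult_distrib[symmetric])
       (simp add: power_mult_distrib[symmetric] divide_simps)
  then show "summable (\<lambda>k. 16 / 16 ^ k * (2 ^ k)\<^sup>2 :: real)" by (simp add: summable_geometric summable_mult)
qed auto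

text \<open>The number is pi, met as the mass of the approximate identity e^2 / (|w|^2 + e^2)^2
  after rescaling; only its sign is extracted below.\<close>

definition pompeiu_const :: real where
  "pompeiu_const = (LINT w|lborel. 1 / (1 + (norm (w::complex))\<^sup>2)\<^sup>2)"

lemma pompeiu_const_pos: "pompeiu_const > 0"
proof -
  have "pompeiu_const \<noteq> 0"
  proof
    assume "pompeiu_const = 0"
    then have "AE w in lborel. 1 / (1 + (norm (w::complex))\<^sup>2)\<^sup>2 = 0"
      unfolding pompeiu_const_def
      by (subst (asm) integral_nonneg_eq_0_iff_AE[OF integrable_inverse_square_quartic]) auto
    moreover have "1 / (1 + (norm (w::complex))\<^sup>2)\<^sup>2 \<noteq> 0" for w
      by (simp add: add_nonneg_eq_0_iff)
    ultimately have "AE w::complex in lborel. False" by simp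
    then have "ae_filter (lborel :: complex measure) = bot" by (simp add: trivial_limit_def)
    then show False by (simp add: ae_filter_eq_bot_iff)
  qed
  moreover have "pompeiu_const \<ge> 0"
    unfolding pompeiu_const_def by (rule integral_nonneg_AE) auto
  ultimately show ?thesis by simp
qed

text \<open>Seen from \<open>z\<close>, the disc lies in a disc about \<open>z\<close> of radius |R|
  + |z| + 1. Translating to the origin gives a bound that is uniform for bounded \<open>z\<close>,
  as Fubini's theorem for Cauchy transforms will demand.\<close>

lemma integrable_inverse_dist:
  "integrable lborel (\<lambda>\<zeta>::complex. indicator (cball 0 R) \<zeta> / norm (z - \<zeta>))"
  "(LINT \<zeta>|lborel. indicator (cball 0 R) \<zeta> / norm (z - \<zeta>))
     \<le> (LINT w|lborel. indicator (ball 0 (\<bar>R\<bar> + norm z + 1)) w / norm (w::complex))"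
proof -
  define S where "S = \<bar>R\<bar> + norm z + 1"
  define f where "f = (\<lambda>w::complex. indicator (ball 0 S) w / norm w :: real)"
  have fi: "integrable lborel f"
    unfolding f_def by (rule integrable_inverse_norm) (simp add: S_def add_nonneg_pos)
  have fm: "f \<in> borel_measurable borel" using fi by auto
  have gi: "integrable lborel (\<lambda>\<zeta>. f (- z + \<zeta>))"
    using lborel_integral_translate(2)[OF fm, of "- z"] fi by simp
  have le: "indicator (cball 0 R) \<zeta> / norm (z - \<zeta>) \<le> f (- z + \<zeta>)" for \<zeta>
  proof (cases "\<zeta> \<in> cball 0 R")
    case True
    then have "norm (- z + \<zeta>) < S"
      using norm_triangle_ineq[of "- z" \<zeta>] by (simp add: S_def)
    then show ?thesis using True by (simp add: f_def norm_minus_commute)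
  qed (simp add: f_def)
  show 1: "integrable lborel (\<lambda>\<zeta>::complex. indicator (cball 0 R) \<zeta> / norm (z - \<zeta>))"
  proof (rule Bochner_Integration.integrable_bound[OF gi])
    show "(\<lambda>\<zeta>::complex. indicator (cball 0 R) \<zeta> / norm (z - \<zeta>)) \<in> borel_measurable lborel"
      by (intro borel_measurable_divide borel_measurable_indicator borel_measurable_norm) auto
    show "AE \<zeta> in lborel. norm (indicator (cball 0 R) \<zeta> / norm (z - \<zeta>)) \<le> norm (f (- z + \<zeta>))"
      using le by (intro AE_I2) (simp add: order_trans[OF _ abs_ge_self])
  qed
  have "(LINT \<zeta>|lborel. indicator (cball 0 R) \<zeta> / norm (z - \<zeta>)) \<le> (LINT \<zeta>|lborel. f (- z + \<zeta>))"
    by (rule integral_mono[OF 1 gi le])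
  also have "\<dots> = (LINT \<zeta>|lborel. f \<zeta>)" by (rule lborel_integral_translate(1)[OF fm])
  finally show "(LINT \<zeta>|lborel. indicator (cball 0 R) \<zeta> / norm (z - \<zeta>))
     \<le> (LINT w|lborel. indicator (ball 0 (\<bar>R\<bar> + norm z + 1)) w / norm (w::complex))"
    by (simp add: f_def S_def)
qed

lemma lborel_integral_affine:
  fixes f :: "complex \<Rightarrow> complex"
  assumes f: "f \<in> borel_measurable borel" and e: "e > 0"
  shows "(LINT \<zeta>|lborel. f \<zeta>) = (LINT w|lborel. of_real (e\<^sup>2) * f (z + of_real e * w))"
proof -
  have "(LINT \<zeta>|lborel. f \<zeta>)
      = (LINT \<zeta>|density (distr lborel borel (\<lambda>x. z + e *\<^sub>R x)) (\<lambda>_. ennreal (\<bar>e\<bar> ^ DIM(complex))). f \<zeta>)"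
    using lborel_affine[of e z] e by simp
  also have "\<dots> = (LINT \<zeta>|distr lborel borel (\<lambda>x. z + e *\<^sub>R x). (e\<^sup>2) *\<^sub>R f \<zeta>)"
    using f e by (subst integral_density) auto
  also have "\<dots> = (LINT w|lborel. (e\<^sup>2) *\<^sub>R f (z + e *\<^sub>R w))"
    using f by (intro integral_distr) auto
  finally show ?thesis by (simp add: scaleR_conv_of_real)
qed

text \<open>The kernel 1 / w is regularised to cnj w / (|w|^2 + e^2), whose derivative with respect to cnj w is
  e^2 / (|w|^2 + e^2)^2.\<close>

lemma pompeiu_regularised:
  assumes u: "wirtinger UNIV u p q" and 0: "\<And>z. z \<notin> cball 0 R \<Longrightarrow> u z = 0" and e: "e > 0"
  shows "(LINT \<zeta>|lborel. q \<zeta> * (cnj (z - \<zeta>) / of_real ((norm (z - \<zeta>))\<^sup>2 + e\<^sup>2)))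
     = (LINT w|lborel. u (z + of_real e * w) / of_real ((1 + (norm w)\<^sup>2)\<^sup>2))"
proof -
  have nz: "of_real ((norm (z - \<zeta>))\<^sup>2 + e\<^sup>2) \<noteq> (0::complex)" for \<zeta>
    using e by (simp only: of_real_eq_0_iff) (simp add: add_nonneg_eq_0_iff)
  define D where "D \<zeta> = (z + - 1 * \<zeta>) * (cnj z + - 1 * cnj \<zeta>) + of_real (e\<^sup>2)" for \<zeta>
  have D_eq: "D \<zeta> = of_real ((norm (z - \<zeta>))\<^sup>2 + e\<^sup>2)" for \<zeta>
    using complex_norm_square[of "z - \<zeta>"] by (simp add: D_def)
  define Dp where "Dp \<zeta> = (0 + - 1 * 1) * (cnj z + - 1 * cnj \<zeta>) + (z + - 1 * \<zeta>) * (0 + - 1 * 0) + 0" for \<zeta>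
  define Dq where "Dq \<zeta> = (0 + - 1 * 0) * (cnj z + - 1 * cnj \<zeta>) + (z + - 1 * \<zeta>) * (0 + - 1 * 1) + 0" for \<zeta>
  have l1: "wirtinger UNIV (\<lambda>\<zeta>. z + - 1 * \<zeta>) (\<lambda>\<zeta>. 0 + - 1 * 1) (\<lambda>\<zeta>. 0 + - 1 * 0)"
    by (rule wirtinger_add[OF wirtinger_const[OF open_UNIV] wirtinger_cmult[OF wirtinger_ident[OF open_UNIV]]])
  have l2: "wirtinger UNIV (\<lambda>\<zeta>. cnj z + - 1 * cnj \<zeta>) (\<lambda>\<zeta>. 0 + - 1 * 0) (\<lambda>\<zeta>. 0 + - 1 * 1)"
    by (rule wirtinger_add[OF wirtinger_const[OF open_UNIV] wirtinger_cmult[OF wirtinger_cnj[OF open_UNIV]]])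
  have wD: "wirtinger UNIV D Dp Dq"
    unfolding D_def Dp_def Dq_def by (rule wirtinger_add[OF wirtinger_mult[OF l1 l2] wirtinger_const[OF open_UNIV]])
  have "wirtinger UNIV (\<lambda>\<zeta>. inverse (D \<zeta>)) (\<lambda>\<zeta>. - (inverse (D \<zeta>) * Dp \<zeta> * inverse (D \<zeta>)))
      (\<lambda>\<zeta>. - (inverse (D \<zeta>) * Dq \<zeta> * inverse (D \<zeta>)))"
    by (rule wirtinger_inverse[OF wD]) (subst D_eq, rule nz)
  from wirtinger_mult[OF u wirtinger_mult[OF l2 this]]
  obtain P where P: "wirtinger UNIV (\<lambda>\<zeta>. u \<zeta> * ((cnj z + - 1 * cnj \<zeta>) * inverse (D \<zeta>))) P
     (\<lambda>\<zeta>. q \<zeta> * ((cnj z + - 1 * cnj \<zeta>) * inverse (D \<zeta>)) +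
       u \<zeta> * ((0 + - 1 * 1) * inverse (D \<zeta>) + (cnj z + - 1 * cnj \<zeta>) * - (inverse (D \<zeta>) * Dq \<zeta> * inverse (D \<zeta>))))"
    by blast
  define k where "k \<zeta> = cnj (z - \<zeta>) / of_real ((norm (z - \<zeta>))\<^sup>2 + e\<^sup>2)" for \<zeta>
  define j where "j \<zeta> = of_real (e\<^sup>2) / (of_real (((norm (z - \<zeta>))\<^sup>2 + e\<^sup>2)\<^sup>2) :: complex)" for \<zeta>
  have k_eq: "(cnj z + - 1 * cnj \<zeta>) * inverse (D \<zeta>) = k \<zeta>" for \<zeta>
    by (simp add: k_def D_eq divide_inverse)
  have j_eq: "(0 + - 1 * 1) * inverse (D \<zeta>) + (cnj z + - 1 * cnj \<zeta>) * - (inverse (D \<zeta>) * Dq \<zeta> * inverse (D \<zeta>)) = - j \<zeta>" for \<zeta>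
  proof -
    have nzD: "D \<zeta> \<noteq> 0" using nz D_eq by simp
    have "(0 + - 1 * 1) * inverse (D \<zeta>) + (cnj z + - 1 * cnj \<zeta>) * - (inverse (D \<zeta>) * Dq \<zeta> * inverse (D \<zeta>))
       = ((z + - 1 * \<zeta>) * (cnj z + - 1 * cnj \<zeta>) - D \<zeta>) / (D \<zeta>)\<^sup>2"
      using nzD by (simp add: Dq_def divide_simps power2_eq_square) (simp add: algebra_simps)
    also have "\<dots> = - of_real (e\<^sup>2) / (D \<zeta>)\<^sup>2" by (simp add: D_def)
    also have "\<dots> = - j \<zeta>" by (simp add: j_def D_eq)
    finally show ?thesis .
  qed
  \<comment> \<open>Integration by parts: the integrand is the derivative, with respect to the
    conjugate variable, of u times the regularised kernel \<open>k\<close>.\<close>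
  have "(LINT \<zeta>|lborel. q \<zeta> * k \<zeta> + u \<zeta> * - j \<zeta>) = 0"
    using integral_dbar_zero[OF P, of R] 0 unfolding k_eq j_eq by simp
  moreover have q0: "q \<zeta> = 0" if "\<zeta> \<notin> cball 0 R" for \<zeta>
    using wirtinger_zero_off[OF u closed_cball 0 that] by auto
  have cont: "continuous_on UNIV q" "continuous_on UNIV u"
    using u wirtinger_continuous[OF u] by (auto simp: wirtinger_def)
  have kc: "continuous_on UNIV k" "continuous_on UNIV j"
    unfolding k_def j_def using nz by (auto intro!: continuous_intros simp del: of_real_add simp: )
  have qi: "integrable lborel (\<lambda>\<zeta>. q \<zeta> * k \<zeta>)" and ui: "integrable lborel (\<lambda>\<zeta>. u \<zeta> * j \<zeta>)"
    by (rule integrable_continuous_compact_support[OF _ compact_cball[of 0 R]],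
        intro continuous_intros cont kc, simp add: q0 0)+
  ultimately have "(LINT \<zeta>|lborel. q \<zeta> * k \<zeta>) = (LINT \<zeta>|lborel. u \<zeta> * j \<zeta>)"
    using Bochner_Integration.integral_diff[OF qi ui] by simp
  \<comment> \<open>Substituting \<zeta> = z + e w removes e from the kernel and moves it into the
    argument of u, so that letting e tend to 0 becomes a question of continuity of u.\<close>
  also have "\<dots> = (LINT w|lborel. of_real (e\<^sup>2) * (u (z + of_real e * w) * j (z + of_real e * w)))"
    by (rule lborel_integral_affine[OF _ e])
       (intro borel_measurable_continuous_onI continuous_intros cont kc)
  also have "\<dots> = (LINT w|lborel. u (z + of_real e * w) / of_real ((1 + (norm w)\<^sup>2)\<^sup>2))"
  proof (rule Bochner_Integration.integral_cong)
    fix w :: complex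
    have "(norm (z - (z + of_real e * w)))\<^sup>2 + e\<^sup>2 = e\<^sup>2 * (1 + (norm w)\<^sup>2)"
      using e by (simp add: norm_mult power_mult_distrib distrib_left)
    then have "j (z + of_real e * w) = of_real (e\<^sup>2 / (e\<^sup>2 * (1 + (norm w)\<^sup>2))\<^sup>2)"
      by (simp only: j_def of_real_divide)
    also have "e\<^sup>2 / (e\<^sup>2 * (1 + (norm w)\<^sup>2))\<^sup>2 = 1 / (e\<^sup>2 * (1 + (norm w)\<^sup>2)\<^sup>2)"
      using e by (simp add: power_mult_distrib power2_eq_square)
    finally have "of_real (e\<^sup>2) * j (z + of_real e * w) = of_real (e\<^sup>2 * (1 / (e\<^sup>2 * (1 + (norm w)\<^sup>2)\<^sup>2)))"
      by (simp only: of_real_mult)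
    also have "e\<^sup>2 * (1 / (e\<^sup>2 * (1 + (norm w)\<^sup>2)\<^sup>2)) = 1 / (1 + (norm w)\<^sup>2)\<^sup>2" using e by simp
    finally have *: "of_real (e\<^sup>2) * j (z + of_real e * w) = of_real (1 / (1 + (norm w)\<^sup>2)\<^sup>2)" .
    have "of_real (e\<^sup>2) * (u (z + of_real e * w) * j (z + of_real e * w))
        = u (z + of_real e * w) * (of_real (e\<^sup>2) * j (z + of_real e * w))"
      by (rule mult.left_commute)
    then show "of_real (e\<^sup>2) * (u (z + of_real e * w) * j (z + of_real e * w)) = u (z + of_real e * w) / of_real ((1 + (norm w)\<^sup>2)\<^sup>2)"
      by (simp only: * of_real_divide of_real_1 times_divide_eq_right mult_1_right)
  qed simp
  finally show ?thesis by (simp add: k_def)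
qed

text \<open>The regularised identity is passed to the limit on both sides by dominated convergence:
  on the left the regularised kernel is at most 1 / |z - \<zeta>|, on the right u is bounded and the
  weight is integrable.\<close>

theorem pompeiu:
  assumes u: "wirtinger UNIV u p q" and 0: "\<And>z. z \<notin> cball 0 R \<Longrightarrow> u z = 0"
  shows "(LINT \<zeta>|lborel. q \<zeta> / (z - \<zeta>)) = of_real pompeiu_const * u z"
proof -
  have q0: "q \<zeta> = 0" if "\<zeta> \<notin> cball 0 R" for \<zeta>
    using wirtinger_zero_off[OF u closed_cball 0 that] by auto
  have cont: "continuous_on UNIV q" "continuous_on UNIV u"
    using u wirtinger_continuous[OF u] by (auto simp: wirtinger_def)
  obtain Bq where Bq: "Bq \<ge> 0" "\<And>z. norm (q z) \<le> Bq"
    using bounded_continuous_compact_support[OF cont(1) compact_cball q0] by metis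
  obtain Bu where Bu: "Bu \<ge> 0" "\<And>z. norm (u z) \<le> Bu"
    using bounded_continuous_compact_support[OF cont(2) compact_cball 0] by metis
  have qm: "q \<in> borel_measurable borel" and um: "u \<in> borel_measurable borel"
    using cont borel_measurable_continuous_onI by auto
  define t where "t n = 1 / real (Suc n)" for n
  have t: "t n > 0" for n by (auto simp: t_def)
  have t0: "t \<longlonglongrightarrow> 0" unfolding t_def by (rule LIMSEQ_Suc[OF lim_1_over_n])
  have lim1: "(\<lambda>n. LINT \<zeta>|lborel. q \<zeta> * (cnj (z - \<zeta>) / of_real ((norm (z - \<zeta>))\<^sup>2 + (t n)\<^sup>2)))
      \<longlonglongrightarrow> (LINT \<zeta>|lborel. q \<zeta> / (z - \<zeta>))"
  proof (rule integral_dominated_convergence)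
    show "(\<lambda>\<zeta>. q \<zeta> / (z - \<zeta>)) \<in> borel_measurable lborel" using qm by measurable
    show "(\<lambda>\<zeta>. q \<zeta> * (cnj (z - \<zeta>) / of_real ((norm (z - \<zeta>))\<^sup>2 + (t n)\<^sup>2))) \<in> borel_measurable lborel" for n
    proof -
      have "(norm (z - \<zeta>))\<^sup>2 + (t n)\<^sup>2 \<noteq> 0" for \<zeta> using t[of n] by (simp add: add_nonneg_eq_0_iff)
      then have "continuous_on UNIV (\<lambda>\<zeta>. q \<zeta> * (cnj (z - \<zeta>) / of_real ((norm (z - \<zeta>))\<^sup>2 + (t n)\<^sup>2)))"
        by (intro continuous_intros cont) (simp only: of_real_eq_0_iff, blast)
      then show ?thesis using borel_measurable_continuous_onI by auto
    qed
    show "integrable lborel (\<lambda>\<zeta>::complex. Bq * (indicator (cball 0 R) \<zeta> / norm (z - \<zeta>)))"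
      by (intro integrable_mult_right integrable_inverse_dist)
    show "AE \<zeta> in lborel. norm (q \<zeta> * (cnj (z - \<zeta>) / of_real ((norm (z - \<zeta>))\<^sup>2 + (t n)\<^sup>2)))
        \<le> Bq * (indicator (cball 0 R) \<zeta> / norm (z - \<zeta>))" for n
    proof (rule AE_I2)
      fix \<zeta>
      show "norm (q \<zeta> * (cnj (z - \<zeta>) / of_real ((norm (z - \<zeta>))\<^sup>2 + (t n)\<^sup>2)))
        \<le> Bq * (indicator (cball 0 R) \<zeta> / norm (z - \<zeta>))"
      proof (cases "\<zeta> \<in> cball 0 R \<and> z \<noteq> \<zeta>")
        case True
        define d where "d = norm (z - \<zeta>)"
        have d: "d > 0" using True by (simp add: d_def)
        have "norm (of_real (d\<^sup>2 + (t n)\<^sup>2) :: complex) = d\<^sup>2 + (t n)\<^sup>2"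
          by (simp only: norm_of_real) simp
        then have "norm (cnj (z - \<zeta>) / of_real (d\<^sup>2 + (t n)\<^sup>2)) = d / (d\<^sup>2 + (t n)\<^sup>2)"
          by (simp only: norm_divide complex_mod_cnj d_def)
        also have "\<dots> \<le> d / d\<^sup>2" using d by (intro divide_left_mono mult_pos_pos) (auto intro: add_pos_nonneg)
        also have "\<dots> = 1 / d" using d by (simp add: power2_eq_square)
        finally have "norm (q \<zeta>) * norm (cnj (z - \<zeta>) / of_real (d\<^sup>2 + (t n)\<^sup>2)) \<le> Bq * (1 / d)"
          using Bq d by (intro mult_mono) auto
        then show ?thesis using True by (simp only: norm_mult d_def) simp
      next
        case False
        then show ?thesis using q0 by auto
      qed
    qed
    show "AE \<zeta> in lborel. (\<lambda>n. q \<zeta> * (cnj (z - \<zeta>) / of_real ((norm (z - \<zeta>))\<^sup>2 + (t n)\<^sup>2))) \<longlonglongrightarrow> q \<zeta> / (z - \<zeta>)"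
    proof (rule AE_I2)
      fix \<zeta>
      show "(\<lambda>n. q \<zeta> * (cnj (z - \<zeta>) / of_real ((norm (z - \<zeta>))\<^sup>2 + (t n)\<^sup>2))) \<longlonglongrightarrow> q \<zeta> / (z - \<zeta>)"
      proof (cases "z = \<zeta>")
        case False
        have "(\<lambda>n. q \<zeta> * (cnj (z - \<zeta>) / of_real ((norm (z - \<zeta>))\<^sup>2 + (t n)\<^sup>2)))
            \<longlonglongrightarrow> q \<zeta> * (cnj (z - \<zeta>) / of_real ((norm (z - \<zeta>))\<^sup>2 + 0\<^sup>2))"
          using False by (intro tendsto_intros t0) auto
        moreover have "cnj (z - \<zeta>) / of_real ((norm (z - \<zeta>))\<^sup>2 + 0\<^sup>2) = 1 / (z - \<zeta>)"
          using False complex_norm_square[of "z - \<zeta>"] by simp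
        ultimately show ?thesis by (simp only: times_divide_eq_right mult_1_right)
      qed simp
    qed
  qed
  have lim2: "(\<lambda>n. LINT w|lborel. u (z + of_real (t n) * w) / of_real ((1 + (norm w)\<^sup>2)\<^sup>2))
      \<longlonglongrightarrow> (LINT w|lborel. u z / of_real ((1 + (norm (w::complex))\<^sup>2)\<^sup>2))"
  proof (rule integral_dominated_convergence)
    have nz: "(1 + (norm (w::complex))\<^sup>2)\<^sup>2 \<noteq> 0" for w by (simp add: add_nonneg_eq_0_iff)
    show "(\<lambda>w::complex. u z / of_real ((1 + (norm w)\<^sup>2)\<^sup>2)) \<in> borel_measurable lborel" by measurable
    show "(\<lambda>w. u (z + of_real (t n) * w) / of_real ((1 + (norm w)\<^sup>2)\<^sup>2)) \<in> borel_measurable lborel" for n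
      using um by measurable
    show "integrable lborel (\<lambda>w::complex. Bu * (1 / (1 + (norm w)\<^sup>2)\<^sup>2))"
      by (intro integrable_mult_right integrable_inverse_square_quartic)
    show "AE w in lborel. norm (u (z + of_real (t n) * w) / of_real ((1 + (norm w)\<^sup>2)\<^sup>2)) \<le> Bu * (1 / (1 + (norm w)\<^sup>2)\<^sup>2)" for n
    proof (rule AE_I2)
      fix w :: complex
      have "norm (of_real ((1 + (norm w)\<^sup>2)\<^sup>2) :: complex) = (1 + (norm w)\<^sup>2)\<^sup>2" by (simp only: norm_of_real) simp
      then show "norm (u (z + of_real (t n) * w) / of_real ((1 + (norm w)\<^sup>2)\<^sup>2)) \<le> Bu * (1 / (1 + (norm w)\<^sup>2)\<^sup>2)"
        by (simp only: norm_divide) (simp add: divide_right_mono Bu)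
    qed
    show "AE w in lborel. (\<lambda>n. u (z + of_real (t n) * w) / of_real ((1 + (norm w)\<^sup>2)\<^sup>2)) \<longlonglongrightarrow> u z / of_real ((1 + (norm w)\<^sup>2)\<^sup>2)"
    proof (rule AE_I2)
      fix w :: complex
      have "(\<lambda>n. z + of_real (t n) * w) \<longlonglongrightarrow> z + of_real 0 * w" by (intro tendsto_intros t0)
      then have "(\<lambda>n. u (z + of_real (t n) * w)) \<longlonglongrightarrow> u z"
        using continuous_on_tendsto_compose[OF cont(2)] by force
      then show "(\<lambda>n. u (z + of_real (t n) * w) / of_real ((1 + (norm w)\<^sup>2)\<^sup>2)) \<longlonglongrightarrow> u z / of_real ((1 + (norm w)\<^sup>2)\<^sup>2)"
        by (rule tendsto_divide[OF _ tendsto_const]) (use nz[of w] in \<open>simp only: of_real_eq_0_iff\<close>, simp)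
    qed
  qed
  have "(LINT \<zeta>|lborel. q \<zeta> / (z - \<zeta>)) = (LINT w|lborel. u z / of_real ((1 + (norm (w::complex))\<^sup>2)\<^sup>2))"
    using lim1 lim2 by (intro LIMSEQ_unique) (simp_all only: pompeiu_regularised[OF u 0 t])
  also have "\<dots> = (LINT w|lborel. u z * of_real (1 / (1 + (norm (w::complex))\<^sup>2)\<^sup>2))"
    by (simp add: divide_inverse)
  also have "\<dots> = u z * of_real pompeiu_const"
    unfolding pompeiu_const_def by (simp only: integral_mult_right_zero integral_complex_of_real)
  finally show ?thesis by (simp add: mult.commute)
qed

section \<open>Cauchy transforms\<close>

text \<open>The data below stand for the complex measure on the disc of radius r that is the image under x
  of the measure with density c.\<close>

locale weighted_points = sigma_finite_measure M for M :: "'a measure" +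
  fixes c x :: "'a \<Rightarrow> complex" and r :: real
  assumes c: "integrable M c" and x: "x \<in> borel_measurable M"
    and supp: "\<And>\<omega>. c \<omega> \<noteq> 0 \<Longrightarrow> norm (x \<omega>) \<le> r"
begin

text \<open>The integral is 0 by convention where it does not exist; \<open>AE_integrable\<close>
  confines this to a null set of \<zeta>, and \<open>AE_off_diagonal\<close> does the same for zero
  denominators on sets of positive measure.\<close>

definition cauchy_transform :: "complex \<Rightarrow> complex" where
  "cauchy_transform \<zeta> = (LINT \<omega>|M. c \<omega> / (x \<omega> - \<zeta>))"

lemma c_measurable [measurable]: "c \<in> borel_measurable M" using c by auto

lemma x_measurable [measurable]: "x \<in> borel_measurable M" by (rule x)

interpretation P: pair_sigma_finite M "lborel :: complex measure" ..

text \<open>Fubini: each \<omega> excludes the single point \<zeta> = x \<omega>. So at almost every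
  \<zeta> pointwise limits of kernels may ignore the diagonal.\<close>

lemma AE_off_diagonal: "AE \<zeta> in lborel. AE \<omega> in M. x \<omega> \<noteq> \<zeta>"
proof (rule P.AE_commute[THEN iffD1])
  show "{y \<in> space (M \<Otimes>\<^sub>M lborel). x (fst y) \<noteq> snd y} \<in> sets (M \<Otimes>\<^sub>M lborel)"
    by measurable
  show "AE \<omega> in M. AE \<zeta> in lborel. x \<omega> \<noteq> \<zeta>"
  proof (rule AE_I2)
    show "AE \<zeta> in lborel. x \<omega> \<noteq> \<zeta>" for \<omega>
      using AE_lborel_singleton[of "x \<omega>"] by eventually_elim auto
  qed
qed

text \<open>The \<zeta>-integral of 1 / |x \<omega> - \<zeta>| over a disc is bounded uniformly for
  |x \<omega>| \<le> r, so integrability of \<open>c\<close> makes the double integral finite. Every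
  interchange of integrals below rests on this.\<close>

lemma kernel_integrable:
  assumes g: "g \<in> borel_measurable borel" "\<And>\<zeta>. norm (g \<zeta>) \<le> B" "\<And>\<zeta>. \<zeta> \<notin> cball 0 R \<Longrightarrow> g \<zeta> = 0"
  shows "integrable (M \<Otimes>\<^sub>M lborel) (\<lambda>(\<omega>, \<zeta>). g \<zeta> * (c \<omega> / (x \<omega> - \<zeta>)))"
proof (rule P.Fubini_integrable)
  have gm [measurable]: "g \<in> borel_measurable borel" by (rule g)
  show "(\<lambda>(\<omega>, \<zeta>). g \<zeta> * (c \<omega> / (x \<omega> - \<zeta>))) \<in> borel_measurable (M \<Otimes>\<^sub>M lborel)"
    by measurable
  have B: "B \<ge> 0" using g(2)[of 0] norm_ge_zero order_trans by blast
  define I where "I \<omega> = (\<lambda>\<zeta>::complex. B * norm (c \<omega>) * (indicator (cball 0 R) \<zeta> / norm (x \<omega> - \<zeta>)))" for \<omega>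
  have I_int: "integrable lborel (I \<omega>)" for \<omega>
    unfolding I_def by (intro integrable_mult_right integrable_inverse_dist)
  have I_le: "norm (g \<zeta> * (c \<omega> / (x \<omega> - \<zeta>))) \<le> I \<omega> \<zeta>" for \<omega> \<zeta>
  proof (cases "\<zeta> \<in> cball 0 R")
    case True
    have "norm (g \<zeta>) * (norm (c \<omega>) / norm (x \<omega> - \<zeta>)) \<le> B * (norm (c \<omega>) / norm (x \<omega> - \<zeta>))"
      by (intro mult_right_mono g(2)) auto
    then show ?thesis using True by (simp add: I_def norm_mult norm_divide)
  qed (simp add: g(3) I_def)
  have int: "integrable lborel (\<lambda>\<zeta>. g \<zeta> * (c \<omega> / (x \<omega> - \<zeta>)))" for \<omega>
  proof (rule Bochner_Integration.integrable_bound[OF I_int])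
    show "(\<lambda>\<zeta>. g \<zeta> * (c \<omega> / (x \<omega> - \<zeta>))) \<in> borel_measurable lborel" by measurable
    show "AE \<zeta> in lborel. norm (g \<zeta> * (c \<omega> / (x \<omega> - \<zeta>))) \<le> norm (I \<omega> \<zeta>)"
      using I_le by (intro AE_I2) (simp add: order_trans[OF _ abs_ge_self])
  qed
  show "AE \<omega> in M. integrable lborel (\<lambda>\<zeta>. case (\<omega>, \<zeta>) of (\<omega>, \<zeta>) \<Rightarrow> g \<zeta> * (c \<omega> / (x \<omega> - \<zeta>)))"
    using int by simp
  define S where "S = \<bar>R\<bar> + \<bar>r\<bar> + 1"
  define b where "b = (LINT w|lborel. indicator (ball 0 S) w / norm (w::complex))"
  have b: "(LINT w|lborel. indicator (ball 0 (\<bar>R\<bar> + norm (x \<omega>) + 1)) w / norm (w::complex)) \<le> b" if "c \<omega> \<noteq> 0" for \<omega>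
    unfolding b_def
  proof (rule integral_mono)
    show "integrable lborel (\<lambda>w::complex. indicator (ball 0 (\<bar>R\<bar> + norm (x \<omega>) + 1)) w / norm w)"
      by (rule integrable_inverse_norm) (simp add: add_nonneg_pos)
    show "integrable lborel (\<lambda>w::complex. indicator (ball 0 S) w / norm w)"
      by (rule integrable_inverse_norm) (simp add: add_nonneg_pos S_def)
    show "indicator (ball 0 (\<bar>R\<bar> + norm (x \<omega>) + 1)) w / norm w \<le> indicator (ball 0 S) w / norm w" for w :: complex
      using supp[OF that] by (intro divide_right_mono) (auto simp: indicator_def S_def)
  qed
  show "integrable M (\<lambda>\<omega>. LINT \<zeta>|lborel. norm (case (\<omega>, \<zeta>) of (\<omega>, \<zeta>) \<Rightarrow> g \<zeta> * (c \<omega> / (x \<omega> - \<zeta>))))"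
  proof (rule Bochner_Integration.integrable_bound)
    show "integrable M (\<lambda>\<omega>. B * b * norm (c \<omega>))" using c by (intro integrable_mult_right integrable_norm)
    show "(\<lambda>\<omega>. LINT \<zeta>|lborel. norm (case (\<omega>, \<zeta>) of (\<omega>, \<zeta>) \<Rightarrow> g \<zeta> * (c \<omega> / (x \<omega> - \<zeta>)))) \<in> borel_measurable M"
      by measurable
    show "AE \<omega> in M. norm (LINT \<zeta>|lborel. norm (case (\<omega>, \<zeta>) of (\<omega>, \<zeta>) \<Rightarrow> g \<zeta> * (c \<omega> / (x \<omega> - \<zeta>)))) \<le> norm (B * b * norm (c \<omega>))"
    proof (rule AE_I2)
      fix \<omega>
      have "(LINT \<zeta>|lborel. norm (g \<zeta> * (c \<omega> / (x \<omega> - \<zeta>)))) \<le> (LINT \<zeta>|lborel. I \<omega> \<zeta>)"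
        by (intro integral_mono integrable_norm int I_int I_le)
      also have "\<dots> = B * norm (c \<omega>) * (LINT \<zeta>|lborel. indicator (cball 0 R) \<zeta> / norm (x \<omega> - \<zeta>))"
        unfolding I_def by (rule integral_mult_right_zero)
      also have "\<dots> \<le> B * norm (c \<omega>) * b"
      proof (cases "c \<omega> = 0")
        case False
        show ?thesis
          using order_trans[OF integrable_inverse_dist(2) b[OF False]] B by (intro mult_left_mono) auto
      qed simp
      finally have "(LINT \<zeta>|lborel. norm (g \<zeta> * (c \<omega> / (x \<omega> - \<zeta>)))) \<le> B * b * norm (c \<omega>)" by (simp add: mult_ac)
      moreover have "0 \<le> (LINT \<zeta>|lborel. norm (g \<zeta> * (c \<omega> / (x \<omega> - \<zeta>))))" by (rule integral_nonneg_AE) auto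
      ultimately show "norm (LINT \<zeta>|lborel. norm (case (\<omega>, \<zeta>) of (\<omega>, \<zeta>) \<Rightarrow> g \<zeta> * (c \<omega> / (x \<omega> - \<zeta>)))) \<le> norm (B * b * norm (c \<omega>))"
        by simp
    qed
  qed
qed

lemma AE_integrable: "AE \<zeta> in lborel. integrable M (\<lambda>\<omega>. c \<omega> / (x \<omega> - \<zeta>))"
proof -
  have "AE \<zeta> in lborel. \<forall>n::nat. integrable M (\<lambda>\<omega>. indicator (cball 0 (real n)) \<zeta> * (c \<omega> / (x \<omega> - \<zeta>)))"
  proof (rule AE_all_countable[THEN iffD2], rule allI)
    fix n :: nat
    have "integrable (M \<Otimes>\<^sub>M lborel) (\<lambda>(\<omega>, \<zeta>). indicator (cball 0 (real n)) \<zeta> * (c \<omega> / (x \<omega> - \<zeta>)))"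
      by (rule kernel_integrable[of _ 1 "real n"]) (auto simp: indicator_def intro!: borel_measurable_indicator)
    then show "AE \<zeta> in lborel. integrable M (\<lambda>\<omega>. indicator (cball 0 (real n)) \<zeta> * (c \<omega> / (x \<omega> - \<zeta>)))"
      by (rule P.AE_integrable_snd)
  qed
  then show ?thesis
  proof eventually_elim
    case (elim \<zeta>)
    obtain n :: nat where "norm \<zeta> \<le> real n" using real_arch_simple by blast
    then show ?case using elim[rule_format, of n] by simp
  qed
qed

lemma cauchy_transform_measurable [measurable]: "cauchy_transform \<in> borel_measurable borel"
proof -
  have "(\<lambda>(\<zeta>, \<omega>). c \<omega> / (x \<omega> - \<zeta>)) \<in> borel_measurable (borel \<Otimes>\<^sub>M M)" by measurable
  then have "(\<lambda>\<zeta>. LINT \<omega>|M. c \<omega> / (x \<omega> - \<zeta>)) \<in> borel_measurable borel"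
    by (rule borel_measurable_lebesgue_integral)
  then show ?thesis by (simp add: cauchy_transform_def[abs_def])
qed

lemma cauchy_transform_integrable:
  assumes g: "g \<in> borel_measurable borel" "\<And>\<zeta>. norm (g \<zeta>) \<le> B" "\<And>\<zeta>. \<zeta> \<notin> cball 0 R \<Longrightarrow> g \<zeta> = 0"
  shows "integrable lborel (\<lambda>\<zeta>. g \<zeta> * cauchy_transform \<zeta>)"
proof -
  have "integrable lborel (\<lambda>\<zeta>. LINT \<omega>|M. g \<zeta> * (c \<omega> / (x \<omega> - \<zeta>)))"
    using P.integrable_snd[OF kernel_integrable[OF g]] by simp
  then show ?thesis by (simp only: cauchy_transform_def integral_mult_right_zero)
qed

text \<open>Pompeiu's formula is inserted for u under the integral over \<open>M\<close> and the
  order is exchanged. In the language of distributions, the derivative of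
  \<open>cauchy_transform\<close> with respect to the conjugate variable is minus
  \<open>pompeiu_const\<close> times the image measure.\<close>

theorem cauchy_transform_pairing:
  assumes u: "wirtinger UNIV u p q" and 0: "\<And>z. z \<notin> cball 0 R \<Longrightarrow> u z = 0"
  shows "of_real pompeiu_const * (LINT \<omega>|M. c \<omega> * u (x \<omega>)) = (LINT \<zeta>|lborel. q \<zeta> * cauchy_transform \<zeta>)"
proof -
  have q0: "q \<zeta> = 0" if "\<zeta> \<notin> cball 0 R" for \<zeta>
    using wirtinger_zero_off[OF u closed_cball 0 that] by auto
  have qc: "continuous_on UNIV q" using u by (auto simp: wirtinger_def)
  obtain B where B: "B \<ge> 0" "\<And>z. norm (q z) \<le> B"
    using bounded_continuous_compact_support[OF qc compact_cball q0] by metis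
  have qm: "q \<in> borel_measurable borel" using qc by (rule borel_measurable_continuous_onI)
  have "of_real pompeiu_const * (LINT \<omega>|M. c \<omega> * u (x \<omega>)) = (LINT \<omega>|M. c \<omega> * (of_real pompeiu_const * u (x \<omega>)))"
    by (simp add: mult.left_commute)
  also have "\<dots> = (LINT \<omega>|M. LINT \<zeta>|lborel. q \<zeta> * (c \<omega> / (x \<omega> - \<zeta>)))"
  proof (rule Bochner_Integration.integral_cong)
    fix \<omega>
    have "c \<omega> * (of_real pompeiu_const * u (x \<omega>)) = c \<omega> * (LINT \<zeta>|lborel. q \<zeta> / (x \<omega> - \<zeta>))"
      using pompeiu[OF u 0] by simp
    also have "\<dots> = (LINT \<zeta>|lborel. c \<omega> * (q \<zeta> / (x \<omega> - \<zeta>)))" by (rule integral_mult_right_zero[symmetric])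
    also have "\<dots> = (LINT \<zeta>|lborel. q \<zeta> * (c \<omega> / (x \<omega> - \<zeta>)))"
      by (rule Bochner_Integration.integral_cong) auto
    finally show "c \<omega> * (of_real pompeiu_const * u (x \<omega>)) = (LINT \<zeta>|lborel. q \<zeta> * (c \<omega> / (x \<omega> - \<zeta>)))" .
  qed simp
  also have "\<dots> = (LINT \<zeta>|lborel. LINT \<omega>|M. q \<zeta> * (c \<omega> / (x \<omega> - \<zeta>)))"
    by (rule P.Fubini_integral[symmetric]) (rule kernel_integrable[OF qm B(2) q0])
  also have "\<dots> = (LINT \<zeta>|lborel. q \<zeta> * cauchy_transform \<zeta>)"
    by (simp only: cauchy_transform_def integral_mult_right_zero)
  finally show ?thesis .
qed

corollary integral_zero_if_cauchy_transform_zero: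
  assumes u: "wirtinger UNIV u p q" and 0: "\<And>z. z \<notin> cball 0 R \<Longrightarrow> u z = 0"
    and AE: "AE \<zeta> in lborel. q \<zeta> * cauchy_transform \<zeta> = 0"
  shows "(LINT \<omega>|M. c \<omega> * u (x \<omega>)) = 0"
proof -
  have "(LINT \<zeta>|lborel. q \<zeta> * cauchy_transform \<zeta>) = 0"
    by (rule integral_eq_zero_AE[OF AE])
  then show ?thesis
    using cauchy_transform_pairing[OF u 0] pompeiu_const_pos by simp
qed

end

section \<open>Zeros of the Cauchy--Riemann derivative\<close>

text \<open>The set where Re (a h) is positive is itself a permitted test set. Four rotations
  \<open>a\<close> then determine h.\<close>

lemma AE_nonpos_of_integrals:
  fixes h :: "complex \<Rightarrow> complex"
  assumes h: "integrable lborel h" and z: "\<And>S. S \<in> sets borel \<Longrightarrow> (LINT z|lborel. indicator S z *\<^sub>R h z) = 0"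
  shows "AE z in lborel. Re (a * h z) \<le> 0"
proof -
  have ah: "integrable lborel (\<lambda>z. a * h z)" using h by simp
  have m: "(\<lambda>z. Re (a * h z)) \<in> borel_measurable borel"
    using borel_measurable_integrable[OF integrable_Re[OF ah]] by (simp del: times_complex.sel)
  define S where "S = {z. Re (a * h z) > 0}"
  have S: "S \<in> sets borel" unfolding S_def using m by measurable
  have i: "integrable lborel (\<lambda>z. indicator S z *\<^sub>R (a * h z))"
    using ah S by (intro integrable_mult_indicator) auto
  have "(LINT z|lborel. indicator S z *\<^sub>R (a * h z)) = (LINT z|lborel. a * (indicator S z *\<^sub>R h z))"
    by (rule Bochner_Integration.integral_cong) auto
  also have "\<dots> = a * (LINT z|lborel. indicator S z *\<^sub>R h z)" by (rule integral_mult_right_zero)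
  finally have "(LINT z|lborel. indicator S z *\<^sub>R (a * h z)) = 0" using z[OF S] by simp
  then have "(LINT z|lborel. Re (indicator S z *\<^sub>R (a * h z))) = 0"
    using integral_Re[OF i] by simp
  moreover have "0 \<le> Re (indicator S z *\<^sub>R (a * h z))" for z
    by (auto simp: S_def indicator_def)
  ultimately have "AE z in lborel. Re (indicator S z *\<^sub>R (a * h z)) = 0"
    using integrable_Re[OF i] by (subst (asm) integral_nonneg_eq_0_iff_AE) auto
  then show ?thesis
  proof eventually_elim
    case (elim z)
    show ?case
    proof (cases "z \<in> S")
      case True
      then show ?thesis using elim by simp
    qed (simp add: S_def)
  qed
qed

lemma AE_zero_of_integrals:
  fixes h :: "complex \<Rightarrow> complex"
  assumes "integrable lborel h" "\<And>S. S \<in> sets borel \<Longrightarrow> (LINT z|lborel. indicator S z *\<^sub>R h z) = 0"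
  shows "AE z in lborel. h z = 0"
proof -
  have *: "AE z in lborel. Re (a * h z) \<le> 0" for a
    by (rule AE_nonpos_of_integrals[OF assms(1)]) (rule assms(2))
  from *[of 1] *[of "-1"] *[of \<i>] *[of "- \<i>"] show ?thesis
    by eventually_elim (simp add: complex_eq_iff)
qed

text \<open>Bump functions supported in an open set and equal to 1 on exhausting compact subsets
  converge to its indicator, so integrals over open subsets of \<open>W\<close> vanish; Dynkin's
  lemma carries this to Borel sets.\<close>

lemma AE_zero_of_tests:
  fixes h :: "complex \<Rightarrow> complex"
  assumes h: "integrable lborel h" and W: "open W"
    and test: "\<And>u p q S. wirtinger UNIV u p q \<Longrightarrow> compact S \<Longrightarrow> S \<subseteq> W \<Longrightarrow> (\<And>z. z \<notin> S \<Longrightarrow> u z = 0)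
      \<Longrightarrow> (LINT z|lborel. u z * h z) = 0"
  shows "AE z in lborel. z \<in> W \<longrightarrow> h z = 0"
proof -
  define g where "g z = indicator W z *\<^sub>R h z" for z
  have hm: "h \<in> borel_measurable borel" using h by auto
  have g: "integrable lborel g"
    unfolding g_def using h W by (intro integrable_mult_indicator) auto
  have opn: "(LINT z|lborel. indicator U z *\<^sub>R g z) = 0" if U: "open U" for U
  proof -
    define V where "V = U \<inter> W"
    have V: "open V" using U W by (auto simp: V_def)
    obtain K where K: "\<And>n::nat. compact (K n)" "\<And>n. K n \<subseteq> V"
      and KX: "\<And>X. \<lbrakk>compact X; X \<subseteq> V\<rbrakk> \<Longrightarrow> \<exists>N. \<forall>n\<ge>N. X \<subseteq> K n"
      using open_Union_compact_subsets[OF V] by metis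
    have "\<exists>\<phi>. (\<exists>p q S. wirtinger UNIV (\<lambda>z. of_real (\<phi> z)) p q \<and> compact S \<and> S \<subseteq> V \<and> (\<forall>z. z \<notin> S \<longrightarrow> \<phi> z = 0))
        \<and> (\<forall>z\<in>K n. \<phi> z = 1) \<and> (\<forall>z. 0 \<le> \<phi> z \<and> \<phi> z \<le> (1::real))" for n
      by (rule wirtinger_bump[OF K(1)[of n] V K(2)[of n]]) blast
    then obtain \<phi> where \<phi>: "\<And>n. \<exists>p q S. wirtinger UNIV (\<lambda>z. of_real (\<phi> n z)) p q \<and> compact S \<and> S \<subseteq> V \<and> (\<forall>z. z \<notin> S \<longrightarrow> \<phi> n z = 0)"
      "\<And>n z. z \<in> K n \<Longrightarrow> \<phi> n z = 1" "\<And>n z. 0 \<le> \<phi> n z \<and> \<phi> n z \<le> (1::real)" by metis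
    have zero: "(LINT z|lborel. of_real (\<phi> n z) * h z) = 0" for n
    proof -
      obtain p q S where "wirtinger UNIV (\<lambda>z. of_real (\<phi> n z)) p q" "compact S" "S \<subseteq> V" "\<And>z. z \<notin> S \<Longrightarrow> \<phi> n z = 0"
        using \<phi>(1) by blast
      then show ?thesis by (intro test[of _ p q S]) (auto simp: V_def)
    qed
    have off: "\<phi> n z = 0" if "z \<notin> V" for n z using \<phi>(1)[of n] that by blast
    have "(\<lambda>n. LINT z|lborel. of_real (\<phi> n z) * h z) \<longlonglongrightarrow> (LINT z|lborel. indicator U z *\<^sub>R g z)"
    proof (rule integral_dominated_convergence)
      show "(\<lambda>z. indicator U z *\<^sub>R g z) \<in> borel_measurable lborel"
        using g U by (intro borel_measurable_scaleR borel_measurable_indicator) auto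
      show "(\<lambda>z. of_real (\<phi> n z) * h z) \<in> borel_measurable lborel" for n
      proof -
        obtain p q where "wirtinger UNIV (\<lambda>z. of_real (\<phi> n z)) p q" using \<phi>(1) by blast
        then have "continuous_on UNIV (\<lambda>z. of_real (\<phi> n z) :: complex)" by (rule wirtinger_continuous)
        then have "(\<lambda>z. of_real (\<phi> n z) :: complex) \<in> borel_measurable borel" by (rule borel_measurable_continuous_onI)
        then show ?thesis using hm by (intro borel_measurable_times) auto
      qed
      show "integrable lborel (\<lambda>z. norm (h z))" using h by simp
      show "AE z in lborel. norm (of_real (\<phi> n z) * h z) \<le> norm (h z)" for n
        using \<phi>(3)[of n] by (intro AE_I2) (simp add: norm_mult mult_left_le_one_le)
      show "AE z in lborel. (\<lambda>n. of_real (\<phi> n z) * h z) \<longlonglongrightarrow> indicator U z *\<^sub>R g z"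
      proof (rule AE_I2)
        fix z
        show "(\<lambda>n. of_real (\<phi> n z) * h z) \<longlonglongrightarrow> indicator U z *\<^sub>R g z"
        proof (cases "z \<in> V")
          case True
          obtain N where "\<forall>n\<ge>N. {z} \<subseteq> K n" using KX[of "{z}"] True by auto
          then have "\<forall>n\<ge>N. of_real (\<phi> n z) * h z = indicator U z *\<^sub>R g z"
            using True \<phi>(2) by (auto simp: g_def V_def)
          then show ?thesis by (intro tendsto_eventually) (auto simp: eventually_sequentially)
        next
          case False
          then have "indicator U z *\<^sub>R g z = 0" by (auto simp: g_def V_def indicator_def)
          then show ?thesis by (simp only: off[OF False]) simp
        qed
      qed
    qed
    then show ?thesis by (simp add: zero LIMSEQ_const_iff)
  qed
  have "(LINT z|lborel. indicator S z *\<^sub>R g z) = 0" if S: "S \<in> sets borel" for S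
  proof -
    \<comment> \<open>Open sets are closed under intersection and generate the Borel sets; the
      complement step uses that the integral over the whole plane is one of the open cases.\<close>
    have "Int_stable {S::complex set. open S}" by (auto simp: Int_stable_def)
    moreover have "{S::complex set. open S} \<subseteq> Pow UNIV" by simp
    moreover have "S \<in> sigma_sets UNIV {S. open S}" using S by (simp add: borel_def)
    ultimately show ?thesis
    proof (induction S rule: sigma_sets_induct_disjoint)
      case (basic A)
      then show ?case using opn by simp
    next
      case empty
      then show ?case by simp
    next
      case (compl A)
      then have A: "A \<in> sets borel" by (simp add: borel_def)
      have i: "integrable lborel (\<lambda>z. indicator A z *\<^sub>R g z)"
        using g A by (intro integrable_mult_indicator) auto
      have "(LINT z|lborel. indicator (UNIV - A) z *\<^sub>R g z) = (LINT z|lborel. g z - indicator A z *\<^sub>R g z)"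
        by (rule Bochner_Integration.integral_cong) (auto simp: indicator_def)
      also have "\<dots> = (LINT z|lborel. g z) - (LINT z|lborel. indicator A z *\<^sub>R g z)"
        by (rule Bochner_Integration.integral_diff[OF g i])
      finally show ?case using compl.IH opn[OF open_UNIV] by simp
    next
      case (union A)
      have A: "A i \<in> sets borel" for i using union by (auto simp: borel_def)
      have "(LINT z:(\<Union>i. A i)|lborel. g z) = (\<Sum>i. (LINT z:(A i)|lborel. g z))"
      proof (rule lebesgue_integral_countable_add)
        show "set_integrable lborel (\<Union>i. A i) g"
          unfolding set_integrable_def using A g by (intro integrable_mult_indicator) auto
      qed (use A union.hyps in \<open>auto simp: disjoint_family_on_def\<close>)
      then show ?case using union.IH by (simp add: set_lebesgue_integral_def)
    qed
  qed
  then have "AE z in lborel. g z = 0" by (rule AE_zero_of_integrals[OF g])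
  then show ?thesis
    by eventually_elim (auto simp: g_def)
qed

lemma wirtinger_cnj_comp:
  assumes "wirtinger U u p q"
  shows "wirtinger U (\<lambda>z. cnj (u z)) (\<lambda>z. cnj (q z)) (\<lambda>z. cnj (p z))"
proof -
  have "((\<lambda>z. cnj (u z)) has_derivative (\<lambda>h. cnj (q z) * h + cnj (p z) * cnj h)) (at z)" if "z \<in> U" for z
  proof (rule has_derivative_eq_rhs)
    show "((\<lambda>z. cnj (u z)) has_derivative (\<lambda>h. cnj (p z * h + q z * cnj h))) (at z)"
      by (rule has_derivative_compose[OF _ bounded_linear_imp_has_derivative[OF bounded_linear_cnj]])
         (use assms that in \<open>simp add: wirtinger_def\<close>)
  qed (simp add: fun_eq_iff)
  then show ?thesis using assms by (auto simp: wirtinger_def intro!: continuous_intros)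
qed

text \<open>f e^2 / (e^2 + |f|^2) tends to 0 uniformly as e tends to 0, while its derivative tends to that of f
  on the zero set of f and to 0 elsewhere.\<close>

lemma dbar_zero_on_zero_set:
  assumes f: "wirtinger D f p q" and D: "bounded D" and qb: "\<And>z. z \<in> D \<Longrightarrow> norm (q z) \<le> Bq"
  shows "AE z in lborel. z \<in> D \<longrightarrow> f z = 0 \<longrightarrow> q z = 0"
proof -
  have opD: "open D" by (rule wirtinger_open[OF f])
  have cf: "continuous_on D f" "continuous_on D p" "continuous_on D q"
    using f wirtinger_continuous[OF f] by (auto simp: wirtinger_def)
  define N where "N = {z\<in>D. f z = 0}"
  have N: "N \<in> sets borel"
  proof -
    have "closedin (top_of_set D) N"
      unfolding N_def using continuous_closedin_preimage_constant[OF cf(1)] by simp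
    then obtain T where "closed T" "N = D \<inter> T" by (auto simp: closedin_closed)
    then show ?thesis using opD by auto
  qed
  define h where "h z = indicator N z *\<^sub>R q z" for z
  have qm: "(\<lambda>z. indicator D z *\<^sub>R q z) \<in> borel_measurable borel"
    using opD by (intro borel_measurable_continuous_on_indicator cf) auto
  have h_eq: "h = (\<lambda>z. indicator N z *\<^sub>R (indicator D z *\<^sub>R q z))"
    by (auto simp: h_def fun_eq_iff N_def indicator_def)
  have hm: "h \<in> borel_measurable borel"
    unfolding h_eq by (rule borel_measurable_scaleR[OF borel_measurable_indicator[OF N] qm])
  have hi: "integrable lborel h"
  proof (rule Bochner_Integration.integrable_bound)
    show "integrable lborel (\<lambda>z. \<bar>Bq\<bar> * indicator D z)"
      using opD D by (intro integrable_mult_right integrable_real_indicator) (auto intro: emeasure_bounded_finite[unfolded infinity_ennreal_def])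
    show "h \<in> borel_measurable lborel" using hm by simp
    show "AE z in lborel. norm (h z) \<le> norm (\<bar>Bq\<bar> * indicator D z)"
      using order_trans[OF qb abs_ge_self] by (intro AE_I2) (auto simp: h_def N_def indicator_def)
  qed
  have "AE z in lborel. z \<in> D \<longrightarrow> h z = 0"
  proof (rule AE_zero_of_tests[OF hi opD])
    fix \<phi> p' q' S
    assume \<phi>: "wirtinger UNIV \<phi> p' q'" and S: "compact S" "S \<subseteq> D" and \<phi>0: "\<And>z. z \<notin> S \<Longrightarrow> \<phi> z = 0"
    have c\<phi>: "continuous_on UNIV \<phi>" "continuous_on UNIV q'"
      using \<phi> wirtinger_continuous[OF \<phi>] by (auto simp: wirtinger_def)
    have q'0: "q' z = 0" if "z \<notin> S" for z
      using wirtinger_zero_off[OF \<phi> compact_imp_closed[OF S(1)] \<phi>0 that] by auto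
    define t where "t n = 1 / real (Suc n)" for n
    have t: "t n > 0" for n by (auto simp: t_def)
    have t0: "t \<longlonglongrightarrow> 0" unfolding t_def by (rule LIMSEQ_Suc[OF lim_1_over_n])
    \<comment> \<open>The denominator |f|^2 + (t n)^2, written as a product with the conjugate so
      that the Wirtinger calculus applies.\<close>
    define d where "d n z = f z * cnj (f z) + of_real ((t n)\<^sup>2)" for n z
    have d_eq: "d n z = of_real ((norm (f z))\<^sup>2 + (t n)\<^sup>2)" for n z
      using complex_norm_square[of "f z"] by (simp add: d_def)
    have d_pos: "(norm (f z))\<^sup>2 + (t n)\<^sup>2 > 0" for n z using t[of n] by (simp add: add_nonneg_pos)
    have d_norm: "norm (d n z) = (norm (f z))\<^sup>2 + (t n)\<^sup>2" for n z
      using d_pos[of z n] by (simp only: d_eq norm_of_real abs_of_pos)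
    have d_nz: "d n z \<noteq> 0" for n z using d_norm[of n z] d_pos[of z n] by auto
    define dq where "dq z = q z * cnj (f z) + f z * cnj (p z)" for z
    \<comment> \<open>The derivative of \<phi> f (t n)^2 / d with respect to the conjugate variable.
      It has integral 0 for each n because the differentiated function has compact support in
      \<open>D\<close>.\<close>
    define R where "R n z = q' z * (f z * (of_real ((t n)\<^sup>2) * inverse (d n z))) +
       \<phi> z * (q z * (of_real ((t n)\<^sup>2) * inverse (d n z)) + f z * (of_real ((t n)\<^sup>2) * - (inverse (d n z) * dq z * inverse (d n z))))" for n z
    have wR: "\<exists>P. wirtinger D (\<lambda>z. \<phi> z * (f z * (of_real ((t n)\<^sup>2) * inverse (d n z)))) P (R n)" for n
    proof -
      obtain P where "wirtinger D (d n) P (\<lambda>z. dq z + 0)"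
        using wirtinger_add[OF wirtinger_mult[OF f wirtinger_cnj_comp[OF f]] wirtinger_const[OF opD, of "of_real ((t n)\<^sup>2)"]]
        unfolding d_def dq_def by blast
      from wirtinger_mult[OF wirtinger_subset[OF \<phi> subset_UNIV opD]
          wirtinger_mult[OF f wirtinger_cmult[OF wirtinger_inverse[OF this d_nz], of "of_real ((t n)\<^sup>2)"]]]
      show ?thesis unfolding R_def by auto
    qed
    have R0: "R n z = 0" if "z \<notin> S" for n z using q'0[OF that] \<phi>0[OF that] by (simp add: R_def)
    have cR: "continuous_on D (R n)" for n using wR[of n] by (auto simp: wirtinger_def)
    obtain rad where rad: "S \<subseteq> cball 0 rad" using bounded_subset_ballD[OF compact_imp_bounded[OF S(1)]] ball_subset_cball by blast
    have intR: "(LINT z|lborel. R n z) = 0" for n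
    proof -
      obtain P where P: "wirtinger D (\<lambda>z. \<phi> z * (f z * (of_real ((t n)\<^sup>2) * inverse (d n z)))) P (R n)"
        using wR by blast
      have "wirtinger UNIV (\<lambda>z. if z \<in> D then \<phi> z * (f z * (of_real ((t n)\<^sup>2) * inverse (d n z))) else 0)
          (\<lambda>z. if z \<in> D then P z else 0) (\<lambda>z. if z \<in> D then R n z else 0)"
        by (rule wirtinger_extend_zero[OF P compact_imp_closed[OF S(1)] S(2)]) (use \<phi>0 in auto)
      then have "(LINT z|lborel. (if z \<in> D then R n z else 0)) = 0"
      proof (rule integral_dbar_zero[where R = rad])
        fix z :: complex assume "z \<notin> cball 0 rad"
        then have "\<phi> z = 0" using rad \<phi>0 by blast
        then show "(if z \<in> D then \<phi> z * (f z * (of_real ((t n)\<^sup>2) * inverse (d n z))) else 0) = 0" by simp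
      qed
      moreover have "(\<lambda>z. if z \<in> D then R n z else 0) = R n" using R0 S(2) by (auto simp: fun_eq_iff)
      ultimately show ?thesis by simp
    qed
    \<comment> \<open>Both (t n)^2 / d and |f|^2 / d are at most 1. One term |q| comes from
      differentiating f, the other together with |p| from differentiating 1 / d.\<close>
    define bnd where "bnd z = norm (q' z) * norm (f z) + norm (\<phi> z) * (2 * norm (q z) + norm (p z))" for z
    have "continuous_on S bnd"
      unfolding bnd_def
      by (intro continuous_intros continuous_on_subset[OF cf(1) S(2)] continuous_on_subset[OF cf(2) S(2)]
          continuous_on_subset[OF cf(3) S(2)] continuous_on_subset[OF c\<phi>(1)] continuous_on_subset[OF c\<phi>(2)]) auto
    then have bi: "integrable lborel (\<lambda>z. indicator S z *\<^sub>R bnd z)"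
      by (intro borel_integrable_compact S)
    have R_bound: "norm (R n z) \<le> bnd z" for n z
    proof -
      define \<tau> where "\<tau> = (t n)\<^sup>2"
      define m where "m = (norm (f z))\<^sup>2 + \<tau>"
      have m: "m > 0" "0 \<le> \<tau>" "\<tau> \<le> m" "(norm (f z))\<^sup>2 \<le> m" using d_pos[of z n] by (auto simp: m_def \<tau>_def)
      have nd: "norm (inverse (d n z)) = 1 / m" by (simp add: norm_inverse d_norm m_def \<tau>_def divide_inverse)
      have 1: "norm (of_real \<tau> * inverse (d n z)) \<le> 1"
        using m by (simp add: norm_mult nd)
      have "norm (dq z) \<le> norm (f z) * (norm (q z) + norm (p z))"
        using norm_triangle_ineq[of "q z * cnj (f z)" "f z * cnj (p z)"]
        by (simp add: dq_def norm_mult algebra_simps)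
      then have "norm (f z) * norm (dq z) \<le> norm (f z) * (norm (f z) * (norm (q z) + norm (p z)))"
        by (rule mult_left_mono) simp
      also have "\<dots> = (norm (f z))\<^sup>2 * (norm (q z) + norm (p z))" by (simp add: power2_eq_square mult.assoc)
      also have "\<dots> \<le> m * (norm (q z) + norm (p z))" using m by (intro mult_right_mono) auto
      finally have fd: "norm (f z) * norm (dq z) \<le> m * (norm (q z) + norm (p z))" .
      have "norm (f z * (of_real \<tau> * - (inverse (d n z) * dq z * inverse (d n z))))
          = (\<tau> / m) * ((norm (f z) * norm (dq z)) / m)"
        using m(2) by (simp add: norm_mult nd)
      also have "\<dots> \<le> 1 * (norm (q z) + norm (p z))"
        using m fd by (intro mult_mono) (auto simp: divide_le_eq mult.commute)
      finally have 2: "norm (f z * (of_real \<tau> * - (inverse (d n z) * dq z * inverse (d n z)))) \<le> norm (q z) + norm (p z)" by simp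
      define w y where "w = of_real \<tau> * inverse (d n z)"
        and "y = f z * (of_real \<tau> * - (inverse (d n z) * dq z * inverse (d n z)))"
      have "norm (R n z) \<le> norm (q' z * (f z * w)) + norm (\<phi> z * (q z * w + y))"
        unfolding R_def \<tau>_def[symmetric] w_def y_def by (rule norm_triangle_ineq)
      also have "\<dots> \<le> norm (q' z) * (norm (f z) * norm w) + norm (\<phi> z) * (norm (q z) * norm w + norm y)"
        using norm_triangle_ineq[of "q z * w" y] by (simp add: norm_mult mult_left_mono)
      also have "\<dots> \<le> norm (q' z) * (norm (f z) * 1) + norm (\<phi> z) * (norm (q z) * 1 + (norm (q z) + norm (p z)))"
        using 1 2 unfolding w_def y_def by (intro add_mono mult_left_mono) auto
      finally show ?thesis by (simp add: bnd_def)
    qed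
    have "(\<lambda>n. LINT z|lborel. R n z) \<longlonglongrightarrow> (LINT z|lborel. \<phi> z * h z)"
    proof (rule integral_dominated_convergence[OF _ _ bi])
      show "(\<lambda>z. \<phi> z * h z) \<in> borel_measurable lborel"
        using hm borel_measurable_continuous_onI[OF c\<phi>(1)] by (intro borel_measurable_times) auto
      show "R n \<in> borel_measurable lborel" for n
      proof -
        have "(\<lambda>z. indicator D z *\<^sub>R R n z) \<in> borel_measurable borel"
          using opD by (intro borel_measurable_continuous_on_indicator cR) auto
        moreover have "(\<lambda>z. indicator D z *\<^sub>R R n z) = R n" using R0 S(2) by (auto simp: fun_eq_iff indicator_def)
        ultimately show ?thesis by simp
      qed
      show "AE z in lborel. norm (R n z) \<le> indicator S z *\<^sub>R bnd z" for n
        using R_bound R0 by (intro AE_I2) (auto simp: indicator_def)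
      show "AE z in lborel. (\<lambda>n. R n z) \<longlonglongrightarrow> \<phi> z * h z"
      proof (rule AE_I2)
        fix z
        consider "z \<notin> S" | "z \<in> S" "f z = 0" | "z \<in> S" "f z \<noteq> 0" by blast
        then show "(\<lambda>n. R n z) \<longlonglongrightarrow> \<phi> z * h z"
        proof cases
          case 1
          then show ?thesis using R0 \<phi>0 by simp
        next
          case 2
          have "R n z = \<phi> z * h z" for n
          proof -
            have "of_real ((t n)\<^sup>2) * inverse (d n z) = 1" using 2 d_nz[of n z] by (simp add: d_def)
            moreover have "h z = q z" using 2 S(2) by (auto simp: h_def N_def)
            ultimately show ?thesis using 2 by (simp add: R_def)
          qed
          then show ?thesis by simp
        next
          case 3
          have hz: "h z = 0" using 3 by (simp add: h_def N_def)
          have "(\<lambda>n. d n z) \<longlonglongrightarrow> f z * cnj (f z) + of_real (0\<^sup>2)"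
            unfolding d_def by (intro tendsto_intros t0)
          then have dl: "(\<lambda>n. inverse (d n z)) \<longlonglongrightarrow> inverse (f z * cnj (f z))"
            using 3 by (intro tendsto_inverse) auto
          have "(\<lambda>n. R n z) \<longlonglongrightarrow> q' z * (f z * (of_real (0\<^sup>2) * inverse (f z * cnj (f z)))) +
            \<phi> z * (q z * (of_real (0\<^sup>2) * inverse (f z * cnj (f z))) + f z * (of_real (0\<^sup>2) * - (inverse (f z * cnj (f z)) * dq z * inverse (f z * cnj (f z)))))"
            unfolding R_def by (intro tendsto_intros dl t0)
          then show ?thesis by (simp add: hz)
        qed
      qed
    qed
    then show "(LINT z|lborel. \<phi> z * h z) = 0" by (simp add: intR LIMSEQ_const_iff)
  qed
  then show ?thesis by eventually_elim (auto simp: h_def N_def)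
qed

section \<open>Bounded approximation of Cauchy kernels\<close>

text \<open>The contour integral is a logarithm of (finish - z) / (start - z), defined at once on
  every component of the complement of the path, whatever its topology.\<close>

lemma contour_log:
  fixes g :: "real \<Rightarrow> complex"
  assumes g: "polynomial_function g"
  shows "(\<lambda>z. contour_integral g (\<lambda>w. 1 / (w - z))) holomorphic_on - path_image g"
    and "z \<notin> path_image g \<Longrightarrow> exp (contour_integral g (\<lambda>w. 1 / (w - z))) * (pathstart g - z) = pathfinish g - z"
proof -
  have vp: "valid_path g" using g by (rule valid_path_polynomial_function)
  obtain g' where g': "polynomial_function g'" "\<And>x. (g has_vector_derivative g' x) (at x)"
    using has_vector_derivative_polynomial_function[OF g] by metis
  have "bounded (g' ` {0..1})"
    by (intro compact_imp_bounded compact_continuous_image continuous_on_polymonial_function g') auto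
  then obtain B where B: "\<And>x. x \<in> {0..1} \<Longrightarrow> norm (g' x) \<le> B" unfolding bounded_iff by blast
  have leB: "norm (vector_derivative g (at t)) \<le> B" if "t \<in> {0..1}" for t
    using B[OF that] vector_derivative_at[OF g'(2)] by simp
  have int: "((\<lambda>u. 1 / (u - w) ^ 1) has_contour_integral contour_integral g (\<lambda>u. 1 / (u - w))) g"
    if "w \<in> UNIV - path_image g" for w
    using that contour_integrable_inversediff[OF vp] has_contour_integral_integral by force
  show "(\<lambda>z. contour_integral g (\<lambda>w. 1 / (w - z))) holomorphic_on - path_image g"
  proof (rule holomorphic_onI)
    fix z assume "z \<in> - path_image g"
    then have z: "z \<in> UNIV - path_image g" by auto
    have "((\<lambda>z. contour_integral g (\<lambda>w. 1 / (w - z))) has_field_derivative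
        of_nat 1 * contour_integral g (\<lambda>u. 1 / (u - z) ^ Suc 1)) (at z)"
      by (rule Cauchy_next_derivative(2)[where f' = "\<lambda>_. 1" and k = 1, OF _ leB int _ open_UNIV vp z]) auto
    then show "(\<lambda>z. contour_integral g (\<lambda>w. 1 / (w - z))) field_differentiable (at z within - path_image g)"
      using field_differentiable_at_within field_differentiable_def by blast
  qed
  show "exp (contour_integral g (\<lambda>w. 1 / (w - z))) * (pathstart g - z) = pathfinish g - z" if z: "z \<notin> path_image g"
    using winding_number_exp_2pi[OF valid_path_imp_path[OF vp] z] winding_number_valid_path[OF vp z] by simp
qed

text \<open>The branch s of sqrt ((z - b) / (z - a)) off a path from a to b; its composition with
  (s - 1) / (s + 1) is bounded by an absolute constant since s never gets near -1.\<close>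

lemma sqrt_branch:
  fixes p :: complex
  assumes K: "open K" "connected K" and a: "a \<in> K" "norm (a - p) < \<delta>" and b0: "b0 \<in> K" "norm (b0 - p) > \<delta>"
  obtains \<Gamma> b s where "compact \<Gamma>" "\<Gamma> \<subseteq> K" "b \<in> \<Gamma>" "a \<in> \<Gamma>"
    "norm (b - p) = \<delta>" "s holomorphic_on - \<Gamma>"
    "\<And>z. z \<notin> \<Gamma> \<Longrightarrow> (s z)\<^sup>2 = (z - b) / (z - a)"
    "\<And>z. norm (z - p) \<ge> 4 * \<delta> \<Longrightarrow> Re (s z) > 0"
proof -
  have \<delta>: "\<delta> > 0" using a(2) norm_ge_zero[of "a - p"] by linarith
  obtain g where g: "polynomial_function g" "path_image g \<subseteq> K" "pathstart g = a" "pathfinish g = b0"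
    using connected_open_polynomial_connected[OF K a(1) b0(1)] by blast
  have pg: "path g" using g(1) by (simp add: path_def continuous_on_polymonial_function)
  have "pathstart g \<in> closure (cball p \<delta>)" "pathfinish g \<notin> cball p \<delta>"
    using g a b0 by (auto simp: dist_norm norm_minus_commute)
  \<comment> \<open>The path is cut at its first exit from the disc, so that \<Gamma> stays within
    distance \<delta> of \<open>p\<close> and ends exactly on the circle.\<close>
  then obtain u where u: "0 \<le> u" "u \<le> 1" "g u \<in> frontier (cball p \<delta>)"
      "path_image (subpath 0 u g) - {g u} \<subseteq> interior (cball p \<delta>)"
    using subpath_to_frontier[OF pg] by metis
  define h where "h = subpath 0 u g"
  have "polynomial_function (\<lambda>x::real. u * x)"
    by (intro polynomial_function_bounded_linear bounded_linear_mult_right)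
  then have "polynomial_function (g \<circ> (\<lambda>x. u * x))" using g(1) by (rule polynomial_function_compose)
  then have h: "polynomial_function h" by (simp add: h_def subpath_def o_def)
  define \<Gamma> where "\<Gamma> = path_image h"
  define b where "b = g u"
  have st: "pathstart h = a" "pathfinish h = b" using g(3) by (auto simp: h_def b_def pathstart_def subpath_def pathfinish_def)
  have vp: "valid_path h" using h by (rule valid_path_polynomial_function)
  have b: "norm (b - p) = \<delta>" using u(3) \<delta> by (simp add: b_def dist_norm norm_minus_commute)
  have \<Gamma>K: "\<Gamma> \<subseteq> K" using path_image_subpath_subset[of 0 u g] u g(2) by (force simp: \<Gamma>_def h_def)
  have \<Gamma>\<delta>: "\<Gamma> \<subseteq> cball p \<delta>"
  proof
    fix w assume "w \<in> \<Gamma>"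
    then consider "w = b" | "w \<in> interior (cball p \<delta>)" using u(4) by (auto simp: \<Gamma>_def h_def b_def)
    then show "w \<in> cball p \<delta>"
      by cases (use b in \<open>auto simp: dist_norm norm_minus_commute\<close>)
  qed
  have ab: "a \<in> \<Gamma>" "b \<in> \<Gamma>" using st pathstart_in_path_image[of h] pathfinish_in_path_image[of h] by (auto simp: \<Gamma>_def)
  define L where "L z = contour_integral h (\<lambda>w. 1 / (w - z))" for z
  define s where "s z = exp (L z / 2)" for z
  note cl = contour_log[OF h, folded L_def \<Gamma>_def]
  have Lh: "L holomorphic_on - \<Gamma>" using contour_log(1)[OF h] by (simp add: L_def[abs_def] \<Gamma>_def)
  have far: "Re (s z) > 0" if z: "norm (z - p) \<ge> 4 * \<delta>" for z
  proof -
    have az: "norm (z - a) \<ge> 3 * \<delta>"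
      using z a(2) norm_triangle_ineq[of "z - a" "a - p"] by simp
    then have az0: "z \<noteq> a" using \<delta> by auto
    \<comment> \<open>Seen from a far point z, the quotient (z - w) / (z - a) stays in the right
      half-plane while w runs through the disc. Hence the principal logarithm of it is a primitive
      along the path, and \<open>L z\<close> is a principal value.\<close>
    have Re_pos: "Re ((z - w) / (z - a)) > 0" if w: "w \<in> cball p \<delta>" for w
    proof -
      have "norm (a - w) \<le> 2 * \<delta>"
        using w a(2) norm_triangle_ineq[of "a - p" "p - w"] by (simp add: dist_norm)
      then have "norm (a - w) < norm (z - a)" using az \<delta> by linarith
      then have "norm ((a - w) / (z - a)) < 1" using az0 by (simp add: norm_divide)
      moreover have "(z - w) / (z - a) = 1 + (a - w) / (z - a)" using az0 by (simp add: field_simps)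
      ultimately show ?thesis
        using abs_Re_le_cmod[of "(a - w) / (z - a)"] by (simp only: plus_complex.sel one_complex.sel)
    qed
    have "((\<lambda>w. 1 / (w - z)) has_contour_integral Ln ((z - pathfinish h) / (z - a)) - Ln ((z - pathstart h) / (z - a))) h"
    proof (rule contour_integral_primitive[where S = "cball p \<delta>", OF _ vp])
      show "path_image h \<subseteq> cball p \<delta>" using \<Gamma>\<delta> by (simp add: \<Gamma>_def)
      fix w assume w: "w \<in> cball p \<delta>"
      have zw: "z \<noteq> w" using w z \<delta> by (auto simp: dist_norm norm_minus_commute)
      have "(z - w) / (z - a) \<notin> \<real>\<^sub>\<le>\<^sub>0" using Re_pos[OF w] by (auto simp: complex_nonpos_Reals_iff)
      moreover have "((\<lambda>w. (z - w) / (z - a)) has_field_derivative (0 - 1) / (z - a)) (at w within cball p \<delta>)"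
        by (intro DERIV_cdivide DERIV_diff DERIV_const DERIV_ident)
      ultimately have "((\<lambda>w. Ln ((z - w) / (z - a))) has_field_derivative
          inverse ((z - w) / (z - a)) * ((0 - 1) / (z - a))) (at w within cball p \<delta>)"
        by (intro DERIV_chain2[OF has_field_derivative_Ln])
      moreover have "inverse ((z - w) / (z - a)) * ((0 - 1) / (z - a)) = 1 / (w - z)"
        using az0 zw by (simp add: divide_simps)
      ultimately show "((\<lambda>w. Ln ((z - w) / (z - a))) has_field_derivative 1 / (w - z)) (at w within cball p \<delta>)"
        by simp
    qed
    then have "L z = Ln ((z - b) / (z - a))" using st az0 by (simp add: L_def contour_integral_unique)
    moreover have q: "Re ((z - b) / (z - a)) > 0"
      using Re_pos[of b] b by (simp add: dist_norm norm_minus_commute)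
    then have "(z - b) / (z - a) \<noteq> 0" by (metis less_irrefl zero_complex.sel(1))
    \<comment> \<open>Halving the argument makes it less than pi / 4 in modulus, so the square root
      has positive real part as well.\<close>
    ultimately have "\<bar>Im (L z)\<bar> < pi / 2"
      using q Re_Ln_pos_lt[of "(z - b) / (z - a)"] by metis
    then have "cos (Im (L z) / 2) > 0" by (intro cos_gt_zero_pi) auto
    then show ?thesis by (simp add: s_def Re_exp)
  qed
  show thesis
  proof (rule that[of \<Gamma> b s])
    show "compact \<Gamma>" unfolding \<Gamma>_def by (rule compact_path_image[OF valid_path_imp_path[OF vp]])
    show "s holomorphic_on - \<Gamma>" 
    proof -
      have "(\<lambda>z. exp (L z / 2)) holomorphic_on - \<Gamma>"
        by (intro holomorphic_on_exp' holomorphic_on_divide Lh holomorphic_on_const) simp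
      then show ?thesis by (simp add: s_def[abs_def])
    qed
    show "(s z)\<^sup>2 = (z - b) / (z - a)" if z: "z \<notin> \<Gamma>" for z
    proof -
      have "(s z)\<^sup>2 = exp (L z)" by (simp add: s_def power2_eq_square exp_add[symmetric])
      moreover have "exp (L z) * (a - z) = b - z" using cl(2)[OF z] st by simp
      then have "exp (L z) * (z - a) = z - b" by (simp add: algebra_simps)
      moreover have "z - a \<noteq> 0" using z ab by auto
      ultimately show ?thesis by (simp add: eq_divide_eq)
    qed
  qed (use \<Gamma>K ab b far in auto)
qed

text \<open>The function is (s - 1) / (s + 1). Far from \<open>p\<close> the branch s is close to 1
  and g is small; at \<open>p\<close> the pole \<open>a\<close> of s^2 is much nearer than its zero
  b, so s is large and g is close to 1. Boundedness amounts to keeping s away from -1.\<close>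

lemma ahlfors_function:
  fixes p :: complex
  assumes K: "open K" "connected K" and pK: "p \<notin> K"
    and a: "a \<in> K" "norm (a - p) < \<delta> / 2" and b0: "b0 \<in> K" "norm (b0 - p) > \<delta>"
  obtains \<Gamma> g where "compact \<Gamma>" "\<Gamma> \<subseteq> K" "g holomorphic_on - \<Gamma>" "\<And>z. z \<notin> \<Gamma> \<Longrightarrow> norm (g z) \<le> 73"
    "\<And>z. z \<notin> \<Gamma> \<Longrightarrow> norm (z - p) \<ge> 4 * \<delta> \<Longrightarrow> norm (g z) \<le> 2 * \<delta> / norm (z - p)"
    "norm (a - p) \<le> \<delta> / m\<^sup>2 \<Longrightarrow> m > 1 \<Longrightarrow> norm (1 - g p) \<le> 2 / (m - 1)"
proof -
  have \<delta>: "\<delta> > 0" using a(2) norm_ge_zero[of "a - p"] by linarith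
  have a3: "norm (a - p) < \<delta>" using a(2) \<delta> by linarith
  obtain \<Gamma> b s where \<Gamma>: "compact \<Gamma>" "\<Gamma> \<subseteq> K" "b \<in> \<Gamma>" "a \<in> \<Gamma>"
    and b: "norm (b - p) = \<delta>" and s: "s holomorphic_on - \<Gamma>"
    and s2: "\<And>z. z \<notin> \<Gamma> \<Longrightarrow> (s z)\<^sup>2 = (z - b) / (z - a)"
    and far: "\<And>z. norm (z - p) \<ge> 4 * \<delta> \<Longrightarrow> Re (s z) > 0"
    by (rule sqrt_branch[OF K a(1) a3 b0]) (rule that)
  have ab: "norm (a - b) \<ge> \<delta> / 2" "norm (a - b) \<le> 3 / 2 * \<delta>"
    using a(2) b norm_triangle_ineq[of "b - a" "a - p"] norm_triangle_ineq[of "a - p" "p - b"]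
    by (auto simp: norm_minus_commute)
  have diff: "norm (s z - 1) * norm (s z + 1) = norm (a - b) / norm (z - a)" if z: "z \<notin> \<Gamma>" for z
  proof -
    have "z \<noteq> a" using z \<Gamma> by auto
    then have "(s z - 1) * (s z + 1) = (a - b) / (z - a)"
      using s2[OF z] by (simp add: power2_eq_square algebra_simps) (simp add: field_simps)
    then show ?thesis by (metis norm_mult norm_divide)
  qed
  have low: "norm (s z + 1) \<ge> 1 / 36" if z: "z \<notin> \<Gamma>" for z
  proof (cases "norm (z - p) \<ge> 4 * \<delta>")
    case True
    then have "1 \<le> Re (s z + 1)" using far by (simp add: less_imp_le)
    then show ?thesis using complex_Re_le_cmod[of "s z + 1"] by linarith
  next
    case False
    show ?thesis
    proof (cases "norm (s z) \<le> 3")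
      case True
      have za: "norm (z - a) > 0" using z \<Gamma> by auto
      have "norm (z - a) \<le> 9 / 2 * \<delta>"
        using False a(2) norm_triangle_ineq[of "z - p" "p - a"] by (simp add: norm_minus_commute)
      \<comment> \<open>From |z - a| \<le> 9/2 \<delta> and |a - b| \<ge> \<delta> / 2 the product
        (s - 1) (s + 1) has modulus at least 1/9; as |s - 1| \<le> 4, this leaves |s + 1| \<ge>
        1/36. The bound 73 is 1 + 2 / (1/36).\<close>
      then have "1 / 9 * norm (z - a) \<le> norm (a - b)" using ab by linarith
      then have "1 / 9 \<le> norm (s z - 1) * norm (s z + 1)" unfolding diff[OF z] using za by (simp add: field_simps)
      also have "\<dots> \<le> 4 * norm (s z + 1)"
        using True norm_triangle_ineq4[of "s z" 1] by (intro mult_right_mono) auto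
      finally show ?thesis by simp
    next
      case False
      then show ?thesis using norm_triangle_ineq4[of "s z + 1" 1] by simp
    qed
  qed
  define g where "g z = (s z - 1) / (s z + 1)" for z
  have nz: "s z + 1 \<noteq> 0" if "z \<notin> \<Gamma>" for z using low[OF that] by auto
  have g1: "1 - g z = 2 / (s z + 1)" if "z \<notin> \<Gamma>" for z
    using nz[OF that] by (simp add: g_def field_simps)
  show thesis
  proof (rule that[OF \<Gamma>(1,2)])
    show "g holomorphic_on - \<Gamma>" unfolding g_def[abs_def] using nz by (intro holomorphic_intros s) auto
    show "norm (g z) \<le> 73" if z: "z \<notin> \<Gamma>" for z
    proof -
      have "norm (1 - g z) = 2 / norm (s z + 1)" using g1[OF z] by (simp add: norm_divide)
      also have "\<dots> \<le> 2 / (1 / 36)" using low[OF z] by (intro divide_left_mono) auto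
      finally show ?thesis using norm_triangle_ineq4[of 1 "1 - g z"] by simp
    qed
    show "norm (g z) \<le> 2 * \<delta> / norm (z - p)" if z: "z \<notin> \<Gamma>" "norm (z - p) \<ge> 4 * \<delta>" for z
    proof -
      have "1 \<le> Re (s z + 1)" using far[OF z(2)] by (simp add: less_imp_le)
      then have s1: "1 \<le> norm (s z + 1)" using complex_Re_le_cmod[of "s z + 1"] by linarith
      have "norm (s z - 1) / norm (s z + 1) \<le> norm (s z - 1) / 1" using s1 by (intro divide_left_mono) auto
      also have "\<dots> \<le> norm (s z - 1) * norm (s z + 1)" using s1 mult_left_mono[of 1 "norm (s z + 1)" "norm (s z - 1)"] by simp
      also have "\<dots> = norm (a - b) / norm (z - a)" by (rule diff[OF z(1)])
      also have "\<dots> \<le> 2 * \<delta> / norm (z - p)"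
      proof -
        have "norm (z - p) \<le> norm (z - a) + \<delta> / 2"
          using a(2) norm_triangle_ineq[of "z - a" "a - p"] by simp
        then have "3 / 4 * norm (z - p) \<le> norm (z - a)" "norm (z - p) > 0" using z(2) \<delta> by auto
        then have "norm (a - b) / norm (z - a) \<le> (3 / 2 * \<delta>) / (3 / 4 * norm (z - p))"
          using ab \<delta> by (intro frac_le) auto
        then show ?thesis by simp
      qed
      finally show ?thesis by (simp add: g_def norm_divide)
    qed
    show "norm (1 - g p) \<le> 2 / (m - 1)" if m: "norm (a - p) \<le> \<delta> / m\<^sup>2" "m > 1"
    proof -
      \<comment> \<open>The square of |s p| is \<delta> / |a - p|, hence at least m^2.\<close>
      have p\<Gamma>: "p \<notin> \<Gamma>" using \<Gamma> pK by auto
      have pa: "norm (p - a) > 0" using p\<Gamma> \<Gamma> by auto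
      have "(norm (s p))\<^sup>2 = norm (p - b) / norm (p - a)"
        using s2[OF p\<Gamma>] by (metis norm_divide norm_power)
      also have "\<dots> = \<delta> / norm (a - p)" using b by (simp add: norm_minus_commute)
      finally have sp: "(norm (s p))\<^sup>2 = \<delta> / norm (a - p)" .
      have "m\<^sup>2 \<le> \<delta> / norm (a - p)"
        using m pa by (simp add: norm_minus_commute field_simps)
      then have "m\<^sup>2 \<le> (norm (s p))\<^sup>2" unfolding sp .
      then have "m \<le> norm (s p)" by (rule power2_le_imp_le) simp
      then have "m - 1 \<le> norm (s p + 1)" using norm_triangle_ineq4[of "s p + 1" 1] by simp
      then have "2 / norm (s p + 1) \<le> 2 / (m - 1)" using m(2) by (intro divide_left_mono mult_pos_pos) auto
      then show ?thesis using g1[OF p\<Gamma>] by (simp add: norm_divide)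
    qed
  qed
qed

text \<open>The approximants are (g p - g z) / (z - p) for Ahlfors functions g at shrinking scales.
  They are holomorphic across p, and g p tends to 1 while g z tends to 0. The constant 146 is twice
  the bound 73 of g.\<close>

lemma cauchy_kernel_approximation:
  fixes p :: complex
  assumes K: "open K" "connected K" "K \<noteq> {}" and pK: "p \<in> closure K" "p \<notin> K"
  obtains k :: "nat \<Rightarrow> complex \<Rightarrow> complex" and \<Gamma> where
    "\<And>n. compact (\<Gamma> n)" "\<And>n. \<Gamma> n \<subseteq> K" "\<And>n. k n holomorphic_on - \<Gamma> n"
    "\<And>n z. z \<notin> K \<Longrightarrow> z \<noteq> p \<Longrightarrow> norm (k n z) \<le> 146 / norm (z - p)"
    "\<And>z. z \<notin> K \<Longrightarrow> z \<noteq> p \<Longrightarrow> (\<lambda>n. k n z) \<longlonglongrightarrow> 1 / (z - p)"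
proof -
  obtain b0 where b0: "b0 \<in> K" using K(3) by blast
  define d where "d = norm (b0 - p)"
  have d: "d > 0" using b0 pK(2) by (auto simp: d_def)
  define m where "m n = real n + 2" for n
  \<comment> \<open>The scale \<delta> tends to 0 while \<open>m\<close> tends to infinity;
    \<open>a\<close> is then taken within \<delta> / m^2 of p. As \<delta> < d, the fixed point
    \<open>b0\<close> is outside every one of the discs.\<close>
  define \<delta> where "\<delta> n = d / m n" for n
  have m: "m n > 1" "m n \<ge> 2" for n by (auto simp: m_def)
  have \<delta>: "\<delta> n > 0" "\<delta> n < d" for n using d m[of n] by (auto simp: \<delta>_def field_simps)
  have ex: "\<exists>g \<Gamma>. compact \<Gamma> \<and> \<Gamma> \<subseteq> K \<and> g holomorphic_on - \<Gamma> \<and> (\<forall>z. z \<notin> \<Gamma> \<longrightarrow> norm (g z) \<le> 73) \<and>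
    (\<forall>z. z \<notin> \<Gamma> \<longrightarrow> norm (z - p) \<ge> 4 * \<delta> n \<longrightarrow> norm (g z) \<le> 2 * \<delta> n / norm (z - p)) \<and>
    norm (1 - g p) \<le> 2 / (m n - 1)" for n
  proof -
    have "\<delta> n / (m n)\<^sup>2 > 0" using \<delta> m[of n] by simp
    then obtain a where a: "a \<in> K" "dist a p < \<delta> n / (m n)\<^sup>2" using pK(1) closure_approachable by blast
    have "(2::real)\<^sup>2 \<le> (m n)\<^sup>2" using m(2)[of n] by (intro power_mono) auto
    then have "\<delta> n / (m n)\<^sup>2 \<le> \<delta> n / 2" using \<delta>(1)[of n] m(1)[of n] by (intro divide_left_mono mult_pos_pos) auto
    then have a2: "norm (a - p) < \<delta> n / 2" "norm (a - p) \<le> \<delta> n / (m n)\<^sup>2" using a(2) unfolding dist_norm by linarith+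
    have b0': "norm (b0 - p) > \<delta> n" using \<delta>(2)[of n] by (simp add: d_def)
    show ?thesis
      by (rule ahlfors_function[OF K(1,2) pK(2) a(1) a2(1) b0 b0', of "m n"]) (use a2(2) m in blast)
  qed
  then obtain g \<Gamma> where g: "\<And>n. compact (\<Gamma> n)" "\<And>n. \<Gamma> n \<subseteq> K" "\<And>n. g n holomorphic_on - \<Gamma> n"
    "\<And>n z. z \<notin> \<Gamma> n \<Longrightarrow> norm (g n z) \<le> 73"
    "\<And>n z. z \<notin> \<Gamma> n \<Longrightarrow> norm (z - p) \<ge> 4 * \<delta> n \<Longrightarrow> norm (g n z) \<le> 2 * \<delta> n / norm (z - p)"
    "\<And>n. norm (1 - g n p) \<le> 2 / (m n - 1)" by metis
  have p\<Gamma>: "p \<notin> \<Gamma> n" for n using g(2) pK(2) by blast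
  \<comment> \<open>The derivative fills the removable singularity at p, so \<open>k n\<close> is
    holomorphic off \<Gamma> n.\<close>
  define k where "k n z = - (if z = p then deriv (g n) p else (g n z - g n p) / (z - p))" for n z
  have \<delta>0: "\<delta> \<longlonglongrightarrow> 0" unfolding \<delta>_def m_def by real_asymp
  show thesis
  proof (rule that[OF g(1,2)])
    show "k n holomorphic_on - \<Gamma> n" for n
      unfolding k_def[abs_def]
      by (intro holomorphic_on_minus pole_lemma_open g(3)) (use g(1) compact_imp_closed in auto)
    show "norm (k n z) \<le> 146 / norm (z - p)" if z: "z \<notin> K" "z \<noteq> p" for n z
    proof -
      have "norm (g n z - g n p) \<le> 73 + 73"
        using g(4)[of z n] g(4)[of p n] p\<Gamma>[of n] g(2)[of n] z norm_triangle_ineq4[of "g n z" "g n p"] by fastforce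
      then show ?thesis using z by (simp add: k_def norm_divide divide_right_mono)
    qed
    show "(\<lambda>n. k n z) \<longlonglongrightarrow> 1 / (z - p)" if z: "z \<notin> K" "z \<noteq> p" for z
    proof -
      have zp: "norm (z - p) > 0" using z by simp
      have gz: "(\<lambda>n. g n z) \<longlonglongrightarrow> 0"
      proof (rule Lim_null_comparison)
        have "\<forall>\<^sub>F n in sequentially. \<delta> n < norm (z - p) / 4" 
          using order_tendstoD(2)[OF \<delta>0, of "norm (z - p) / 4"] zp by simp
        then show "\<forall>\<^sub>F n in sequentially. norm (g n z) \<le> 2 * \<delta> n / norm (z - p)"
          by eventually_elim (use g(2,5) z in force)
        show "(\<lambda>n. 2 * \<delta> n / norm (z - p)) \<longlonglongrightarrow> 0"
          using \<delta>0 z(2) by (auto intro!: tendsto_eq_intros)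
      qed
      have gp: "(\<lambda>n. 1 - g n p) \<longlonglongrightarrow> 0"
      proof (rule Lim_null_comparison)
        show "\<forall>\<^sub>F n in sequentially. norm (1 - g n p) \<le> 2 / (m n - 1)" using g(6) by simp
        show "(\<lambda>n. 2 / (m n - 1)) \<longlonglongrightarrow> 0" unfolding m_def by real_asymp
      qed
      have "(\<lambda>n. - ((g n z - (1 - (1 - g n p))) / (z - p))) \<longlonglongrightarrow> - ((0 - (1 - 0)) / (z - p))"
        using zp by (intro tendsto_intros gz gp) auto
      then show ?thesis using z by (simp add: k_def)
    qed
  qed
qed

section \<open>Complementary components in the plane and in the Riemann sphere\<close>

lemma connectedin_riemann_sphere_Some:
  assumes "connected K"
  shows "connectedin riemann_sphere (Some ` K)"
proof -
  have "continuous_map euclidean riemann_sphere Some"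
    unfolding continuous_map_def by (auto simp: openin_riemann_sphere vimage_def)
  then show ?thesis using connectedin_continuous_map_image assms connectedin_iff_connected by blast
qed

text \<open>Adding the point at infinity merges no two planar components: a bounded one remains open
  and closed in the complement on the sphere, and there is only one unbounded one. So planar
  components inject into those of the sphere.\<close>

lemma finite_components_complement:
  assumes S: "compact S" and fc: "finitely_connected S"
  shows "finite (components (- S))"
proof -
  define T where "T = subtopology riemann_sphere (- (Some ` S))"
  have opS: "open (- S)" using S compact_imp_closed by auto
  have topT: "topspace T = - (Some ` S)" by (simp add: T_def)
  define \<Phi> where "\<Phi> K = connected_component_of_set T (Some (SOME x. x \<in> K))" for K
  have K\<Phi>: "Some ` K \<subseteq> \<Phi> K" "\<Phi> K \<in> connected_components_of T" if K: "K \<in> components (- S)" for K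
  proof -
    have x: "(SOME x. x \<in> K) \<in> K" using in_components_nonempty[OF K] by (simp add: some_in_eq)
    have KS: "K \<subseteq> - S" by (rule in_components_subset[OF K])
    have "connectedin T (Some ` K)"
      unfolding T_def using connectedin_riemann_sphere_Some[OF in_components_connected[OF K]] KS
      by (auto simp: connectedin_subtopology)
    then show "Some ` K \<subseteq> \<Phi> K" unfolding \<Phi>_def using x by (intro connected_component_of_maximal) auto
    show "\<Phi> K \<in> connected_components_of T"
      unfolding \<Phi>_def connected_component_in_connected_components_of topT using x KS by auto
  qed
  \<comment> \<open>For bounded \<open>K\<close> the set S \<union> K is compact, since the other
    components are open. Its complement is therefore a neighbourhood of infinity, and
    \<open>K\<close> is open and closed in \<open>T\<close>.\<close>
  have clopen: "\<Phi> K' \<noteq> \<Phi> K" if K: "K \<in> components (- S)" "bounded K" and K': "K' \<in> components (- S)" "K' \<noteq> K" for K K'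
  proof
    assume eq: "\<Phi> K' = \<Phi> K"
    have opK: "open K" using open_components[OF opS K(1)] .
    have KS: "K \<subseteq> - S" by (rule in_components_subset[OF K(1)])
    have "open (- S - K)"
    proof (subst open_subopen, intro ballI)
      fix x assume x: "x \<in> - S - K"
      then obtain C where C: "C \<in> components (- S)" "x \<in> C" using Union_components[of "- S"] by blast
      then have "C \<inter> K = {}" using components_nonoverlap[OF C(1) K(1)] x by blast
      then show "\<exists>T. open T \<and> x \<in> T \<and> T \<subseteq> - S - K"
        using open_components[OF opS C(1)] C(2) in_components_subset[OF C(1)] by (intro exI[of _ C]) blast
    qed
    then have opc: "open (- (S \<union> K))" by (simp add: Compl_Un Diff_eq)
    then have "compact (S \<union> K)"
      using K(2) compact_imp_bounded[OF S] by (simp add: compact_eq_bounded_closed closed_def)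
    moreover have "Some -` (- (Some ` (S \<union> K))) = - (S \<union> K)" by auto
    ultimately have o1: "openin riemann_sphere (- (Some ` (S \<union> K)))"
      using opc by (simp add: openin_riemann_sphere)
    have "Some -` (Some ` K) = K" by auto
    then have "openin riemann_sphere (Some ` K)" using opK by (auto simp: openin_riemann_sphere)
    then have "openin T (Some ` K)"
      unfolding T_def openin_subtopology using KS by (intro exI[of _ "Some ` K"]) auto
    moreover have "closedin T (Some ` K)"
      unfolding closedin_def topT
    proof
      show "Some ` K \<subseteq> - Some ` S" using KS by auto
      show "openin T (- Some ` S - Some ` K)"
        unfolding T_def openin_subtopology using o1 by (intro exI[of _ "- (Some ` (S \<union> K))"]) auto
    qed
    moreover have "connectedin T (\<Phi> K)" using K\<Phi>(2)[OF K(1)] by (rule connectedin_connected_components_of)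
    ultimately have "\<Phi> K \<subseteq> Some ` K \<or> disjnt (\<Phi> K) (Some ` K)" using connectedin_clopen_cases by blast
    moreover have "Some ` K \<subseteq> \<Phi> K" "K \<noteq> {}" using K\<Phi>(1)[OF K(1)] in_components_nonempty[OF K(1)] by auto
    ultimately have "\<Phi> K \<subseteq> Some ` K" by (auto simp: disjnt_def)
    then have "Some ` K' \<subseteq> Some ` K" using K\<Phi>(1)[OF K'(1)] eq by auto
    then have "K' \<inter> K \<noteq> {}" using in_components_nonempty[OF K'(1)] by auto
    then show False using components_nonoverlap[OF K'(1) K(1)] K'(2) by blast
  qed
  have "inj_on \<Phi> (components (- S))"
  proof (rule inj_onI)
    fix K K' assume K: "K \<in> components (- S)" and K': "K' \<in> components (- S)" and eq: "\<Phi> K = \<Phi> K'"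
    show "K = K'"
    proof (rule ccontr)
      assume ne: "K \<noteq> K'"
      have "\<not> bounded K" "\<not> bounded K'"
        using clopen[of K K'] clopen[of K' K] K K' ne eq by auto
      then show False
        using cobounded_unique_unbounded_components[of "- S" K K'] compact_imp_bounded[OF S] K K' ne by simp
    qed
  qed
  moreover have "\<Phi> ` components (- S) \<subseteq> connected_components_of T" using K\<Phi>(2) by blast
  moreover have "finite (connected_components_of T)" using fc by (simp add: finitely_connected_def T_def)
  ultimately show ?thesis using inj_on_finite by blast
qed

text \<open>Closure commutes with finite unions. With infinitely many components a point of
  \<open>S\<close> could be approached only by passing through ever new ones.\<close>

lemma in_closure_of_component:
  assumes S: "compact S" and fc: "finitely_connected S" and int: "interior S = {}" and p: "p \<in> S"
  obtains K where "K \<in> components (- S)" "p \<in> closure K"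
proof -
  have "p \<in> closure (- S)" using int by (simp add: closure_complement)
  also have "\<dots> = closure (\<Union>(components (- S)))" by simp
  also have "\<dots> = (\<Union>K\<in>components (- S). closure K)"
    using finite_components_complement[OF S fc] by (induction rule: finite_induct) auto
  finally show thesis using that by blast
qed

section \<open>Measures annihilating the algebra\<close>

context weighted_points
begin

lemma integrable_continuous:
  assumes f: "continuous_on (cball 0 r) f"
  shows "integrable M (\<lambda>\<omega>. c \<omega> * f (x \<omega>))"
proof -
  define g where "g z = indicator (cball 0 r) z *\<^sub>R f z" for z
  have gm [measurable]: "g \<in> borel_measurable borel"
    unfolding g_def[abs_def] by (intro borel_measurable_continuous_on_indicator f) auto
  have "bounded (f ` cball 0 r)" by (intro compact_imp_bounded compact_continuous_image f compact_cball)
  then obtain b where b: "\<And>z. z \<in> cball 0 r \<Longrightarrow> norm (f z) \<le> b" unfolding bounded_iff by blast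
  have eq: "c \<omega> * f (x \<omega>) = c \<omega> * g (x \<omega>)" for \<omega>
    using supp[of \<omega>] by (cases "c \<omega> = 0") (auto simp: g_def)
  have "norm (c \<omega> * g (x \<omega>)) \<le> norm (\<bar>b\<bar> * norm (c \<omega>))" for \<omega>
  proof (cases "x \<omega> \<in> cball 0 r")
    case True
    then have "norm (g (x \<omega>)) \<le> \<bar>b\<bar>" using b[OF True] by (simp add: g_def)
    then have "norm (g (x \<omega>)) * norm (c \<omega>) \<le> \<bar>b\<bar> * norm (c \<omega>)" by (rule mult_right_mono) simp
    then show ?thesis by (simp add: norm_mult abs_mult mult.commute)
  qed (simp add: g_def)
  note bound = this
  show ?thesis
    unfolding eq
  proof (rule Bochner_Integration.integrable_bound)
    show "integrable M (\<lambda>\<omega>. \<bar>b\<bar> * norm (c \<omega>))" using c by (intro integrable_mult_right integrable_norm)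
    show "(\<lambda>\<omega>. c \<omega> * g (x \<omega>)) \<in> borel_measurable M" by measurable
    show "AE \<omega> in M. norm (c \<omega> * g (x \<omega>)) \<le> norm (\<bar>b\<bar> * norm (c \<omega>))" by (intro AE_I2 bound)
  qed
qed

lemma annihilates_poly_closure:
  assumes F: "continuous_on (cball 0 r) F"
    and ann: "\<And>p. hol_polynomial p \<Longrightarrow> (LINT \<omega>|M. c \<omega> * p (vector [x \<omega>, F (x \<omega>)] :: complex ^ 2)) = 0"
    and k: "k \<in> poly_closure (graph_on (cball 0 r) F)"
    and kc: "continuous_on (cball 0 r) (\<lambda>z. k (vector [z, F z]))"
  shows "(LINT \<omega>|M. c \<omega> * k (vector [x \<omega>, F (x \<omega>)])) = 0"
proof -
  let ?v = "\<lambda>z. vector [z, F z] :: complex ^ 2"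
  define I where "I = (LINT \<omega>|M. norm (c \<omega>))"
  have I: "I \<ge> 0" unfolding I_def by (rule integral_nonneg_AE) auto
  have ki: "integrable M (\<lambda>\<omega>. c \<omega> * k (?v (x \<omega>)))" by (rule integrable_continuous[OF kc])
  have "norm (LINT \<omega>|M. c \<omega> * k (?v (x \<omega>))) \<le> 0 + e" if e: "e > 0" for e
  proof -
    have e': "e / (I + 1) > 0" using e I by simp
    obtain p where p: "hol_polynomial p" "\<And>y. y \<in> graph_on (cball 0 r) F \<Longrightarrow> norm (k y - p y) < e / (I + 1)"
      using poly_closureD[OF k e'] by blast
    have "continuous_on (cball 0 r) ?v" by (rule continuous_on_graph_map[OF F])
    then have pc: "continuous_on (cball 0 r) (\<lambda>z. p (?v z))"
      using continuous_on_compose2[OF continuous_on_hol_polynomial[OF p(1), of UNIV]] by auto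
    have pi: "integrable M (\<lambda>\<omega>. c \<omega> * p (?v (x \<omega>)))" by (rule integrable_continuous[OF pc])
    have "(LINT \<omega>|M. c \<omega> * k (?v (x \<omega>))) = (LINT \<omega>|M. c \<omega> * k (?v (x \<omega>)) - c \<omega> * p (?v (x \<omega>)))"
      using Bochner_Integration.integral_diff[OF ki pi] ann[OF p(1)] by simp
    also have "norm \<dots> \<le> (LINT \<omega>|M. e / (I + 1) * norm (c \<omega>))"
    proof (rule order_trans[OF integral_norm_bound integral_mono])
      show "integrable M (\<lambda>\<omega>. norm (c \<omega> * k (?v (x \<omega>)) - c \<omega> * p (?v (x \<omega>))))"
        using ki pi by (intro integrable_norm Bochner_Integration.integrable_diff)
      show "integrable M (\<lambda>\<omega>. e / (I + 1) * norm (c \<omega>))" using c by (intro integrable_mult_right integrable_norm)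
      show "norm (c \<omega> * k (?v (x \<omega>)) - c \<omega> * p (?v (x \<omega>))) \<le> e / (I + 1) * norm (c \<omega>)" for \<omega>
      proof (cases "c \<omega> = 0")
        case False
        then have "?v (x \<omega>) \<in> graph_on (cball 0 r) F" using supp by (auto simp: graph_on_def)
        then have "norm (k (?v (x \<omega>)) - p (?v (x \<omega>))) \<le> e / (I + 1)" using p(2) less_imp_le by blast
        then have "norm (c \<omega>) * norm (k (?v (x \<omega>)) - p (?v (x \<omega>))) \<le> norm (c \<omega>) * (e / (I + 1))"
          by (rule mult_left_mono) simp
        then show ?thesis by (simp add: right_diff_distrib[symmetric] norm_mult mult.commute)
      qed simp
    qed
    also have "\<dots> = e / (I + 1) * I" unfolding I_def by (rule integral_mult_right_zero)
    also have "\<dots> \<le> e" using I e by (simp add: field_simps)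
    finally show ?thesis by simp
  qed
  then have "norm (LINT \<omega>|M. c \<omega> * k (?v (x \<omega>))) \<le> 0" by (rule field_le_epsilon)
  then show ?thesis by simp
qed

end

section \<open>Vanishing Cauchy integrals of an annihilating density\<close>

lemma AE_not_sphere: "AE z::complex in lborel. norm z \<noteq> r"
proof -
  have "sphere (0::complex) r \<in> null_sets lebesgue"
    using negligible_sphere negligible_iff_null_sets by blast
  then have "emeasure lborel (sphere (0::complex) r) = 0"
    by (simp add: null_sets_def)
  then show ?thesis
    by (intro AE_I'[of "sphere 0 r"]) (auto simp: null_sets_def)
qed

text \<open>The kernels are centred at points \<xi> n off \<open>E\<close>, where for fixed t they
  are bounded uniformly in n; the singular kernel at \<zeta> is met only in the second limit, where
  \<open>int\<close> provides the dominating function.\<close>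

lemma cauchy_integral_zero:
  fixes F A :: "complex \<Rightarrow> complex" and E :: "complex set"
  assumes r: "r > 0" and F: "continuous_on (cball 0 r) F" and Fw: "wirtinger (ball 0 r) F p q"
    and qb: "\<And>z. z \<in> ball 0 r \<Longrightarrow> norm (q z) \<le> Bq"
    and E: "nowhere_dense E"
    and A: "A \<in> hol_on_closed (cball 0 r)" and A0: "\<forall>z\<in>cball 0 r. A z \<noteq> 0"
    and M: "M > 0" and \<nu>: "\<nu> \<ge> 1"
    and main: "\<forall>\<zeta>\<in>cball 0 r - E.
           \<exists>G \<in> hol_on_closed_zero (cball 0 r) \<zeta>. \<exists>C :: complex.
             (\<forall>z\<in>cball 0 r - {\<zeta>}. inverse (norm (z - \<zeta>)) * norm (G z) \<le> M) \<and>
             norm C = 1 \<and>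
             (\<forall>z\<in>cball 0 r. C * (z - \<zeta>) * (A z * F z - A \<zeta> * F \<zeta> + G z)
                \<in> {w. Re w \<ge> 0 \<and> \<bar>Im w\<bar> \<le> K * Re w powr (1 / \<nu>)})"
    and h: "weighted_points lborel h (\<lambda>z. z) r"
    and h0: "AE z in lborel. z \<in> ball 0 r \<longrightarrow> q z = 0 \<longrightarrow> h z = 0"
    and ann: "\<And>p. hol_polynomial p \<Longrightarrow> (LINT z|lborel. h z * p (vector [z, F z] :: complex ^ 2)) = 0"
    and \<zeta>: "\<zeta> \<in> ball 0 r" and int: "integrable lborel (\<lambda>z. h z / (z - \<zeta>))"
  shows "(LINT z|lborel. h z / (z - \<zeta>)) = 0"
proof -
  interpret weighted_points lborel h "\<lambda>z. z" r by (rule h)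
  let ?D = "cball (0::complex) r"
  let ?v = "\<lambda>z. vector [z, F z] :: complex ^ 2"
  obtain U where U: "open U" "?D \<subseteq> U" "A holomorphic_on U"
    using A unfolding hol_on_closed_def by blast
  have contA: "continuous_on ?D A"
    using U by (meson continuous_on_subset holomorphic_on_imp_continuous_on)
  have contAF: "continuous_on ?D (\<lambda>z. A z * F z)" by (intro continuous_on_mult contA F)
  have "bounded ((\<lambda>z. A z * F z) ` ?D)" by (intro compact_imp_bounded compact_continuous_image contAF compact_cball)
  then obtain b0 where b0: "\<And>z. z \<in> ?D \<Longrightarrow> norm (A z * F z) \<le> b0" unfolding bounded_iff by blast
  have "bounded (A ` ?D)" by (intro compact_imp_bounded compact_continuous_image contA compact_cball)
  then obtain bA where bA: "\<And>z. z \<in> ?D \<Longrightarrow> norm (A z) \<le> bA" unfolding bounded_iff by blast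
  have hm: "h \<in> borel_measurable borel" using c by auto

  have "\<exists>\<xi>. \<xi> \<in> ball 0 r - E \<and> dist \<zeta> \<xi> < 1 / real (Suc n)" for n
    using nowhere_dense_approx[OF E r, of \<zeta> "1 / real (Suc n)"] \<zeta> by (metis ball_subset_cball of_nat_0_less_iff subsetD zero_less_Suc zero_less_divide_1_iff)
  then obtain \<xi>0 where \<xi>0: "\<And>n. \<xi>0 n \<in> ball 0 r - E" "\<And>n. dist \<zeta> (\<xi>0 n) < 1 / real (Suc n)" by metis
  have \<xi>0lim: "\<xi>0 \<longlonglongrightarrow> \<zeta>"
  proof (rule metric_LIMSEQ_I)
    fix e :: real assume "e > 0"
    then obtain N where N: "1 / real (Suc N) < e" using nat_approx_posE by blast
    have "dist (\<xi>0 n) \<zeta> < e" if "n \<ge> N" for n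
    proof -
      have "1 / real (Suc n) \<le> 1 / real (Suc N)" using that by (intro divide_left_mono) auto
      then show ?thesis using \<xi>0(2)[of n] N by (simp add: dist_commute)
    qed
    then show "\<exists>N. \<forall>n\<ge>N. dist (\<xi>0 n) \<zeta> < e" by blast
  qed
  define Q where "Q n G C \<longleftrightarrow> G \<in> hol_on_closed_zero ?D (\<xi>0 n) \<and>
      (\<forall>z\<in>?D - {\<xi>0 n}. inverse (norm (z - \<xi>0 n)) * norm (G z) \<le> M) \<and> norm C = 1 \<and>
      (\<forall>z\<in>?D. C * (z - \<xi>0 n) * (A z * F z - A (\<xi>0 n) * F (\<xi>0 n) + G z)
                \<in> {w. Re w \<ge> 0 \<and> \<bar>Im w\<bar> \<le> K * Re w powr (1 / \<nu>)})" for n G and C :: complex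
  have "\<exists>G C. Q n G C" for n
  proof -
    have "\<xi>0 n \<in> ?D - E" using \<xi>0(1)[of n] by auto
    then show ?thesis using main unfolding Q_def by blast
  qed
  then obtain G0 C0 where Q: "\<And>n. Q n (G0 n) (C0 n)" by metis
  have GC: "\<And>n. G0 n \<in> hol_on_closed_zero ?D (\<xi>0 n)"
      "\<And>n z. z \<in> ?D - {\<xi>0 n} \<Longrightarrow> inverse (norm (z - \<xi>0 n)) * norm (G0 n z) \<le> M" "\<And>n. norm (C0 n :: complex) = 1"
      "\<And>n z. z \<in> ?D \<Longrightarrow> C0 n * (z - \<xi>0 n) * (A z * F z - A (\<xi>0 n) * F (\<xi>0 n) + G0 n z)
                \<in> {w. Re w \<ge> 0 \<and> \<bar>Im w\<bar> \<le> K * Re w powr (1 / \<nu>)}"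
    using Q unfolding Q_def by blast+
  \<comment> \<open>One bound for all the functions \<open>G0 n\<close> on the disc: this is the
    normality that the uniform constant \<open>M\<close> buys.\<close>
  have G0b: "norm (G0 n z) \<le> M * (2 * r)" if z: "z \<in> ?D" for n z
  proof (cases "z = \<xi>0 n")
    case True
    then show ?thesis using GC(1)[of n] M r by (simp add: hol_on_closed_zero_def)
  next
    case False
    then have "inverse (norm (z - \<xi>0 n)) * norm (G0 n z) \<le> M" using GC(2)[of z n] z by blast
    then have "norm (G0 n z) \<le> M * norm (z - \<xi>0 n)" using False by (simp add: field_simps)
    moreover have "norm (z - \<xi>0 n) \<le> 2 * r"
      using norm_triangle_ineq4[of z "\<xi>0 n"] z \<xi>0(1)[of n] by auto
    then have "M * norm (z - \<xi>0 n) \<le> M * (2 * r)" using M by (intro mult_left_mono) auto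
    ultimately show ?thesis by linarith
  qed
  \<comment> \<open>First a subsequence along which the unimodular constants converge, then within
    it one along which the holomorphic functions converge in the open disc.\<close>
  obtain l r1 where l: "l \<in> sphere (0::complex) 1" "strict_mono r1" "(C0 \<circ> r1) \<longlonglongrightarrow> l"
    using compact_sphere[of "0::complex" 1] GC(3) unfolding compact_def by (metis dist_0_norm mem_sphere)
  obtain g r2 where g: "g holomorphic_on ball 0 r" "strict_mono (r2 :: nat \<Rightarrow> nat)"
    "\<And>z. z \<in> ball 0 r \<Longrightarrow> (\<lambda>n. G0 (r1 (r2 n)) z) \<longlonglongrightarrow> g z"
  proof (rule Montel[of "ball (0::complex) r" "{f. f holomorphic_on ball 0 r \<and> (\<forall>z\<in>ball 0 r. norm (f z) \<le> M * (2 * r))}" "\<lambda>n. G0 (r1 n)"])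
    show "range (\<lambda>n. G0 (r1 n)) \<subseteq> {f. f holomorphic_on ball 0 r \<and> (\<forall>z\<in>ball 0 r. norm (f z) \<le> M * (2 * r))}"
    proof safe
      fix n
      obtain V where "?D \<subseteq> V" "G0 (r1 n) holomorphic_on V"
        using GC(1)[of "r1 n"] by (auto simp: hol_on_closed_zero_def hol_on_closed_def)
      then show "G0 (r1 n) holomorphic_on ball 0 r"
        using ball_subset_cball by (meson holomorphic_on_subset order_trans)
      show "norm (G0 (r1 n) z) \<le> M * (2 * r)" if "z \<in> ball 0 r" for z
        using G0b that ball_subset_cball by blast
    qed
    show "\<exists>B. \<forall>f\<in>{f. f holomorphic_on ball 0 r \<and> (\<forall>z\<in>ball 0 r. norm (f z) \<le> M * (2 * r))}. \<forall>z\<in>L. norm (f z) \<le> B"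
      if "L \<subseteq> ball 0 r" for L
      using that by (intro exI[of _ "M * (2 * r)"]) blast
    fix g and r2 :: "nat \<Rightarrow> nat"
    assume "g holomorphic_on ball 0 r" "strict_mono r2"
      "\<And>x. x \<in> ball 0 r \<Longrightarrow> (\<lambda>n. G0 (r1 (r2 n)) x) \<longlonglongrightarrow> g x"
    then show thesis by (rule that)
  qed auto
  define \<sigma> where "\<sigma> n = r1 (r2 n)" for n
  have \<sigma>: "strict_mono \<sigma>" using l(2) g(2) by (auto simp: \<sigma>_def strict_mono_def)
  define \<xi> G C where "\<xi> n = \<xi>0 (\<sigma> n)" and "G n = G0 (\<sigma> n)" and "C n = C0 (\<sigma> n)" for n
  have \<xi>lim: "\<xi> \<longlonglongrightarrow> \<zeta>"
    using LIMSEQ_subseq_LIMSEQ[OF \<xi>0lim \<sigma>] by (simp add: \<xi>_def[abs_def] o_def)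
  have Clim: "C \<longlonglongrightarrow> l"
    using LIMSEQ_subseq_LIMSEQ[OF l(3) g(2)] by (simp add: C_def[abs_def] \<sigma>_def o_def)
  have Glim: "(\<lambda>n. G n z) \<longlonglongrightarrow> g z" if "z \<in> ball 0 r" for z
    using g(3)[OF that] by (simp add: G_def \<sigma>_def)
  have \<xi>D: "\<xi> n \<in> ball 0 r" for n using \<xi>0(1) by (auto simp: \<xi>_def)
  have C1: "norm (C n) = 1" "C n \<noteq> 0" for n using GC(3)[of "\<sigma> n"] by (auto simp: C_def)
  have l1: "norm l = 1" "l \<noteq> 0" using l(1) by auto
  have Ghol: "G n \<in> hol_on_closed ?D" for n using GC(1) by (auto simp: G_def hol_on_closed_zero_def)

  define fn where "fn n z = A z * F z - A (\<xi> n) * F (\<xi> n) + G n z" for n z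
  define Hn where "Hn n z = C n * (z - \<xi> n) * fn n z" for n z
  define f where "f z = A z * F z - A \<zeta> * F \<zeta> + g z" for z
  define H where "H z = l * (z - \<zeta>) * f z" for z
  have cone: "Re (Hn n z) \<ge> 0" "\<bar>Im (Hn n z)\<bar> \<le> K * Re (Hn n z) powr (1 / \<nu>)" if "z \<in> ?D" for n z
    using GC(4)[OF that, of "\<sigma> n"] by (auto simp: Hn_def fn_def \<xi>_def G_def C_def)
  have AFlim: "(\<lambda>n. A (\<xi> n) * F (\<xi> n)) \<longlonglongrightarrow> A \<zeta> * F \<zeta>"
    by (rule continuous_on_tendsto_compose[OF contAF \<xi>lim]) (use \<zeta> \<xi>D in \<open>auto simp: less_imp_le\<close>)
  have fnlim: "(\<lambda>n. fn n z) \<longlonglongrightarrow> f z" if "z \<in> ball 0 r" for z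
    unfolding fn_def f_def by (intro tendsto_intros AFlim Glim that)
  have Hnlim: "(\<lambda>n. Hn n z) \<longlonglongrightarrow> H z" if "z \<in> ball 0 r" for z
    unfolding Hn_def H_def by (intro tendsto_intros Clim \<xi>lim fnlim that)
  have ReH: "Re (H z) \<ge> 0" if "z \<in> ball 0 r" for z
    by (rule tendsto_lowerbound[OF tendsto_Re[OF Hnlim[OF that]]])
       (use cone(1) that in \<open>auto simp: less_imp_le\<close>)
  \<comment> \<open>The limit inherits the inequality defining the region, and the region meets the
    imaginary axis only at 0, because 0 powr (1/\<nu>) is 0.\<close>
  have H_pos: "Re (H z) > 0" if z: "z \<in> ball 0 r" and nz: "H z \<noteq> 0" for z
  proof (rule ccontr)
    assume "\<not> Re (H z) > 0"
    then have Re0: "Re (H z) = 0" using ReH[OF z] by simp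
    have lim1: "(\<lambda>n. K * Re (Hn n z) powr (1 / \<nu>)) \<longlonglongrightarrow> K * Re (H z) powr (1 / \<nu>)"
      by (intro tendsto_mult tendsto_const tendsto_powr' tendsto_Re Hnlim z)
         (use \<nu> cone(1) z in \<open>auto simp: less_imp_le\<close>)
    have lim2: "(\<lambda>n. \<bar>Im (Hn n z)\<bar>) \<longlonglongrightarrow> \<bar>Im (H z)\<bar>" by (intro tendsto_intros Hnlim z)
    have "\<bar>Im (H z)\<bar> \<le> K * Re (H z) powr (1 / \<nu>)"
      by (rule LIMSEQ_le[OF lim2 lim1]) (use cone(2) z in \<open>auto simp: less_imp_le\<close>)
    then have "Im (H z) = 0" using Re0 by simp
    then show False using Re0 nz by (simp add: complex_eq_iff)
  qed
  \<comment> \<open>The derivative of \<open>f\<close> with respect to the conjugate variable is A q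
    and \<open>A\<close> has no zeros, so almost every zero of \<open>f\<close> is a zero of
    \<open>q\<close>, where \<open>h\<close> vanishes by \<open>h0\<close>.\<close>
  have AE_zero: "AE z in lborel. z \<in> ball 0 r \<longrightarrow> f z = 0 \<longrightarrow> h z = 0"
  proof -
    have Aw: "wirtinger (ball 0 r) A (deriv A) (\<lambda>_. 0)"
      using U(2) ball_subset_cball
      by (intro wirtinger_holomorphic open_ball holomorphic_on_subset[OF U(3)]) (rule order_trans)
    have fw: "wirtinger (ball 0 r) f
       (\<lambda>z. (deriv A z * F z + A z * p z + 0) + deriv g z) (\<lambda>z. (0 * F z + A z * q z + 0) + 0)"
      using wirtinger_add[OF wirtinger_add[OF wirtinger_mult[OF Aw Fw] wirtinger_const[of "ball 0 r" "- (A \<zeta> * F \<zeta>)"]]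
          wirtinger_holomorphic[OF open_ball g(1)]]
      by (simp add: f_def[abs_def])
    have "AE z in lborel. z \<in> ball 0 r \<longrightarrow> f z = 0 \<longrightarrow> (0 * F z + A z * q z + 0) + 0 = 0"
    proof (rule dbar_zero_on_zero_set[OF fw bounded_ball])
      fix z assume z: "z \<in> ball (0::complex) r"
      then have "norm (A z) \<le> bA" "norm (q z) \<le> Bq" using bA[of z] qb[of z] by auto
      moreover from this have "0 \<le> bA" using norm_ge_zero[of "A z"] by linarith
      ultimately have "norm (A z) * norm (q z) \<le> bA * Bq" by (intro mult_mono) auto
      then show "norm ((0 * F z + A z * q z + 0) + 0) \<le> bA * Bq" by (simp add: norm_mult)
    qed
    then show ?thesis
      using h0
    proof eventually_elim
      case (elim z)
      then show ?case using A0 by (auto simp: less_imp_le)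
    qed
  qed
  have AE_D: "AE z in lborel. z \<notin> ball 0 r \<longrightarrow> h z = 0"
    using AE_not_sphere[of r]
  proof eventually_elim
    case (elim z)
    then show ?case using supp[of z] by force
  qed
  have cf: "continuous_on (ball 0 r) f"
    unfolding f_def[abs_def]
    by (intro continuous_intros continuous_on_subset[OF contAF ball_subset_cball] holomorphic_on_imp_continuous_on g(1))
  have cH: "continuous_on (ball 0 r) H"
    unfolding H_def[abs_def] by (intro continuous_intros cf)

  define Et where "Et t z = indicator (ball 0 r) z *\<^sub>R (1 - exp (- of_real t * H z))" for t :: real and z
  have Etm: "Et t \<in> borel_measurable borel" for t
    unfolding Et_def[abs_def] by (intro borel_measurable_continuous_on_indicator continuous_intros cH) auto
  have kernel_measurable: "(\<lambda>z. h z * (Et t z / (z - \<zeta>))) \<in> borel_measurable lborel" for t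
    using hm Etm[of t] by measurable

  \<comment> \<open>The entire function (exp w - 1) / w. It exhibits (1 - exp (-t H)) / (z - \<xi>)
    as C t f times \<psi> at -t H, a member of the algebra in which no division by z - \<xi> is
    left.\<close>
  define \<psi> where "\<psi> w = (if w = 0 then deriv exp 0 else (exp w - exp 0) / (w - 0))" for w :: complex
  have \<psi>hol: "\<psi> holomorphic_on UNIV"
    unfolding \<psi>_def[abs_def] by (rule pole_lemma_open) (auto intro: holomorphic_intros)
  have \<psi>eq: "w * \<psi> w = exp w - 1" for w by (simp add: \<psi>_def)
  have X: "compact (graph_on ?D F)" by (intro compact_graph_on compact_cball F)
  have step: "(LINT z|lborel. h z * (Et t z / (z - \<zeta>))) = 0" for t :: real
  proof -
    define k where "k n z = C n * fn n z * of_real t * \<psi> (- of_real t * Hn n z)" for n z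
    have fc: "continuous_on ?D (fn n)" for n
    proof -
      obtain V where "?D \<subseteq> V" "G n holomorphic_on V" using Ghol[of n] by (auto simp: hol_on_closed_def)
      then have "continuous_on ?D (G n)" by (meson continuous_on_subset holomorphic_on_imp_continuous_on)
      then show ?thesis unfolding fn_def[abs_def] by (intro continuous_intros contAF)
    qed
    have Hc: "continuous_on ?D (Hn n)" for n unfolding Hn_def[abs_def] by (intro continuous_intros fc)
    have kc: "continuous_on ?D (k n)" for n
      unfolding k_def[abs_def]
      by (intro continuous_intros fc Hc continuous_on_compose2[OF holomorphic_on_imp_continuous_on[OF \<psi>hol]]) auto
    have k0: "(LINT z|lborel. h z * k n z) = 0" for n
    proof -
      define fy where "fy = (\<lambda>y :: complex ^ 2. A (y $ 1) * y $ 2 - A (\<xi> n) * F (\<xi> n) + G n (y $ 1))"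
      define Hy where "Hy = (\<lambda>y :: complex ^ 2. C n * (y $ 1 - \<xi> n) * fy y)"
      define ky where "ky = (\<lambda>y. C n * fy y * of_real t * \<psi> (- of_real t * Hy y))"
      have n1: "norm (y $ 1) \<le> r" if "y \<in> graph_on ?D F" for y
        using that by (auto simp: graph_on_def vector_2_nth)
      have fP: "fy \<in> poly_closure (graph_on ?D F)"
        unfolding fy_def
        by (intro poly_closure_add poly_closure_diff poly_closure_mult poly_closure_const
            poly_closure_proj poly_closure_hol_on_closed[OF X A] poly_closure_hol_on_closed[OF X Ghol] X n1)
      have HP: "Hy \<in> poly_closure (graph_on ?D F)"
        unfolding Hy_def by (intro poly_closure_diff poly_closure_mult poly_closure_const poly_closure_proj X fP)
      have "ky \<in> poly_closure (graph_on ?D F)"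
        unfolding ky_def
        by (intro poly_closure_mult poly_closure_const X fP
            poly_closure_entire[OF X poly_closure_mult[OF X poly_closure_const HP] \<psi>hol])
      moreover have eq: "ky (?v z) = k n z" for z
        by (simp add: ky_def Hy_def fy_def k_def Hn_def fn_def vector_2_nth)
      ultimately show ?thesis
        using annihilates_poly_closure[OF F ann, of ky] kc[of n] by simp
    qed
    \<comment> \<open>With t fixed, \<open>b1\<close> bounds all \<open>fn n\<close>, so all
      \<open>Hn n\<close> lie in one disc and \<psi> is evaluated on one compact set.\<close>
    define b1 where "b1 = 2 * b0 + M * (2 * r)"
    have fb: "norm (fn n z) \<le> b1" if z: "z \<in> ?D" for n z
    proof -
      have "norm (fn n z) \<le> norm (A z * F z) + norm (A (\<xi> n) * F (\<xi> n)) + norm (G n z)"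
        unfolding fn_def using norm_triangle_ineq[of "A z * F z - A (\<xi> n) * F (\<xi> n)" "G n z"]
          norm_triangle_ineq4[of "A z * F z" "A (\<xi> n) * F (\<xi> n)"] by linarith
      moreover have "norm (A (\<xi> n) * F (\<xi> n)) \<le> b0" using \<xi>D[of n] by (intro b0) auto
      moreover have "norm (G n z) \<le> M * (2 * r)" using G0b[OF z] by (simp add: G_def)
      ultimately show ?thesis using b0[OF z] by (simp add: b1_def)
    qed
    have Hb: "norm (Hn n z) \<le> 2 * r * b1" if z: "z \<in> ?D" for n z
    proof -
      have "norm (z - \<xi> n) \<le> 2 * r" using norm_triangle_ineq4[of z "\<xi> n"] z \<xi>D[of n] by auto
      then have "norm (z - \<xi> n) * norm (fn n z) \<le> 2 * r * b1" using fb[OF z] r by (intro mult_mono) auto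
      then show ?thesis using C1 by (simp add: Hn_def norm_mult)
    qed
    have "bounded (\<psi> ` cball 0 (\<bar>t\<bar> * (2 * r * b1)))"
      by (intro compact_imp_bounded compact_continuous_image compact_cball
          continuous_on_subset[OF holomorphic_on_imp_continuous_on[OF \<psi>hol]]) auto
    then obtain b2 where b2: "\<And>w. w \<in> cball 0 (\<bar>t\<bar> * (2 * r * b1)) \<Longrightarrow> norm (\<psi> w) \<le> b2"
      unfolding bounded_iff by blast
    have kb: "norm (k n z) \<le> b1 * \<bar>t\<bar> * b2" if z: "z \<in> ?D" for n z
    proof -
      have "norm (\<psi> (- of_real t * Hn n z)) \<le> b2"
        using Hb[OF z, of n] by (intro b2) (simp add: norm_mult mult_left_mono)
      moreover have "0 \<le> b1" using fb[OF z, of n] norm_ge_zero order_trans by blast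
      ultimately have "norm (fn n z) * \<bar>t\<bar> * norm (\<psi> (- of_real t * Hn n z)) \<le> b1 * \<bar>t\<bar> * b2"
        using fb[OF z, of n] by (intro mult_mono) auto
      then show ?thesis using C1 by (simp add: k_def norm_mult)
    qed
    have keq: "k n z = (1 - exp (- of_real t * Hn n z)) / (z - \<xi> n)" if "z \<noteq> \<xi> n" for n z
    proof -
      have "(z - \<xi> n) * k n z = - (- of_real t * Hn n z * \<psi> (- of_real t * Hn n z))"
        by (simp add: k_def Hn_def)
      also have "\<dots> = 1 - exp (- of_real t * Hn n z)" unfolding \<psi>eq by simp
      finally show ?thesis using that by (simp add: eq_divide_eq mult.commute)
    qed
    have "(\<lambda>n. LINT z|lborel. h z * k n z) \<longlonglongrightarrow>
        (LINT z|lborel. h z * (Et t z / (z - \<zeta>)))"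
    proof (rule integral_dominated_convergence)
      show "(\<lambda>z. h z * (Et t z / (z - \<zeta>))) \<in> borel_measurable lborel"
        by (rule kernel_measurable)
      show "(\<lambda>z. h z * k n z) \<in> borel_measurable lborel" for n
        by (rule borel_measurable_integrable[OF integrable_continuous[OF kc]])
      show "integrable lborel (\<lambda>z. (b1 * \<bar>t\<bar> * b2) * norm (h z))" using c by (intro integrable_mult_right integrable_norm)
      show "AE z in lborel. norm (h z * k n z) \<le> (b1 * \<bar>t\<bar> * b2) * norm (h z)" for n
      proof (rule AE_I2)
        fix z
        show "norm (h z * k n z) \<le> (b1 * \<bar>t\<bar> * b2) * norm (h z)"
        proof (cases "h z = 0")
          case False
          then have "norm (k n z) * norm (h z) \<le> (b1 * \<bar>t\<bar> * b2) * norm (h z)"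
            using supp[of z] by (intro mult_right_mono kb) auto
          then show ?thesis by (simp add: norm_mult mult.commute)
        qed simp
      qed
      show "AE z in lborel. (\<lambda>n. h z * k n z) \<longlonglongrightarrow> h z * (Et t z / (z - \<zeta>))"
        using AE_D AE_lborel_singleton[of \<zeta>]
      proof eventually_elim
        case (elim z)
        show ?case
        proof (cases "z \<in> ball 0 r")
          case True
          have "\<forall>\<^sub>F n in sequentially. \<xi> n \<noteq> z"
            using tendsto_imp_eventually_ne[OF \<xi>lim, of z] elim(2) by auto
          then have ev: "\<forall>\<^sub>F n in sequentially. (1 - exp (- of_real t * Hn n z)) / (z - \<xi> n) = k n z"
            by eventually_elim (metis keq)
          have "(\<lambda>n. (1 - exp (- of_real t * Hn n z)) / (z - \<xi> n)) \<longlonglongrightarrow> (1 - exp (- of_real t * H z)) / (z - \<zeta>)"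
            using elim(2) by (intro tendsto_intros Hnlim True \<xi>lim) auto
          then have "(\<lambda>n. k n z) \<longlonglongrightarrow> Et t z / (z - \<zeta>)"
            using tendsto_cong[OF ev] True by (simp add: Et_def)
          then show ?thesis by (rule tendsto_mult_left)
        next
          case False
          then show ?thesis using elim(1) by simp
        qed
      qed
    qed
    then show ?thesis by (simp add: k0 LIMSEQ_const_iff)
  qed
  \<comment> \<open>Now t runs through the integers. The factor 2 in the dominating function comes
    from Re H \<ge> 0. Where \<open>h\<close> is nonzero, \<open>AE_zero\<close> gives f \<noteq> 0
    almost everywhere, so Re H > 0 and the exponential dies out.\<close>
  have "(\<lambda>n. LINT z|lborel. h z * (Et (real n) z / (z - \<zeta>)))
      \<longlonglongrightarrow> (LINT z|lborel. h z / (z - \<zeta>))"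
  proof (rule integral_dominated_convergence)
    show "(\<lambda>z. h z / (z - \<zeta>)) \<in> borel_measurable lborel" by (rule borel_measurable_integrable[OF int])
    show "(\<lambda>z. h z * (Et (real n) z / (z - \<zeta>))) \<in> borel_measurable lborel" for n
      by (rule kernel_measurable)
    show "integrable lborel (\<lambda>z. 2 * norm (h z / (z - \<zeta>)))" using int by (intro integrable_mult_right integrable_norm)
    show "AE z in lborel. norm (h z * (Et (real n) z / (z - \<zeta>))) \<le> 2 * norm (h z / (z - \<zeta>))" for n
    proof (rule AE_I2)
      fix z
      show "norm (h z * (Et (real n) z / (z - \<zeta>))) \<le> 2 * norm (h z / (z - \<zeta>))"
      proof (cases "z \<in> ball 0 r")
        case True
        have e1: "norm (exp (- of_real (real n) * H z)) \<le> 1" using ReH[OF True] by simp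
        have "norm (1 - exp (- of_real (real n) * H z)) \<le> norm (1::complex) + norm (exp (- of_real (real n) * H z))"
          by (rule norm_triangle_ineq4)
        also have "\<dots> \<le> 2" using e1 unfolding norm_one by linarith
        finally have "norm (1 - exp (- of_real (real n) * H z)) \<le> 2" .
        then have "norm (1 - exp (- of_real (real n) * H z)) * norm (h z / (z - \<zeta>)) \<le> 2 * norm (h z / (z - \<zeta>))"
          by (rule mult_right_mono) simp
        then show ?thesis using True by (simp add: Et_def norm_mult norm_divide mult.commute)
      qed (simp add: Et_def)
    qed
    show "AE z in lborel. (\<lambda>n. h z * (Et (real n) z / (z - \<zeta>))) \<longlonglongrightarrow> h z / (z - \<zeta>)"
      using AE_D AE_lborel_singleton[of \<zeta>] AE_zero
    proof eventually_elim
      case (elim z)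
      show ?case
      proof (cases "h z = 0")
        case False
        then have z: "z \<in> ball 0 r" using elim(1) by blast
        then have "f z \<noteq> 0" using elim(3) False by blast
        then have "H z \<noteq> 0" using l1 elim(2) by (simp add: H_def)
        then have pos: "Re (H z) > 0" using H_pos z by blast
        have "(\<lambda>n. exp (- of_real (real n) * H z)) \<longlonglongrightarrow> 0"
        proof (rule tendsto_norm_zero_cancel)
          have "(\<lambda>n. (exp (- Re (H z))) ^ n) \<longlonglongrightarrow> 0" using pos by (intro LIMSEQ_realpow_zero) auto
          moreover have "norm (exp (- of_real (real n) * H z)) = (exp (- Re (H z))) ^ n" for n
            by (simp add: exp_of_nat_mult[symmetric])
          ultimately show "(\<lambda>n. norm (exp (- of_real (real n) * H z))) \<longlonglongrightarrow> 0" by simp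
        qed
        then have "(\<lambda>n. h z * ((1 - exp (- of_real (real n) * H z)) / (z - \<zeta>))) \<longlonglongrightarrow> h z * ((1 - 0) / (z - \<zeta>))"
          using elim(2) by (intro tendsto_intros) auto
        then show ?thesis using z by (simp add: Et_def)
      qed simp
    qed
  qed
  then show ?thesis by (simp only: step LIMSEQ_const_iff)
qed

section \<open>Functions of class C^1 on the disc, dilations, test functions and cut-offs\<close>

lemma C1_on_wirtinger:
  assumes r: "r > 0" and C1: "C1_on (cball 0 r) F"
  shows "continuous_on (cball 0 r) F" "continuous_on (cball 0 r) (dbar (cball 0 r) F)"
    "\<exists>p. wirtinger (ball 0 r) F p (dbar (cball 0 r) F)"
proof -
  let ?D = "cball (0::complex) r"
  define F' where "F' z = frechet_derivative F (at z within ?D)" for z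
  have diff: "F differentiable_on ?D" and cont: "\<And>v. continuous_on ?D (\<lambda>z. F' z v)"
    using C1 by (auto simp: C1_on_def F'_def)
  show "continuous_on ?D F" by (rule differentiable_imp_continuous_on[OF diff])
  define p where "p z = (F' z 1 - \<i> * F' z \<i>) / 2" for z
  have q_eq: "dbar ?D F = (\<lambda>z. (F' z 1 + \<i> * F' z \<i>) / 2)" by (simp add: dbar_def F'_def fun_eq_iff)
  show qc: "continuous_on ?D (dbar ?D F)" unfolding q_eq by (intro continuous_intros cont) auto
  have pc: "continuous_on ?D p" unfolding p_def[abs_def] by (intro continuous_intros cont) auto
  have "(F has_derivative (\<lambda>h. p z * h + dbar ?D F z * cnj h)) (at z)" if z: "z \<in> ball 0 r" for z
  proof -
    have "(F has_derivative F' z) (at z within ?D)"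
      using diff z unfolding F'_def differentiable_on_def by (auto simp: frechet_derivative_works[symmetric])
    moreover have "z \<in> interior ?D" using z by simp
    ultimately have d: "(F has_derivative F' z) (at z)" using at_within_interior by metis
    then have lin: "linear (F' z)" by (rule has_derivative_linear)
    have "F' z h = p z * h + dbar ?D F z * cnj h" for h
    proof -
      have "F' z h = F' z (Re h *\<^sub>R 1 + Im h *\<^sub>R \<i>)"
        by (rule arg_cong[of _ _ "F' z"]) (simp add: complex_eq_iff)
      also have "\<dots> = Re h *\<^sub>R F' z 1 + Im h *\<^sub>R F' z \<i>"
        by (simp only: linear_add[OF lin] linear_scale[OF lin])
      also have "\<dots> = p z * h + dbar ?D F z * cnj h"
        unfolding p_def q_eq by (simp add: complex_eq_iff algebra_simps) (simp add: field_simps)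
      finally show ?thesis .
    qed
    then show ?thesis using d by (metis (no_types, lifting) ext)
  qed
  then have "wirtinger (ball 0 r) F p (dbar ?D F)"
    using continuous_on_subset[OF pc ball_subset_cball] continuous_on_subset[OF qc ball_subset_cball]
    by (simp add: wirtinger_def)
  then show "\<exists>p. wirtinger (ball 0 r) F p (dbar ?D F)" by blast
qed

lemma wirtinger_dilation:
  assumes u: "wirtinger U u p q" and V: "open V" "\<And>z. z \<in> V \<Longrightarrow> complex_of_real t * z \<in> U"
  shows "wirtinger V (\<lambda>z. u (complex_of_real t * z)) (\<lambda>z. complex_of_real t * p (complex_of_real t * z)) (\<lambda>z. complex_of_real t * q (complex_of_real t * z))"
proof -
  have "((\<lambda>z. u (complex_of_real t * z)) has_derivative (\<lambda>h. complex_of_real t * p (complex_of_real t * z) * h + complex_of_real t * q (complex_of_real t * z) * cnj h)) (at z)"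
    if z: "z \<in> V" for z
  proof -
    have 1: "((\<lambda>z. complex_of_real t * z) has_derivative (\<lambda>h. complex_of_real t * h)) (at z)"
      by (rule bounded_linear_imp_has_derivative[OF bounded_linear_mult_right])
    have 2: "(u has_derivative (\<lambda>h. p (complex_of_real t * z) * h + q (complex_of_real t * z) * cnj h)) (at (complex_of_real t * z))"
      using u V(2)[OF z] by (simp add: wirtinger_def)
    show ?thesis
      by (rule has_derivative_eq_rhs[OF has_derivative_compose[OF 1 2]]) (simp add: fun_eq_iff)
  qed
  moreover have "continuous_on V (\<lambda>z. p (complex_of_real t * z))" "continuous_on V (\<lambda>z. q (complex_of_real t * z))"
    using u V(2) unfolding wirtinger_def
    by (auto intro!: continuous_on_compose2[of U p] continuous_on_compose2[of U q] continuous_intros)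
  ultimately show ?thesis using V(1) by (auto simp: wirtinger_def intro!: continuous_intros)
qed

lemma wirtinger_power_ex:
  assumes u: "wirtinger U u p q"
  shows "\<exists>P. wirtinger U (\<lambda>z. u z ^ Suc k) P (\<lambda>z. of_nat (Suc k) * u z ^ k * q z)"
proof (induction k)
  case 0
  then show ?case using u by auto
next
  case (Suc k)
  then obtain P where "wirtinger U (\<lambda>z. u z ^ Suc k) P (\<lambda>z. of_nat (Suc k) * u z ^ k * q z)" by blast
  from wirtinger_mult[OF u this]
  have "wirtinger U (\<lambda>z. u z ^ Suc (Suc k)) (\<lambda>z. p z * u z ^ Suc k + u z * P z)
     (\<lambda>z. of_nat (Suc (Suc k)) * u z ^ Suc k * q z)"
    by (rule wirtinger_cong) (auto simp: algebra_simps)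
  then show ?case by blast
qed

lemma wirtinger_real_polynomial:
  assumes "real_polynomial_function f"
  shows "\<exists>p q. wirtinger UNIV (\<lambda>z::complex. of_real (f z)) p q"
  using assms
proof (induction f)
  case (linear f)
  interpret bounded_linear f by (rule linear)
  define a b where "a = f 1" and "b = f \<i>"
  have f: "f z = Re z * a + Im z * b" for z
  proof -
    have "f z = f (Re z *\<^sub>R 1 + Im z *\<^sub>R \<i>)"
      by (rule arg_cong[of _ _ f]) (simp add: complex_eq_iff)
    also have "\<dots> = Re z * a + Im z * b" by (simp only: add scaleR a_def b_def real_scaleR_def)
    finally show ?thesis .
  qed
  \<comment> \<open>The real linear form a Re z + b Im z is (a - \<i> b) / 2 times z plus (a + \<i>
    b) / 2 times the conjugate of z.\<close>
  obtain P Q where "wirtinger UNIV (\<lambda>z. Complex (a / 2) (- b / 2) * z + Complex (a / 2) (b / 2) * cnj z) P Q"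
    using wirtinger_add[OF wirtinger_cmult[OF wirtinger_ident[OF open_UNIV]] wirtinger_cmult[OF wirtinger_cnj[OF open_UNIV]]]
    by blast
  then have "wirtinger UNIV (\<lambda>z. of_real (f z)) P Q"
    by (rule wirtinger_cong) (auto simp: f complex_eq_iff algebra_simps)
  then show ?case by blast
next
  case (const a)
  then show ?case using wirtinger_const[OF open_UNIV] by blast
next
  case (add f g)
  then obtain p q p' q' where "wirtinger UNIV (\<lambda>z. of_real (f z)) p q" "wirtinger UNIV (\<lambda>z. of_real (g z)) p' q'" by blast
  from wirtinger_add[OF this] show ?case by auto
next
  case (mult f g)
  then obtain p q p' q' where "wirtinger UNIV (\<lambda>z. of_real (f z)) p q" "wirtinger UNIV (\<lambda>z. of_real (g z)) p' q'" by blast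
  from wirtinger_mult[OF this] show ?case by auto
qed

text \<open>Stone--Weierstrass gives a polynomial in the real coordinates; a bump function equal to
  1 on the disc cuts it down to compact support.\<close>

lemma wirtinger_approximation:
  assumes g: "continuous_on (cball 0 r) g" and \<epsilon>: "\<epsilon> > 0"
  obtains u p q R where "wirtinger UNIV u p q" "\<And>z. z \<notin> cball 0 R \<Longrightarrow> u z = 0"
    "\<And>z. z \<in> cball 0 r \<Longrightarrow> norm (g z - u z) < \<epsilon>"
proof -
  obtain f where f: "polynomial_function f" "\<And>z. z \<in> cball 0 r \<Longrightarrow> norm (g z - f z) < \<epsilon>"
    using Stone_Weierstrass_polynomial_function[OF compact_cball g \<epsilon>] by blast
  have poly: "real_polynomial_function (Re \<circ> f)" "real_polynomial_function (Im \<circ> f)"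
    using f(1) bounded_linear_Re bounded_linear_Im unfolding polynomial_function_def by blast+
  obtain p1 q1 p2 q2 where w: "wirtinger UNIV (\<lambda>z. of_real ((Re \<circ> f) z)) p1 q1" "wirtinger UNIV (\<lambda>z. of_real ((Im \<circ> f) z)) p2 q2"
    using wirtinger_real_polynomial[OF poly(1)] wirtinger_real_polynomial[OF poly(2)] by metis
  from wirtinger_add[OF w(1) wirtinger_cmult[OF w(2), of \<i>]]
  have fw: "wirtinger UNIV f (\<lambda>z. p1 z + \<i> * p2 z) (\<lambda>z. q1 z + \<i> * q2 z)"
    by (rule wirtinger_cong) (auto simp: complex_eq_iff)
  obtain \<phi> p q S V where \<phi>: "wirtinger UNIV (\<lambda>z. of_real (\<phi> z :: real)) p q" "compact S" "\<And>z. z \<notin> S \<Longrightarrow> \<phi> z = 0"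
    "cball 0 r \<subseteq> V" "\<And>z. z \<in> V \<Longrightarrow> \<phi> z = 1"
    using wirtinger_bump[OF compact_cball open_UNIV, of 0 r] by (metis subset_UNIV)
  obtain R where R: "S \<subseteq> ball 0 R" using bounded_subset_ballD[OF compact_imp_bounded[OF \<phi>(2)]] by blast
  show thesis
  proof (rule that[OF wirtinger_mult[OF \<phi>(1) fw]])
    show "of_real (\<phi> z) * f z = 0" if "z \<notin> cball 0 R" for z
      using \<phi>(3)[of z] R that by force
    show "norm (g z - of_real (\<phi> z) * f z) < \<epsilon>" if "z \<in> cball 0 r" for z
      using f(2)[OF that] \<phi>(4,5) that by auto
  qed
qed

text \<open>The supports shrink to \<open>Z\<close> at rate 1 / (n + 1), while each function is
  constant near \<open>Z\<close>. Hence a product with such a cut-off keeps a controlled derivative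
  on \<open>Z\<close> itself.\<close>

lemma cutoff_sequence:
  assumes Z: "compact Z" and W: "open W" "Z \<subseteq> W"
  obtains \<phi> :: "nat \<Rightarrow> complex \<Rightarrow> real" and p q S V where
    "\<And>n. wirtinger UNIV (\<lambda>z. of_real (\<phi> n z)) (p n) (q n)" "\<And>n. compact (S n)" "\<And>n. S n \<subseteq> W"
    "\<And>n z. z \<notin> S n \<Longrightarrow> \<phi> n z = 0" "\<And>n. open (V n)" "\<And>n. Z \<subseteq> V n" "\<And>n z. z \<in> V n \<Longrightarrow> \<phi> n z = 1"
    "\<And>n z. \<bar>\<phi> n z\<bar> \<le> 1" "\<And>z. (\<lambda>n. \<phi> n z) \<longlonglongrightarrow> indicator Z z"
proof -
  define W' where "W' n = W \<inter> (\<Union>z\<in>Z. ball z (1 / real (Suc n)))" for n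
  have W': "open (W' n)" "Z \<subseteq> W' n" for n using W by (auto simp: W'_def)
  have "\<exists>\<phi> p q S V. wirtinger UNIV (\<lambda>z. of_real (\<phi> z :: real)) p q \<and> compact S \<and> S \<subseteq> W' n \<and> (\<forall>z. z \<notin> S \<longrightarrow> \<phi> z = 0) \<and>
      open V \<and> Z \<subseteq> V \<and> (\<forall>z\<in>V. \<phi> z = 1) \<and> (\<forall>z. 0 \<le> \<phi> z) \<and> (\<forall>z. \<phi> z \<le> 1)" for n
    by (rule wirtinger_bump[OF Z W'(1)[of n] W'(2)[of n]]) blast
  then obtain \<phi> p q S V where \<phi>: "\<And>n. wirtinger UNIV (\<lambda>z. of_real (\<phi> n z :: real)) (p n) (q n)" "\<And>n. compact (S n)" "\<And>n. S n \<subseteq> W' n"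
    "\<And>n z. z \<notin> S n \<Longrightarrow> \<phi> n z = 0" "\<And>n. open (V n)" "\<And>n. Z \<subseteq> V n" "\<And>n z. z \<in> V n \<Longrightarrow> \<phi> n z = 1" "\<And>n z. 0 \<le> \<phi> n z" "\<And>n z. \<phi> n z \<le> 1"
    by metis
  show thesis
  proof (rule that[OF \<phi>(1,2) _ \<phi>(4,5,6,7)])
    show "S n \<subseteq> W" for n using \<phi>(3)[of n] by (auto simp: W'_def)
    show "\<bar>\<phi> n z\<bar> \<le> 1" for n z using \<phi>(8,9)[of n z] by simp
    show "(\<lambda>n. \<phi> n z) \<longlonglongrightarrow> indicator Z z" for z
    proof (cases "z \<in> Z")
      case True
      then have "\<phi> n z = 1" for n using \<phi>(6,7) by blast
      then show ?thesis using True by simp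
    next
      case False
      then obtain e where e: "e > 0" "ball z e \<subseteq> - Z"
        using compact_imp_closed[OF Z] by (metis ComplI open_Compl open_contains_ball)
      obtain N where N: "1 / real (Suc N) < e" using nat_approx_posE[OF e(1)] by blast
      have "\<phi> n z = indicator Z z" if "n \<ge> N" for n
      proof -
        have "1 / real (Suc n) \<le> 1 / real (Suc N)" using that by (intro divide_left_mono) auto
        then have "z \<notin> ball y (1 / real (Suc n))" if "y \<in> Z" for y
          using e(2) N that by (force simp: dist_commute)
        then have "z \<notin> W' n" by (auto simp: W'_def)
        then show ?thesis using \<phi>(3,4) False by auto
      qed
      then show ?thesis by (intro tendsto_eventually) (auto simp: eventually_sequentially)
    qed
  qed
qed

section \<open>The Cauchy transform off the disc and the density built from it\<close>

context weighted_points
begin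

text \<open>For \<zeta> outside the closed disc the kernel 1 / (z - \<zeta>) is holomorphic near the
  disc and so belongs to the algebra.\<close>

lemma cauchy_transform_outside:
  assumes F: "continuous_on (cball 0 r) F"
    and ann: "\<And>p. hol_polynomial p \<Longrightarrow> (LINT \<omega>|M. c \<omega> * p (vector [x \<omega>, F (x \<omega>)] :: complex ^ 2)) = 0"
    and \<zeta>: "norm \<zeta> > r"
  shows "cauchy_transform \<zeta> = 0"
proof -
  have X: "compact (graph_on (cball 0 r) F)" by (intro compact_graph_on compact_cball F)
  have "(\<lambda>z. 1 / (z - \<zeta>)) holomorphic_on - {\<zeta>}" by (intro holomorphic_intros) auto
  then have hol: "(\<lambda>z. 1 / (z - \<zeta>)) \<in> hol_on_closed (cball 0 r)"
    unfolding hol_on_closed_def using \<zeta> by (intro CollectI exI[of _ "- {\<zeta>}"]) auto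
  have "(\<lambda>y :: complex ^ 2. 1 / (y $ 1 - \<zeta>)) \<in> poly_closure (graph_on (cball 0 r) F)"
    by (rule poly_closure_hol_on_closed[OF X hol]) (auto simp: graph_on_def vector_2_nth)
  moreover have "continuous_on (cball 0 r) (\<lambda>z. 1 / (z - \<zeta>))"
    using \<zeta> by (intro continuous_intros) auto
  ultimately have "(LINT \<omega>|M. c \<omega> * (1 / (x \<omega> - \<zeta>))) = 0"
    using annihilates_poly_closure[OF F ann, of "\<lambda>y. 1 / (y $ 1 - \<zeta>)"] by (simp add: vector_2_nth)
  then show ?thesis by (simp add: cauchy_transform_def)
qed

text \<open>A cut-off makes u globally defined. Its derivative leaves no trace: on the disc the
  cut-off is locally constant, and off the disc the Cauchy transform vanishes.\<close>

lemma pairing_near_disc: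
  assumes out: "\<And>\<zeta>. norm \<zeta> > r \<Longrightarrow> cauchy_transform \<zeta> = 0"
    and U: "cball 0 r \<subseteq> U" and u: "wirtinger U u P Q"
  shows "of_real pompeiu_const * (LINT \<omega>|M. c \<omega> * u (x \<omega>))
    = (LINT \<zeta>|lborel. indicator (cball 0 r) \<zeta> *\<^sub>R (Q \<zeta> * cauchy_transform \<zeta>))"
proof -
  have opU: "open U" by (rule wirtinger_open[OF u])
  obtain \<phi> p q S V where \<phi>: "wirtinger UNIV (\<lambda>z. of_real (\<phi> z :: real)) p q" "compact S" "S \<subseteq> U" "\<And>z. z \<notin> S \<Longrightarrow> \<phi> z = 0"
    "open V" "cball 0 r \<subseteq> V" "\<And>z. z \<in> V \<Longrightarrow> \<phi> z = 1"
    using wirtinger_bump[OF compact_cball opU U] by metis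
  obtain R where R: "S \<subseteq> ball 0 R" using bounded_subset_ballD[OF compact_imp_bounded[OF \<phi>(2)]] by blast
  have q0: "q z = 0" if "z \<in> V" for z
    using wirtinger_unique(2)[OF \<phi>(1) wirtinger_const[OF \<phi>(5), of 1] \<phi>(5) _ _ _ that] \<phi>(7) by simp
  define v where "v z = (if z \<in> U then of_real (\<phi> z) * u z else 0)" for z
  have vw: "wirtinger UNIV v (\<lambda>z. if z \<in> U then p z * u z + of_real (\<phi> z) * P z else 0)
      (\<lambda>z. if z \<in> U then q z * u z + of_real (\<phi> z) * Q z else 0)"
    unfolding v_def[abs_def]
    by (rule wirtinger_extend_zero[OF wirtinger_mult[OF wirtinger_subset[OF \<phi>(1) subset_UNIV opU] u]
          compact_imp_closed[OF \<phi>(2)] \<phi>(3)]) (use \<phi>(4) in auto)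
  have v0: "v z = 0" if "z \<notin> cball 0 R" for z
    using \<phi>(4)[of z] R that by (force simp: v_def)
  have "(LINT \<omega>|M. c \<omega> * u (x \<omega>)) = (LINT \<omega>|M. c \<omega> * v (x \<omega>))"
  proof (rule Bochner_Integration.integral_cong)
    fix \<omega>
    show "c \<omega> * u (x \<omega>) = c \<omega> * v (x \<omega>)"
    proof (cases "c \<omega> = 0")
      case False
      then have "x \<omega> \<in> cball 0 r" using supp by simp
      then have "x \<omega> \<in> U" "\<phi> (x \<omega>) = 1" using U \<phi>(6,7) by blast+
      then show ?thesis by (simp add: v_def)
    qed simp
  qed simp
  then have "of_real pompeiu_const * (LINT \<omega>|M. c \<omega> * u (x \<omega>))
      = (LINT \<zeta>|lborel. (if \<zeta> \<in> U then q \<zeta> * u \<zeta> + of_real (\<phi> \<zeta>) * Q \<zeta> else 0) * cauchy_transform \<zeta>)"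
    using cauchy_transform_pairing[OF vw v0] by simp
  also have "\<dots> = (LINT \<zeta>|lborel. indicator (cball 0 r) \<zeta> *\<^sub>R (Q \<zeta> * cauchy_transform \<zeta>))"
  proof (rule Bochner_Integration.integral_cong)
    fix \<zeta>
    show "(if \<zeta> \<in> U then q \<zeta> * u \<zeta> + of_real (\<phi> \<zeta>) * Q \<zeta> else 0) * cauchy_transform \<zeta>
        = indicator (cball 0 r) \<zeta> *\<^sub>R (Q \<zeta> * cauchy_transform \<zeta>)"
    proof (cases "\<zeta> \<in> cball 0 r")
      case True
      then have "\<zeta> \<in> U" "\<phi> \<zeta> = 1" "q \<zeta> = 0" using U \<phi>(6,7) q0 by blast+
      then show ?thesis using True by simp
    next
      case False
      then have "cauchy_transform \<zeta> = 0" by (intro out) simp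
      then show ?thesis by simp
    qed
  qed simp
  finally show ?thesis .
qed

end

lemma prod_UNIV_2: "(\<Prod>i\<in>UNIV. f (i :: 2)) = f 1 * f 2"
  by (simp add: UNIV_2)

lemma continuous_on_cball_bounded:
  fixes f :: "complex \<Rightarrow> complex"
  assumes "continuous_on (cball 0 r) f"
  obtains b where "b \<ge> 0" "\<And>z. z \<in> cball 0 r \<Longrightarrow> norm (f z) \<le> b"
proof -
  have "bounded (f ` cball 0 r)" by (intro compact_imp_bounded compact_continuous_image assms compact_cball)
  then obtain b where b: "\<And>z. z \<in> cball 0 r \<Longrightarrow> norm (f z) \<le> b" unfolding bounded_iff by blast
  show thesis by (rule that[of "\<bar>b\<bar>"]) (use b in \<open>auto intro: order_trans[OF _ abs_ge_self]\<close>)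
qed

context weighted_points
begin

text \<open>With q = dF/d(cnj z) this is the density h of the overview. The explicit indicator gives
  it support in the disc, so that it is again an instance of \<open>weighted_points\<close>.\<close>

definition dbar_density :: "(complex \<Rightarrow> complex) \<Rightarrow> complex \<Rightarrow> complex" where
  "dbar_density q z = indicator (cball 0 r) z *\<^sub>R (q z * cauchy_transform z)"

lemma integrable_dbar_density:
  assumes q: "continuous_on (cball 0 r) q"
  shows "integrable lborel (dbar_density q)"
proof -
  obtain b where b: "b \<ge> 0" "\<And>z. z \<in> cball 0 r \<Longrightarrow> norm (q z) \<le> b"
    using continuous_on_cball_bounded[OF q] by metis
  have "integrable lborel (\<lambda>z. (indicator (cball 0 r) z *\<^sub>R q z) * cauchy_transform z)"
  proof (rule cauchy_transform_integrable[where R = r and B = b])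
    show "(\<lambda>z. indicator (cball 0 r) z *\<^sub>R q z) \<in> borel_measurable borel"
      by (intro borel_measurable_continuous_on_indicator q) auto
    show "norm (indicator (cball 0 r) z *\<^sub>R q z) \<le> b" for z
      using b by (cases "z \<in> cball 0 r") auto
  qed simp
  then show ?thesis by (simp add: dbar_density_def[abs_def])
qed

lemma weighted_points_dbar_density:
  assumes q: "continuous_on (cball 0 r) q"
  shows "weighted_points lborel (dbar_density q) (\<lambda>z. z) r"
proof
  show "integrable lborel (dbar_density q)" by (rule integrable_dbar_density[OF q])
  show "norm z \<le> r" if "dbar_density q z \<noteq> 0" for z
    using that by (auto simp: dbar_density_def indicator_def split: if_splits)
qed auto

text \<open>If mu annihilates z^j F^(k+1), then so does the density dF/d(cnj z) times the Cauchy transform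
  of mu with z^j F^k; the dilations F (t z) replace an extension of F beyond the disc.\<close>

lemma dbar_density_annihilates_monomial:
  assumes r: "r > 0" and F: "continuous_on (cball 0 r) F" and q: "continuous_on (cball 0 r) q"
    and Fw: "wirtinger (ball 0 r) F p q"
    and ann: "\<And>p. hol_polynomial p \<Longrightarrow> (LINT \<omega>|M. c \<omega> * p (vector [x \<omega>, F (x \<omega>)] :: complex ^ 2)) = 0"
  shows "(LINT z|lborel. dbar_density q z * (z ^ j * F z ^ k)) = 0"
proof -
  define t where "t n = 1 - 1 / (real n + 2)" for n
  have t: "0 < t n" "t n < 1" for n by (auto simp: t_def field_simps)
  have t1: "t \<longlonglongrightarrow> 1" unfolding t_def by real_asymp
  have tz: "complex_of_real (t n) * z \<in> cball 0 r" if "z \<in> cball 0 r" for n z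
  proof -
    have "t n * norm z \<le> 1 * norm z" using t[of n] by (intro mult_right_mono) auto
    then show ?thesis using that t[of n] by (simp add: norm_mult)
  qed
  have tlim: "(\<lambda>n. complex_of_real (t n) * z) \<longlonglongrightarrow> z" for z
    using tendsto_mult[OF tendsto_of_real[OF t1] tendsto_const[of z]] by simp
  have Flim: "(\<lambda>n. F (complex_of_real (t n) * z)) \<longlonglongrightarrow> F z" if "z \<in> cball 0 r" for z
    by (rule continuous_on_tendsto_compose[OF F tlim that]) (use tz[OF that] in simp)
  have qlim: "(\<lambda>n. q (complex_of_real (t n) * z)) \<longlonglongrightarrow> q z" if "z \<in> cball 0 r" for z
    by (rule continuous_on_tendsto_compose[OF q tlim that]) (use tz[OF that] in simp)
  obtain bF where bF: "bF \<ge> 0" "\<And>z. z \<in> cball 0 r \<Longrightarrow> norm (F z) \<le> bF"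
    using continuous_on_cball_bounded[OF F] by metis
  obtain bq where bq: "bq \<ge> 0" "\<And>z. z \<in> cball 0 r \<Longrightarrow> norm (q z) \<le> bq"
    using continuous_on_cball_bounded[OF q] by metis
  \<comment> \<open>Only F is dilated: \<open>u n\<close> is thereby defined past the closed disc,
    and z^j passes through the differentiation as a holomorphic factor.\<close>
  define u where "u n z = z ^ j * F (complex_of_real (t n) * z) ^ Suc k" for n z
  define Q where "Q n z = z ^ j * (of_nat (Suc k) * F (complex_of_real (t n) * z) ^ k *
      (complex_of_real (t n) * q (complex_of_real (t n) * z)))" for n z
  have Fct: "continuous_on (cball 0 r) (\<lambda>z. F (complex_of_real (t n) * z))"
    and qct: "continuous_on (cball 0 r) (\<lambda>z. q (complex_of_real (t n) * z))" for n
    using tz by (auto intro!: continuous_on_compose2[OF F] continuous_on_compose2[OF q] continuous_intros)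
  have out: "cauchy_transform \<zeta> = 0" if "norm \<zeta> > r" for \<zeta>
    by (rule cauchy_transform_outside[OF F ann that])
  have eq: "of_real pompeiu_const * (LINT \<omega>|M. c \<omega> * u n (x \<omega>))
      = (LINT \<zeta>|lborel. indicator (cball 0 r) \<zeta> *\<^sub>R (Q n \<zeta> * cauchy_transform \<zeta>))" for n
  proof -
    have tU: "complex_of_real (t n) * z \<in> ball 0 r" if "z \<in> ball 0 (r / t n)" for z
      using that t[of n] by (simp add: norm_mult field_simps)
    obtain P where P: "wirtinger (ball 0 (r / t n)) (\<lambda>z. F (complex_of_real (t n) * z) ^ Suc k) P
        (\<lambda>z. of_nat (Suc k) * F (complex_of_real (t n) * z) ^ k * (complex_of_real (t n) * q (complex_of_real (t n) * z)))"
      using wirtinger_power_ex[OF wirtinger_dilation[where V = "ball 0 (r / t n)" and t = "t n", OF Fw open_ball tU], of k] by blast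
    have zj: "wirtinger (ball 0 (r / t n)) (\<lambda>z. z ^ j) (deriv (\<lambda>z. z ^ j)) (\<lambda>_. 0)"
      by (intro wirtinger_holomorphic open_ball holomorphic_intros)
    have "r < r / t n" using t[of n] r by (simp add: field_simps)
    then have sub: "cball 0 r \<subseteq> ball (0::complex) (r / t n)" by auto
    from wirtinger_mult[OF zj P]
    have uw: "wirtinger (ball 0 (r / t n)) (u n) (\<lambda>z. deriv (\<lambda>z. z ^ j) z * F (complex_of_real (t n) * z) ^ Suc k + z ^ j * P z) (Q n)"
      by (rule wirtinger_cong) (auto simp: u_def Q_def)
    show ?thesis by (rule pairing_near_disc[OF out sub uw])
  qed
  have uc: "continuous_on (cball 0 r) (u n)" for n
    unfolding u_def[abs_def] by (intro continuous_intros Fct)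
  have Qc: "continuous_on (cball 0 r) (Q n)" for n
    unfolding Q_def[abs_def] by (intro continuous_intros Fct qct)
  have "(\<lambda>n. LINT \<omega>|M. c \<omega> * u n (x \<omega>)) \<longlonglongrightarrow> (LINT \<omega>|M. c \<omega> * (x \<omega> ^ j * F (x \<omega>) ^ Suc k))"
  proof (rule integral_dominated_convergence)
    have "continuous_on (cball 0 r) (\<lambda>z. z ^ j * F z ^ Suc k)" by (intro continuous_intros F)
    from borel_measurable_integrable[OF integrable_continuous[OF this]]
    show "(\<lambda>\<omega>. c \<omega> * (x \<omega> ^ j * F (x \<omega>) ^ Suc k)) \<in> borel_measurable M" .
    show "(\<lambda>\<omega>. c \<omega> * u n (x \<omega>)) \<in> borel_measurable M" for n
      by (rule borel_measurable_integrable[OF integrable_continuous[OF uc]])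
    show "integrable M (\<lambda>\<omega>. (r ^ j * bF ^ Suc k) * norm (c \<omega>))" using c by (intro integrable_mult_right integrable_norm)
    show "AE \<omega> in M. norm (c \<omega> * u n (x \<omega>)) \<le> (r ^ j * bF ^ Suc k) * norm (c \<omega>)" for n
    proof (rule AE_I2)
      fix \<omega>
      show "norm (c \<omega> * u n (x \<omega>)) \<le> (r ^ j * bF ^ Suc k) * norm (c \<omega>)"
      proof (cases "c \<omega> = 0")
        case False
        then have xr: "x \<omega> \<in> cball 0 r" using supp by simp
        have "norm (x \<omega>) ^ j * norm (F (complex_of_real (t n) * x \<omega>)) ^ Suc k \<le> r ^ j * bF ^ Suc k"
          using xr r bF(1) by (intro mult_mono power_mono bF tz) auto
        then have "norm (u n (x \<omega>)) \<le> r ^ j * bF ^ Suc k"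
          by (simp only: u_def norm_mult norm_power)
        then have "norm (u n (x \<omega>)) * norm (c \<omega>) \<le> (r ^ j * bF ^ Suc k) * norm (c \<omega>)"
          by (rule mult_right_mono) simp
        then show ?thesis by (simp only: norm_mult mult.commute)
      qed simp
    qed
    show "AE \<omega> in M. (\<lambda>n. c \<omega> * u n (x \<omega>)) \<longlonglongrightarrow> c \<omega> * (x \<omega> ^ j * F (x \<omega>) ^ Suc k)"
    proof (rule AE_I2)
      fix \<omega>
      show "(\<lambda>n. c \<omega> * u n (x \<omega>)) \<longlonglongrightarrow> c \<omega> * (x \<omega> ^ j * F (x \<omega>) ^ Suc k)"
      proof (cases "c \<omega> = 0")
        case False
        then have "x \<omega> \<in> cball 0 r" using supp by simp
        then show ?thesis unfolding u_def by (intro tendsto_intros Flim)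
      qed simp
    qed
  qed
  moreover have "(LINT \<omega>|M. c \<omega> * (x \<omega> ^ j * F (x \<omega>) ^ Suc k)) = 0"
    using ann[OF hol_polynomial_monomial[of 1 "\<lambda>i. if i = 1 then j else Suc k"]]
    by (simp add: prod_UNIV_2 vector_2_nth)
  ultimately have "(\<lambda>n. of_real pompeiu_const * (LINT \<omega>|M. c \<omega> * u n (x \<omega>))) \<longlonglongrightarrow> of_real pompeiu_const * 0"
    by (intro tendsto_mult_left) simp
  then have lim0: "(\<lambda>n. LINT \<zeta>|lborel. indicator (cball 0 r) \<zeta> *\<^sub>R (Q n \<zeta> * cauchy_transform \<zeta>)) \<longlonglongrightarrow> 0"
    unfolding eq by simp
  have CT_int: "integrable lborel (\<lambda>\<zeta>. indicator (cball 0 r) \<zeta> * cauchy_transform \<zeta>)"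
    by (rule cauchy_transform_integrable[of _ 1 r]) (auto simp: indicator_def intro!: borel_measurable_indicator)
  define b where "b = r ^ j * (real (Suc k) * bF ^ k * bq)"
  define L where "L z = z ^ j * (of_nat (Suc k) * F z ^ k * q z)" for z
  have Lc: "continuous_on (cball 0 r) L" unfolding L_def[abs_def] by (intro continuous_intros F q)
  have meas: "(\<lambda>\<zeta>. indicator (cball 0 r) \<zeta> *\<^sub>R (G \<zeta> * cauchy_transform \<zeta>)) \<in> borel_measurable lborel"
    if "continuous_on (cball 0 r) G" for G
    using integrable_dbar_density[OF that] by (auto simp: dbar_density_def[abs_def] dest: borel_measurable_integrable)
  have lim: "(\<lambda>n. LINT \<zeta>|lborel. indicator (cball 0 r) \<zeta> *\<^sub>R (Q n \<zeta> * cauchy_transform \<zeta>))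
      \<longlonglongrightarrow> (LINT \<zeta>|lborel. indicator (cball 0 r) \<zeta> *\<^sub>R (L \<zeta> * cauchy_transform \<zeta>))"
  proof (rule integral_dominated_convergence[OF meas[OF Lc] meas[OF Qc]])
    show "integrable lborel (\<lambda>\<zeta>. b * norm (indicator (cball 0 r) \<zeta> * cauchy_transform \<zeta>))"
      using CT_int by (intro integrable_mult_right integrable_norm)
    show "AE \<zeta> in lborel. norm (indicator (cball 0 r) \<zeta> *\<^sub>R (Q n \<zeta> * cauchy_transform \<zeta>))
        \<le> b * norm (indicator (cball 0 r) \<zeta> * cauchy_transform \<zeta>)" for n
    proof (rule AE_I2)
      fix z :: complex
      show "norm (indicator (cball 0 r) z *\<^sub>R (Q n z * cauchy_transform z))
        \<le> b * norm (indicator (cball 0 r) z * cauchy_transform z)"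
      proof (cases "z \<in> cball 0 r")
        case True
        let ?w = "complex_of_real (t n) * z"
        have m1: "norm (complex_of_real (t n)) * norm (q ?w) \<le> 1 * bq"
          using t[of n] bq(1) by (intro mult_mono bq tz[OF True]) auto
        have m2: "norm (of_nat (Suc k) :: complex) * norm (F ?w) ^ k \<le> real (Suc k) * bF ^ k"
          unfolding norm_of_nat by (intro mult_left_mono power_mono bF tz[OF True]) auto
        have m3: "norm (of_nat (Suc k) :: complex) * norm (F ?w) ^ k * (norm (complex_of_real (t n)) * norm (q ?w))
            \<le> real (Suc k) * bF ^ k * (1 * bq)"
          by (rule mult_mono[OF m2 m1]) (auto intro!: mult_nonneg_nonneg zero_le_power bF(1))
        have m4: "norm z ^ j \<le> r ^ j" using True by (intro power_mono) auto
        have "norm z ^ j * (norm (of_nat (Suc k) :: complex) * norm (F ?w) ^ k * (norm (complex_of_real (t n)) * norm (q ?w)))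
            \<le> r ^ j * (real (Suc k) * bF ^ k * (1 * bq))"
          by (rule mult_mono[OF m4 m3]) (use r bF(1) bq(1) in \<open>auto intro!: mult_nonneg_nonneg zero_le_power\<close>)
        then have "norm (Q n z) \<le> b" by (simp only: Q_def b_def norm_mult norm_power mult_1_left)
        then have "norm (Q n z) * norm (cauchy_transform z) \<le> b * norm (cauchy_transform z)" by (rule mult_right_mono) simp
        then show ?thesis using True by (simp add: norm_mult)
      qed simp
    qed
    show "AE \<zeta> in lborel. (\<lambda>n. indicator (cball 0 r) \<zeta> *\<^sub>R (Q n \<zeta> * cauchy_transform \<zeta>))
        \<longlonglongrightarrow> indicator (cball 0 r) \<zeta> *\<^sub>R (L \<zeta> * cauchy_transform \<zeta>)"
    proof (rule AE_I2)
      fix z :: complex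
      show "(\<lambda>n. indicator (cball 0 r) z *\<^sub>R (Q n z * cauchy_transform z))
        \<longlonglongrightarrow> indicator (cball 0 r) z *\<^sub>R (L z * cauchy_transform z)"
      proof (cases "z \<in> cball 0 r")
        case True
        have "(\<lambda>n. Q n z) \<longlonglongrightarrow> z ^ j * (of_nat (Suc k) * F z ^ k * (of_real 1 * q z))"
          unfolding Q_def by (intro tendsto_intros Flim[OF True] qlim[OF True] t1)
        then have "(\<lambda>n. Q n z) \<longlonglongrightarrow> L z" by (simp add: L_def)
        then show ?thesis by (intro tendsto_intros)
      qed simp
    qed
  qed
  have "(LINT \<zeta>|lborel. indicator (cball 0 r) \<zeta> *\<^sub>R (L \<zeta> * cauchy_transform \<zeta>)) = 0"
    by (rule LIMSEQ_unique[OF lim lim0])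
  moreover have "(LINT \<zeta>|lborel. indicator (cball 0 r) \<zeta> *\<^sub>R (L \<zeta> * cauchy_transform \<zeta>))
      = (LINT z|lborel. of_nat (Suc k) * (dbar_density q z * (z ^ j * F z ^ k)))"
    by (intro Bochner_Integration.integral_cong) (auto simp: dbar_density_def L_def algebra_simps)
  ultimately have "of_nat (Suc k) * (LINT z|lborel. dbar_density q z * (z ^ j * F z ^ k)) = 0"
    by (simp only: integral_mult_right_zero)
  \<comment> \<open>Differentiating the power k + 1 of F left the factor k + 1; kept folded, it is
    visibly nonzero and cancels.\<close>
  then show ?thesis by (simp del: of_nat_Suc)
qed

lemma dbar_density_annihilates:
  assumes r: "r > 0" and F: "continuous_on (cball 0 r) F" and q: "continuous_on (cball 0 r) q"
    and Fw: "wirtinger (ball 0 r) F p q"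
    and ann: "\<And>p. hol_polynomial p \<Longrightarrow> (LINT \<omega>|M. c \<omega> * p (vector [x \<omega>, F (x \<omega>)] :: complex ^ 2)) = 0"
    and P: "hol_polynomial P"
  shows "(LINT z|lborel. dbar_density q z * P (vector [z, F z] :: complex ^ 2)) = 0"
proof -
  interpret h: weighted_points lborel "dbar_density q" "\<lambda>z. z" r by (rule weighted_points_dbar_density[OF q])
  obtain S a where S: "finite S" and P: "P = (\<lambda>y. \<Sum>m\<in>S. a m * (\<Prod>i\<in>UNIV. (y $ i) ^ m i))"
    using P unfolding hol_polynomial_def by blast
  have int: "integrable lborel (\<lambda>z. dbar_density q z * (z ^ m 1 * F z ^ m 2))" for m :: "2 \<Rightarrow> nat"
    by (rule h.integrable_continuous) (intro continuous_intros F)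
  have "(LINT z|lborel. dbar_density q z * P (vector [z, F z]))
      = (LINT z|lborel. (\<Sum>m\<in>S. a m * (dbar_density q z * (z ^ m 1 * F z ^ m 2))))"
    by (intro Bochner_Integration.integral_cong)
       (auto simp: P prod_UNIV_2 vector_2_nth sum_distrib_left mult_ac)
  also have "\<dots> = (\<Sum>m\<in>S. (LINT z|lborel. a m * (dbar_density q z * (z ^ m 1 * F z ^ m 2))))"
    by (intro Bochner_Integration.integral_sum integrable_mult_right int)
  also have "\<dots> = 0"
    using dbar_density_annihilates_monomial[OF r F q Fw ann] by (intro sum.neutral) simp
  finally show ?thesis .
qed


text \<open>The Cauchy transform of \<open>dbar_density q\<close> vanishes inside the disc by
  \<open>cauchy_integral_zero\<close>, outside because the density annihilates the algebra, and the
  circle is a null set. A density with vanishing transform is zero almost everywhere, and off its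
  zeros q can be divided out.\<close>

lemma cauchy_transform_zero_off_critical_set:
  fixes F A :: "complex \<Rightarrow> complex" and E :: "complex set"
  assumes r: "r > 0" and F: "continuous_on (cball 0 r) F" and q: "continuous_on (cball 0 r) q"
    and Fw: "wirtinger (ball 0 r) F p q" and E: "nowhere_dense E"
    and A: "A \<in> hol_on_closed (cball 0 r)" and A0: "\<forall>z\<in>cball 0 r. A z \<noteq> 0"
    and M: "M' > 0" and \<nu>: "\<nu> \<ge> 1"
    and main: "\<forall>\<zeta>\<in>cball 0 r - E.
           \<exists>G \<in> hol_on_closed_zero (cball 0 r) \<zeta>. \<exists>C :: complex.
             (\<forall>z\<in>cball 0 r - {\<zeta>}. inverse (norm (z - \<zeta>)) * norm (G z) \<le> M') \<and>
             norm C = 1 \<and>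
             (\<forall>z\<in>cball 0 r. C * (z - \<zeta>) * (A z * F z - A \<zeta> * F \<zeta> + G z)
                \<in> {w. Re w \<ge> 0 \<and> \<bar>Im w\<bar> \<le> K * Re w powr (1 / \<nu>)})"
    and ann: "\<And>p. hol_polynomial p \<Longrightarrow> (LINT \<omega>|M. c \<omega> * p (vector [x \<omega>, F (x \<omega>)] :: complex ^ 2)) = 0"
  shows "AE z in lborel. z \<notin> {z \<in> cball 0 r. q z = 0} \<longrightarrow> cauchy_transform z = 0"
proof -
  interpret h: weighted_points lborel "dbar_density q" "\<lambda>z. z" r
    by (rule weighted_points_dbar_density[OF q])
  obtain b where b: "\<And>z. z \<in> cball 0 r \<Longrightarrow> norm (q z) \<le> b"
    using continuous_on_cball_bounded[OF q] by metis
  have qb: "norm (q z) \<le> b" if "z \<in> ball 0 r" for z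
    by (rule b) (use that in auto)
  have hann: "(LINT z|lborel. dbar_density q z * P (vector [z, F z] :: complex ^ 2)) = 0"
    if P: "hol_polynomial P" for P
    by (rule dbar_density_annihilates[OF r F q Fw ann P])
  have h0: "AE z in lborel. z \<in> ball 0 r \<longrightarrow> q z = 0 \<longrightarrow> dbar_density q z = 0"
    by (rule AE_I2) (simp add: dbar_density_def)
  have CT: "AE \<zeta> in lborel. h.cauchy_transform \<zeta> = 0"
    using h.AE_integrable AE_not_sphere[of r]
  proof eventually_elim
    case (elim \<zeta>)
    show ?case
    proof (cases "norm \<zeta> < r")
      case True
      then have \<zeta>: "\<zeta> \<in> ball 0 r" by simp
      show ?thesis unfolding h.cauchy_transform_def
        by (rule cauchy_integral_zero[OF r F Fw qb E A A0 M \<nu> main h.weighted_points_axioms h0 hann \<zeta> elim(1)])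
    next
      case False
      then have out: "norm \<zeta> > r" using elim(2) by simp
      show ?thesis by (rule h.cauchy_transform_outside[OF F hann out])
    qed
  qed
  have "AE z in lborel. z \<in> UNIV \<longrightarrow> dbar_density q z = 0"
  proof (rule AE_zero_of_tests[OF integrable_dbar_density[OF q] open_UNIV])
    fix u p' q' S
    assume u: "wirtinger UNIV u p' q'" and S: "compact S" and 0: "\<And>z. z \<notin> S \<Longrightarrow> u z = 0"
    obtain R where R: "S \<subseteq> ball 0 R" using bounded_subset_ballD[OF compact_imp_bounded[OF S]] by blast
    have u0: "u z = 0" if "z \<notin> cball 0 R" for z using 0[of z] R that by force
    have "AE \<zeta> in lborel. q' \<zeta> * h.cauchy_transform \<zeta> = 0" using CT by eventually_elim simp
    from h.integral_zero_if_cauchy_transform_zero[OF u u0 this]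
    show "(LINT z|lborel. u z * dbar_density q z) = 0" by (simp add: mult.commute)
  qed
  then show ?thesis
  proof eventually_elim
    case (elim z)
    show ?case
    proof (cases "z \<in> cball 0 r")
      case True
      then show ?thesis using elim by (auto simp: dbar_density_def)
    next
      case False
      then have out: "norm z > r" by simp
      show ?thesis using cauchy_transform_outside[OF F ann out] by blast
    qed
  qed
qed

section \<open>From the Cauchy transform off the critical set to the vanishing of the
  measure\<close>

lemma integral_dominated_limit:
  assumes "\<And>n. (\<lambda>\<omega>. f n (x \<omega>)) \<in> borel_measurable M" "(\<lambda>\<omega>. g (x \<omega>)) \<in> borel_measurable M"
    and b: "\<And>n z. norm (f n z) \<le> b" and lim: "\<And>z. (\<lambda>n. f n z) \<longlonglongrightarrow> g z"
    and 0: "\<And>n. (LINT \<omega>|M. c \<omega> * f n (x \<omega>)) = 0"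
  shows "(LINT \<omega>|M. c \<omega> * g (x \<omega>)) = 0"
proof -
  have "(\<lambda>n. LINT \<omega>|M. c \<omega> * f n (x \<omega>)) \<longlonglongrightarrow> (LINT \<omega>|M. c \<omega> * g (x \<omega>))"
  proof (rule integral_dominated_convergence)
    show "(\<lambda>\<omega>. c \<omega> * g (x \<omega>)) \<in> borel_measurable M" "(\<lambda>\<omega>. c \<omega> * f n (x \<omega>)) \<in> borel_measurable M" for n
      using assms(1,2) by (auto intro!: borel_measurable_times)
    show "integrable M (\<lambda>\<omega>. norm (c \<omega>) * b)" using c by (intro integrable_mult_left integrable_norm)
    show "AE \<omega> in M. norm (c \<omega> * f n (x \<omega>)) \<le> norm (c \<omega>) * b" for n
      by (intro AE_I2) (simp add: norm_mult mult_left_mono b)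
    show "AE \<omega> in M. (\<lambda>n. c \<omega> * f n (x \<omega>)) \<longlonglongrightarrow> c \<omega> * g (x \<omega>)"
      by (intro AE_I2 tendsto_mult_left lim)
  qed
  then have "(\<lambda>n::nat. 0::complex) \<longlonglongrightarrow> (LINT \<omega>|M. c \<omega> * g (x \<omega>))" by (simp only: 0)
  then show ?thesis by (rule LIMSEQ_unique[OF _ tendsto_const])
qed

text \<open>In the pairing one factor vanishes on \<open>Z\<close> and the other almost everywhere
  off it.\<close>

lemma integral_wirtinger_zero:
  assumes CT: "AE z in lborel. z \<notin> Z \<longrightarrow> cauchy_transform z = 0"
    and v: "wirtinger UNIV v p q" and S: "compact S" and 0: "\<And>z. z \<notin> S \<Longrightarrow> v z = 0"
    and q: "\<And>z. z \<in> Z \<Longrightarrow> q z = 0"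
  shows "(LINT \<omega>|M. c \<omega> * v (x \<omega>)) = 0"
proof -
  obtain R where R: "S \<subseteq> ball 0 R" using bounded_subset_ballD[OF compact_imp_bounded[OF S]] by blast
  have v0: "v z = 0" if "z \<notin> cball 0 R" for z using 0[of z] R that by force
  have "AE \<zeta> in lborel. q \<zeta> * cauchy_transform \<zeta> = 0"
    using CT by eventually_elim (use q in auto)
  from integral_zero_if_cauchy_transform_zero[OF v v0 this] show ?thesis .
qed

text \<open>If \<phi> is 1 near \<open>Z\<close>, the derivative of \<phi> k with respect to the
  conjugate variable is zero on \<open>Z\<close>, because there \<phi> is locally constant and k is
  holomorphic. Letting the supports shrink leaves the integral over \<open>Z\<close>.\<close>

lemma integral_holomorphic_on_zero:
  assumes CT: "AE z in lborel. z \<notin> Z \<longrightarrow> cauchy_transform z = 0" and Z: "compact Z"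
    and U: "open U" "Z \<subseteq> U" and k: "k holomorphic_on U"
  shows "(LINT \<omega>|M. c \<omega> * (indicator Z (x \<omega>) * k (x \<omega>))) = 0"
proof -
  \<comment> \<open>This first cut-off only serves to find a compact neighbourhood \<open>S0\<close>
    of \<open>Z\<close> inside \<open>U\<close>, on which \<open>k\<close> is bounded.\<close>
  obtain \<phi>0 p0 q0 S0 V0 where 0: "wirtinger UNIV (\<lambda>z. of_real (\<phi>0 z :: real)) p0 q0" "compact S0" "S0 \<subseteq> U"
    "open V0" "Z \<subseteq> V0" "\<And>z. z \<notin> S0 \<Longrightarrow> \<phi>0 z = 0" "\<And>z. z \<in> V0 \<Longrightarrow> \<phi>0 z = 1"
    using wirtinger_bump[OF Z U] by metis
  have V0S0: "V0 \<subseteq> S0" using 0(6,7) by force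
  obtain \<phi> :: "nat \<Rightarrow> complex \<Rightarrow> real" and p q S V where \<phi>:
    "\<And>n. wirtinger UNIV (\<lambda>z. of_real (\<phi> n z)) (p n) (q n)" "\<And>n. compact (S n)" "\<And>n. S n \<subseteq> V0"
    "\<And>n z. z \<notin> S n \<Longrightarrow> \<phi> n z = 0" "\<And>n. open (V n)" "\<And>n. Z \<subseteq> V n" "\<And>n z. z \<in> V n \<Longrightarrow> \<phi> n z = 1"
    "\<And>n z. \<bar>\<phi> n z\<bar> \<le> 1" "\<And>z. (\<lambda>n. \<phi> n z) \<longlonglongrightarrow> indicator Z z"
    using cutoff_sequence[OF Z 0(4,5)] by metis
  have "bounded (k ` S0)"
    by (intro compact_imp_bounded compact_continuous_image 0(2)
        continuous_on_subset[OF holomorphic_on_imp_continuous_on[OF k] 0(3)])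
  then obtain b where b: "\<And>z. z \<in> S0 \<Longrightarrow> norm (k z) \<le> b" unfolding bounded_iff by blast
  define v where "v n z = (if z \<in> U then of_real (\<phi> n z) * k z else 0)" for n z
  have SU: "S n \<subseteq> U" for n using \<phi>(3)[of n] V0S0 0(3) by blast
  have q0: "q n z = 0" if "z \<in> V n" for n z
    using wirtinger_unique(2)[OF \<phi>(1)[of n] wirtinger_const[OF \<phi>(5)[of n], of 1] \<phi>(5)[of n] _ _ _ that] \<phi>(7)[of _ n] by simp
  have vw: "wirtinger UNIV (v n) (\<lambda>z. if z \<in> U then p n z * k z + of_real (\<phi> n z) * deriv k z else 0)
      (\<lambda>z. if z \<in> U then q n z * k z + of_real (\<phi> n z) * 0 else 0)" for n
    unfolding v_def[abs_def]
    by (rule wirtinger_extend_zero[OF wirtinger_mult[OF wirtinger_subset[OF \<phi>(1)[of n] subset_UNIV U(1)]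
          wirtinger_holomorphic[OF U(1) k]] compact_imp_closed[OF \<phi>(2)[of n]] SU]) (use \<phi>(4)[of _ n] in auto)
  have cv: "continuous_on UNIV (v n)" for n by (rule wirtinger_continuous[OF vw])
  have lim: "(\<lambda>n. v n z) \<longlonglongrightarrow> indicator Z z * k z" for z
  proof (cases "z \<in> U")
    case True
    have "(\<lambda>n. of_real (\<phi> n z) * k z) \<longlonglongrightarrow> of_real (indicator Z z) * k z"
      by (intro tendsto_intros \<phi>(9))
    then show ?thesis using True by (simp add: v_def of_real_indicator)
  next
    case False
    then show ?thesis using U(2) by (auto simp: v_def indicator_def)
  qed
  have vm: "(\<lambda>\<omega>. v n (x \<omega>)) \<in> borel_measurable M" for n
    by (rule measurable_compose[OF x borel_measurable_continuous_onI[OF cv]])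
  have gm: "(\<lambda>\<omega>. indicator Z (x \<omega>) * k (x \<omega>)) \<in> borel_measurable M"
    by (rule borel_measurable_LIMSEQ_metric[OF vm lim])
  show ?thesis
  proof (rule integral_dominated_limit[where f = v and b = "\<bar>b\<bar>" and g = "\<lambda>z. indicator Z z * k z", OF vm gm _ lim])
    show "norm (v n z) \<le> \<bar>b\<bar>" for n z
    proof (cases "z \<in> S n")
      case True
      then have "norm (k z) \<le> b" using b \<phi>(3)[of n] V0S0 by blast
      then have "\<bar>\<phi> n z\<bar> * norm (k z) \<le> 1 * \<bar>b\<bar>" by (intro mult_mono \<phi>(8)) auto
      then show ?thesis by (auto simp: v_def norm_mult)
    qed (simp add: v_def \<phi>(4))
    show "(LINT \<omega>|M. c \<omega> * v n (x \<omega>)) = 0" for n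
    proof (rule integral_wirtinger_zero[OF CT vw \<phi>(2)])
      show "v n z = 0" if "z \<notin> S n" for z using \<phi>(4)[OF that] by (simp add: v_def)
      show "(if z \<in> U then q n z * k z + of_real (\<phi> n z) * 0 else 0) = 0" if "z \<in> Z" for z
        using q0[of z n] \<phi>(6)[of n] that by auto
    qed
  qed
qed


text \<open>Multiplying u by 1 minus a cut-off makes it vanish near \<open>Z\<close>, hence also its
  derivative on \<open>Z\<close>. In the limit the part of the measure off \<open>Z\<close>
  annihilates all test functions.\<close>

lemma integral_restrict_compact:
  assumes CT: "AE z in lborel. z \<notin> Z \<longrightarrow> cauchy_transform z = 0" and Z: "compact Z"
    and u: "wirtinger UNIV u p q" and S: "compact S" and 0: "\<And>z. z \<notin> S \<Longrightarrow> u z = 0"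
  shows "(LINT \<omega>|M. c \<omega> * ((1 - indicator Z (x \<omega>)) * u (x \<omega>))) = 0"
proof -
  obtain \<phi> :: "nat \<Rightarrow> complex \<Rightarrow> real" and p' q' T V where \<phi>:
    "\<And>n. wirtinger UNIV (\<lambda>z. of_real (\<phi> n z)) (p' n) (q' n)"
    "\<And>n. open (V n)" "\<And>n. Z \<subseteq> V n" "\<And>n z. z \<in> V n \<Longrightarrow> \<phi> n z = 1"
    "\<And>n z. \<bar>\<phi> n z\<bar> \<le> 1" "\<And>z. (\<lambda>n. \<phi> n z) \<longlonglongrightarrow> indicator Z z"
    using cutoff_sequence[OF Z open_UNIV subset_UNIV] by metis
  have cu: "continuous_on UNIV u" by (rule wirtinger_continuous[OF u])
  obtain b where b: "b \<ge> 0" "\<And>z. norm (u z) \<le> b"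
    using bounded_continuous_compact_support[OF cu S 0] by metis
  define v where "v n z = (1 - of_real (\<phi> n z)) * u z" for n z
  define Q where "Q n z = (0 + - 1 * q' n z) * u z + (1 + - 1 * of_real (\<phi> n z)) * q z" for n z
  have "\<exists>P. wirtinger UNIV (v n) P (Q n)" for n
    using wirtinger_mult[OF wirtinger_add[OF wirtinger_const[OF open_UNIV, of 1] wirtinger_cmult[OF \<phi>(1)[of n], of "- 1"]] u]
    by (intro exI, rule wirtinger_cong) (simp_all add: v_def Q_def)
  then obtain P where vw: "\<And>n. wirtinger UNIV (v n) (P n) (Q n)" by metis
  have cv: "continuous_on UNIV (v n)" for n by (rule wirtinger_continuous[OF vw])
  have lim: "(\<lambda>n. v n z) \<longlonglongrightarrow> (1 - indicator Z z) * u z" for z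
  proof -
    have "(\<lambda>n. v n z) \<longlonglongrightarrow> (1 - of_real (indicator Z z)) * u z"
      unfolding v_def by (intro tendsto_intros \<phi>(6))
    then show ?thesis by (simp add: of_real_indicator)
  qed
  have vm: "(\<lambda>\<omega>. v n (x \<omega>)) \<in> borel_measurable M" for n
    by (rule measurable_compose[OF x borel_measurable_continuous_onI[OF cv]])
  have gm: "(\<lambda>\<omega>. (1 - indicator Z (x \<omega>)) * u (x \<omega>)) \<in> borel_measurable M"
    by (rule borel_measurable_LIMSEQ_metric[OF vm lim])
  show ?thesis
  proof (rule integral_dominated_limit[where f = v and b = "2 * b" and g = "\<lambda>z. (1 - indicator Z z) * u z", OF vm gm _ lim])
    show "norm (v n z) \<le> 2 * b" for n z
    proof -
      have "norm (1 - complex_of_real (\<phi> n z)) \<le> norm (1::complex) + norm (complex_of_real (\<phi> n z))"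
        by (rule norm_triangle_ineq4)
      then have "norm (1 - complex_of_real (\<phi> n z)) \<le> 2" using \<phi>(5)[of n z] by simp
      from mult_mono[OF this b(2)[of z]] show ?thesis by (simp add: v_def norm_mult)
    qed
    show "(LINT \<omega>|M. c \<omega> * v n (x \<omega>)) = 0" for n
    proof (rule integral_wirtinger_zero[OF CT vw S])
      show "v n z = 0" if "z \<notin> S" for z using 0[OF that] by (simp add: v_def)
      show "Q n z = 0" if "z \<in> Z" for z
      proof -
        have "z \<in> V n" using that \<phi>(3) by blast
        from wirtinger_unique(2)[OF vw[of n] wirtinger_const[OF \<phi>(2)[of n], of 0] \<phi>(2)[of n] _ _ _ this]
        show ?thesis using \<phi>(4)[of _ n] by (simp add: v_def)
      qed
    qed
  qed
qed

text \<open>The measure is split at \<open>Z\<close>. For the part on \<open>Z\<close>, with weight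
  \<open>d\<close>, the Cauchy kernel at \<zeta> is holomorphic near \<open>Z\<close> when \<zeta>
  is off \<open>Z\<close>, and otherwise a dominated limit of functions holomorphic off compact
  subsets of a single complementary component.\<close>

theorem integral_wirtinger_eq_zero:
  assumes CT: "AE z in lborel. z \<notin> Z \<longrightarrow> cauchy_transform z = 0" and Z: "compact Z"
    and int: "interior Z = {}" and fc: "finitely_connected Z"
    and u: "wirtinger UNIV u p q" and S: "compact S" and 0: "\<And>z. z \<notin> S \<Longrightarrow> u z = 0"
  shows "(LINT \<omega>|M. c \<omega> * u (x \<omega>)) = 0"
proof -
  have Zm [measurable]: "Z \<in> sets borel" using Z by (simp add: borel_compact)
  define d where "d \<omega> = c \<omega> * indicator Z (x \<omega>)" for \<omega>
  have dm: "d \<in> borel_measurable M" unfolding d_def[abs_def] by measurable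
  have nu: "weighted_points M d x r"
  proof
    show "integrable M d"
      by (rule Bochner_Integration.integrable_bound[OF c dm]) (auto simp: d_def indicator_def)
    show "norm (x \<omega>) \<le> r" if "d \<omega> \<noteq> 0" for \<omega> using that supp by (auto simp: d_def)
  qed (rule x)
  interpret nu: weighted_points M d x r by (rule nu)
  have hol: "(LINT \<omega>|M. d \<omega> * k (x \<omega>)) = 0" if U: "open U" "Z \<subseteq> U" and k: "k holomorphic_on U" for U k
    using integral_holomorphic_on_zero[OF CT Z U k] by (simp add: d_def mult.assoc)
  have "AE \<zeta> in lborel. nu.cauchy_transform \<zeta> = 0"
    using nu.AE_integrable AE_off_diagonal
  proof eventually_elim
    case (elim \<zeta>)
    show ?case
    proof (cases "\<zeta> \<in> Z")
      case False
      have "(LINT \<omega>|M. d \<omega> * (1 / (x \<omega> - \<zeta>))) = 0"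
        by (rule hol[of "- {\<zeta>}" "\<lambda>z. 1 / (z - \<zeta>)"]) (use False in \<open>auto intro!: holomorphic_intros\<close>)
      then show ?thesis by (simp add: nu.cauchy_transform_def)
    next
      case True
      obtain K where K: "K \<in> components (- Z)" "\<zeta> \<in> closure K"
        by (rule in_closure_of_component[OF Z fc int True]) (rule that)
      have opZ: "open (- Z)" using Z by (simp add: compact_imp_closed open_Compl)
      have K': "open K" "connected K" "K \<noteq> {}" "K \<subseteq> - Z"
        using open_components[OF opZ K(1)] in_components_connected[OF K(1)]
          in_components_nonempty[OF K(1)] in_components_subset[OF K(1)] by auto
      have \<zeta>K: "\<zeta> \<notin> K" using K'(4) True by blast
      obtain k :: "nat \<Rightarrow> complex \<Rightarrow> complex" and \<Gamma> where k:
        "\<And>n. compact (\<Gamma> n)" "\<And>n. \<Gamma> n \<subseteq> K" "\<And>n. k n holomorphic_on - \<Gamma> n"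
        "\<And>n z. z \<notin> K \<Longrightarrow> z \<noteq> \<zeta> \<Longrightarrow> norm (k n z) \<le> 146 / norm (z - \<zeta>)"
        "\<And>z. z \<notin> K \<Longrightarrow> z \<noteq> \<zeta> \<Longrightarrow> (\<lambda>n. k n z) \<longlonglongrightarrow> 1 / (z - \<zeta>)"
        using cauchy_kernel_approximation[OF K'(1-3) K(2) \<zeta>K] by metis
      have kz: "(LINT \<omega>|M. d \<omega> * k n (x \<omega>)) = 0" for n
        by (rule hol[OF _ _ k(3)[of n]]) (use k(1,2)[of n] K'(4) in \<open>auto simp: compact_imp_closed open_Compl\<close>)
      have lim: "AE \<omega> in M. (\<lambda>n. d \<omega> * k n (x \<omega>)) \<longlonglongrightarrow> d \<omega> / (x \<omega> - \<zeta>)"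
        using elim(2)
      proof eventually_elim
        case (elim \<omega>)
        show ?case
        proof (cases "x \<omega> \<in> Z")
          case True
          then have "x \<omega> \<notin> K" using K'(4) by blast
          from tendsto_mult_left[OF k(5)[OF this elim], of "d \<omega>"] show ?thesis by simp
        qed (simp add: d_def)
      qed
      have bd: "AE \<omega> in M. norm (d \<omega> * k n (x \<omega>)) \<le> 146 * norm (d \<omega> / (x \<omega> - \<zeta>))" for n
        using elim(2)
      proof eventually_elim
        case (elim \<omega>)
        show ?case
        proof (cases "x \<omega> \<in> Z")
          case True
          then have "x \<omega> \<notin> K" using K'(4) by blast
          from mult_left_mono[OF k(4)[OF this elim, of n] norm_ge_zero[of "d \<omega>"]]
          show ?thesis by (simp add: norm_mult norm_divide mult.commute)
        qed (simp add: d_def)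
      qed
      \<comment> \<open>\<open>k n\<close> is controlled only off \<Gamma> n, so measurability goes
        through an indicator; it changes nothing because \<open>d\<close> is zero off
        \<open>Z\<close> and \<Gamma> n is disjoint from \<open>Z\<close>.\<close>
      have km: "(\<lambda>\<omega>. d \<omega> * k n (x \<omega>)) \<in> borel_measurable M" for n
      proof -
        have cl: "- \<Gamma> n \<in> sets borel" using k(1)[of n] by (intro borel_comp) (simp add: borel_compact)
        have "continuous_on (- \<Gamma> n) (k n)" by (rule holomorphic_on_imp_continuous_on[OF k(3)])
        from borel_measurable_continuous_on_indicator[OF cl this]
        have "(\<lambda>z. indicator (- \<Gamma> n) z *\<^sub>R k n z) \<in> borel_measurable borel" .
        then have "(\<lambda>\<omega>. indicator (- \<Gamma> n) (x \<omega>) *\<^sub>R k n (x \<omega>)) \<in> borel_measurable M"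
          by (rule measurable_compose[OF x])
        then have "(\<lambda>\<omega>. d \<omega> * (indicator (- \<Gamma> n) (x \<omega>) *\<^sub>R k n (x \<omega>))) \<in> borel_measurable M"
          using dm by (intro borel_measurable_times)
        moreover have "d \<omega> * (indicator (- \<Gamma> n) (x \<omega>) *\<^sub>R k n (x \<omega>)) = d \<omega> * k n (x \<omega>)" for \<omega>
          using k(2)[of n] K'(4) by (auto simp: d_def indicator_def)
        ultimately show ?thesis by simp
      qed
      have "(\<lambda>n. LINT \<omega>|M. d \<omega> * k n (x \<omega>)) \<longlonglongrightarrow> (LINT \<omega>|M. d \<omega> / (x \<omega> - \<zeta>))"
        by (rule integral_dominated_convergence[OF borel_measurable_integrable[OF elim(1)] km
              integrable_mult_right[OF integrable_norm[OF elim(1)]] lim bd])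
      then have "(\<lambda>n::nat. 0::complex) \<longlonglongrightarrow> (LINT \<omega>|M. d \<omega> / (x \<omega> - \<zeta>))" by (simp only: kz)
      from LIMSEQ_unique[OF this tendsto_const] show ?thesis by (simp add: nu.cauchy_transform_def)
    qed
  qed
  \<comment> \<open>With the empty set in place of \<open>Z\<close>, the requirement on the
    derivative of the test function is vacuous.\<close>
  then have "AE \<zeta> in lborel. \<zeta> \<notin> {} \<longrightarrow> nu.cauchy_transform \<zeta> = 0" by simp
  from nu.integral_wirtinger_zero[OF this u S 0]
  have 1: "(LINT \<omega>|M. d \<omega> * u (x \<omega>)) = 0" by simp
  have 2: "(LINT \<omega>|M. c \<omega> * ((1 - indicator Z (x \<omega>)) * u (x \<omega>))) = 0"
    by (rule integral_restrict_compact[OF CT Z u S 0])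
  have cu: "continuous_on (cball 0 r) u"
    by (rule continuous_on_subset[OF wirtinger_continuous[OF u]]) simp
  have i: "integrable M (\<lambda>\<omega>. c \<omega> * u (x \<omega>))" "integrable M (\<lambda>\<omega>. d \<omega> * u (x \<omega>))"
    using integrable_continuous[OF cu] nu.integrable_continuous[OF cu] .
  have "(LINT \<omega>|M. c \<omega> * u (x \<omega>)) - (LINT \<omega>|M. d \<omega> * u (x \<omega>)) = (LINT \<omega>|M. c \<omega> * u (x \<omega>) - d \<omega> * u (x \<omega>))"
    by (rule Bochner_Integration.integral_diff[OF i, symmetric])
  also have "(\<lambda>\<omega>. c \<omega> * u (x \<omega>) - d \<omega> * u (x \<omega>)) = (\<lambda>\<omega>. c \<omega> * ((1 - indicator Z (x \<omega>)) * u (x \<omega>)))"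
    by (simp add: d_def fun_eq_iff algebra_simps)
  finally show ?thesis using 1 2 by simp
qed

text \<open>Compactly supported C^1 functions are uniformly dense in the continuous functions on the
  disc, and the total weight is finite.\<close>

theorem integral_continuous_zero:
  assumes test: "\<And>u p q S. wirtinger UNIV u p q \<Longrightarrow> compact S \<Longrightarrow> (\<And>z. z \<notin> S \<Longrightarrow> u z = 0)
      \<Longrightarrow> (LINT \<omega>|M. c \<omega> * u (x \<omega>)) = 0"
    and g: "continuous_on (cball 0 r) g"
  shows "(LINT \<omega>|M. c \<omega> * g (x \<omega>)) = 0"
proof -
  define I where "I = (LINT \<omega>|M. norm (c \<omega>))"
  have I: "I \<ge> 0" unfolding I_def by (rule integral_nonneg_AE) auto
  have gi: "integrable M (\<lambda>\<omega>. c \<omega> * g (x \<omega>))" by (rule integrable_continuous[OF g])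
  have "norm (LINT \<omega>|M. c \<omega> * g (x \<omega>)) \<le> 0 + e" if e: "e > 0" for e
  proof -
    define e' where "e' = e / (I + 1)"
    have e': "e' > 0" using e I by (simp add: e'_def)
    obtain u p q R where u: "wirtinger UNIV u p q" "\<And>z. z \<notin> cball 0 R \<Longrightarrow> u z = 0"
      "\<And>z. z \<in> cball 0 r \<Longrightarrow> norm (g z - u z) < e'"
      using wirtinger_approximation[OF g e'] by metis
    have cu: "continuous_on (cball 0 r) u"
      by (rule continuous_on_subset[OF wirtinger_continuous[OF u(1)]]) simp
    have ui: "integrable M (\<lambda>\<omega>. c \<omega> * u (x \<omega>))" by (rule integrable_continuous[OF cu])
    have "(LINT \<omega>|M. c \<omega> * u (x \<omega>)) = 0" by (rule test[OF u(1) compact_cball u(2)])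
    then have "(LINT \<omega>|M. c \<omega> * g (x \<omega>)) = (LINT \<omega>|M. c \<omega> * g (x \<omega>) - c \<omega> * u (x \<omega>))"
      by (simp add: Bochner_Integration.integral_diff[OF gi ui])
    also have "norm \<dots> \<le> (LINT \<omega>|M. norm (c \<omega> * g (x \<omega>) - c \<omega> * u (x \<omega>)))"
      by (rule integral_norm_bound)
    also have "\<dots> \<le> (LINT \<omega>|M. norm (c \<omega>) * e')"
    proof (rule integral_mono)
      show "integrable M (\<lambda>\<omega>. norm (c \<omega> * g (x \<omega>) - c \<omega> * u (x \<omega>)))"
        by (intro integrable_norm Bochner_Integration.integrable_diff gi ui)
      show "integrable M (\<lambda>\<omega>. norm (c \<omega>) * e')" using c by (intro integrable_mult_left integrable_norm)
      show "norm (c \<omega> * g (x \<omega>) - c \<omega> * u (x \<omega>)) \<le> norm (c \<omega>) * e'" for \<omega>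
      proof (cases "c \<omega> = 0")
        case False
        then have "x \<omega> \<in> cball 0 r" using supp by simp
        from mult_left_mono[OF less_imp_le[OF u(3)[OF this]] norm_ge_zero[of "c \<omega>"]]
        show ?thesis by (simp add: right_diff_distrib[symmetric] norm_mult)
      qed simp
    qed
    also have "\<dots> = I * e'" by (simp add: I_def)
    also have "\<dots> \<le> e" using I e by (simp add: e'_def field_simps)
    finally show ?thesis by simp
  qed
  from field_le_epsilon[OF this] show ?thesis by simp
qed

end

section \<open>Continuity of F and the concluding duality argument\<close>

lemma holder_on_continuous:
  assumes "0 < \<alpha>" "holder_on \<alpha> S f"
  shows "continuous_on S f"
  unfolding continuous_on_def
proof
  fix z assume z: "z \<in> S"
  obtain L where L: "\<And>z w. z \<in> S \<Longrightarrow> w \<in> S \<Longrightarrow> norm (f z - f w) \<le> L * norm (z - w) powr \<alpha>"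
    using assms(2) unfolding holder_on_def by blast
  have "((\<lambda>w. L * norm (w - z) powr \<alpha>) \<longlongrightarrow> L * norm (z - z) powr \<alpha>) (at z within S)"
    using assms(1) by (intro tendsto_intros tendsto_powr2) auto
  then have lim: "((\<lambda>w. L * norm (w - z) powr \<alpha>) \<longlongrightarrow> 0) (at z within S)" by simp
  have "((\<lambda>w. f w - f z) \<longlongrightarrow> 0) (at z within S)"
    by (rule Lim_null_comparison[OF _ lim]) (auto simp: eventually_at_filter L z)
  then show "(f \<longlongrightarrow> f z) (at z within S)" by (rule LIM_zero_cancel)
qed

theorem theorem1p3:
  fixes F A :: "complex \<Rightarrow> complex" and E :: "complex set"
    and r \<alpha> M K \<nu> :: real
  assumes "r > 0" and "0 < \<alpha>" and "\<alpha> < 1"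
    and "holder_on \<alpha> (cball 0 r) F"
    and "E \<subseteq> cball 0 r" and "nowhere_dense E"
    and "A \<in> hol_on_closed (cball 0 r)" and "\<forall>z\<in>cball 0 r. A z \<noteq> 0"
    and "M > 0" and "K > 0" and "\<nu> \<ge> 1"
    and "\<forall>\<zeta>\<in>cball 0 r - E.
           \<exists>G \<in> hol_on_closed_zero (cball 0 r) \<zeta>. \<exists>C :: complex.
             (\<forall>z\<in>cball 0 r - {\<zeta>}. inverse (norm (z - \<zeta>)) * norm (G z) \<le> M) \<and>
             norm C = 1 \<and>
             (\<forall>z\<in>cball 0 r. C * (z - \<zeta>) * (A z * F z - A \<zeta> * F \<zeta> + G z)
                \<in> {w. Re w \<ge> 0 \<and> \<bar>Im w\<bar> \<le> K * Re w powr (1 / \<nu>)})"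
  shows "polynomially_convex (graph_on (cball 0 r) F) \<and>
         (C1_on (cball 0 r) F \<and>
          nowhere_dense {z \<in> cball 0 r. dbar (cball 0 r) F z = 0} \<and>
          finitely_connected {z \<in> cball 0 r. dbar (cball 0 r) F z = 0}
          \<longrightarrow> uniform_algebra_gen (cball 0 r) (\<lambda>z. z) F = cont_funs (cball 0 r))"
proof (intro conjI impI)
  have F: "continuous_on (cball 0 r) F" by (rule holder_on_continuous[OF assms(2,4)])
  show "polynomially_convex (graph_on (cball 0 r) F)"
    by (rule polynomially_convex_graph[OF assms(1) F assms(6-12)])
  let ?D = "cball (0::complex) r" and ?q = "dbar (cball 0 r) F"
  let ?v = "\<lambda>z. vector [z, F z] :: complex ^ 2"
  assume C1: "C1_on ?D F \<and> nowhere_dense {z \<in> ?D. ?q z = 0} \<and> finitely_connected {z \<in> ?D. ?q z = 0}"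
  define Z where "Z = {z \<in> ?D. ?q z = 0}"
  have q: "continuous_on ?D ?q" using C1_on_wirtinger(2)[OF assms(1)] C1 by blast
  obtain p where Fw: "wirtinger (ball 0 r) F p ?q" using C1_on_wirtinger(3)[OF assms(1)] C1 by blast
  have "closed Z" unfolding Z_def using continuous_closed_preimage_constant[OF q closed_cball] by simp
  then have Z: "compact Z" using compact_Int_closed[OF compact_cball, of Z 0 r] by (simp add: Z_def Int_def conj_ac)
  have intZ: "interior Z = {}" using C1 \<open>closed Z\<close> by (simp add: nowhere_dense_def Z_def)
  have fc: "finitely_connected Z" using C1 by (simp add: Z_def)
  show "uniform_algebra_gen ?D (\<lambda>z. z) F = cont_funs ?D"
  proof (rule ccontr)
    assume "\<not> ?thesis"
    then obtain h where h: "continuous_on ?D h" "h \<notin> uniform_algebra_gen ?D (\<lambda>z. z) F"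
      unfolding uniform_algebra_gen_def cont_funs_def by blast
    then obtain \<epsilon> where \<epsilon>: "\<epsilon> > 0" "\<And>p. hol_polynomial p \<Longrightarrow> \<exists>z\<in>?D. \<epsilon> \<le> norm (h z - p (?v z))"
      unfolding uniform_algebra_gen_def cont_funs_def by (auto simp: not_less)
    define B where "B = {f. \<exists>p. hol_polynomial p \<and> f = (\<lambda>z. p (?v z))}"
    have D: "compact ?D" "convex ?D" "?D \<noteq> {}" using assms(1) by auto
    obtain N :: "(complex \<times> complex) measure" and c where N: "finite_measure N" "sets N = sets borel"
      and c: "c \<in> borel_measurable borel" "\<And>y. norm (c y) \<le> 1" "\<And>y. fst y \<notin> ?D \<Longrightarrow> c y = 0"
      and ann: "\<And>f. f \<in> B \<Longrightarrow> (LINT y|N. c y * f (fst y)) = 0"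
      and ne: "(LINT y|N. c y * h (fst y)) \<noteq> 0"
    proof (rule annihilating_measure[OF D _ _ _ _ h(1) \<epsilon>(1), of B])
      show "(\<lambda>_. 0) \<in> B" unfolding B_def using hol_polynomial_const[of 0] by blast
      show "(\<lambda>z. f z + g z) \<in> B" if "f \<in> B" "g \<in> B" for f g
        using that hol_polynomial_add unfolding B_def by blast
      show "(\<lambda>z. a * f z) \<in> B" if "f \<in> B" for a f
        using that hol_polynomial_mult[OF hol_polynomial_const[of a]] unfolding B_def by blast
      show "continuous_on ?D f" if "f \<in> B" for f
      proof -
        obtain p where p: "hol_polynomial p" "f = (\<lambda>z. p (?v z))" using \<open>f \<in> B\<close> unfolding B_def by blast
        show ?thesis unfolding p(2)
          by (rule continuous_on_compose2[OF continuous_on_hol_polynomial[OF p(1)] continuous_on_graph_map[OF F] subset_UNIV])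
      qed
      show "\<exists>z\<in>?D. \<epsilon> \<le> norm (h z - f z)" if "f \<in> B" for f
        using that \<epsilon>(2) unfolding B_def by blast
    qed (rule that)
    interpret N: finite_measure N by (rule N(1))
    have cm: "c \<in> borel_measurable N" using c(1) N(2) measurable_cong_sets by blast
    \<comment> \<open>\<open>fst\<close> is the position in the disc and \<open>c\<close> the
      complex weight, so the image under \<open>fst\<close> is the annihilating complex
      measure.\<close>
    interpret weighted_points N c fst r
    proof
      show "integrable N c" by (rule N.integrable_const_bound[OF _ cm, of 1]) (simp add: c(2))
      have "fst \<in> borel_measurable (borel :: (complex \<times> complex) measure)"
        by (intro borel_measurable_continuous_onI continuous_intros)
      then show "fst \<in> borel_measurable N" using N(2) measurable_cong_sets by blast
      show "norm (fst y) \<le> r" if "c y \<noteq> 0" for y using c(3)[of y] that by auto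
    qed
    have annp: "(LINT y|N. c y * p (?v (fst y))) = 0" if "hol_polynomial p" for p
      using ann[of "\<lambda>z. p (?v z)"] that unfolding B_def by blast
    have CT: "AE z in lborel. z \<notin> Z \<longrightarrow> cauchy_transform z = 0"
      unfolding Z_def
      by (rule cauchy_transform_zero_off_critical_set[OF assms(1) F q Fw assms(6-9,11,12) annp])
    have "(LINT y|N. c y * h (fst y)) = 0"
      by (rule integral_continuous_zero[OF integral_wirtinger_eq_zero[OF CT Z intZ fc] h(1)])
    then show False using ne by simp
  qed
qed

end
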